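(* Let $\mathbb M^3\subset\mathbb C^{1+8}$ be the rigid real analytic CR-generic submanifold given in coordinates $(z,w^1,\dots,w^8)$ by $$w^1-\overline w^1=2i\,z\overline z,\quad w^2-\overline w^2=2i(z^2\overline z+z\overline z^2),\quad w^3-\overline w^3=2(z^2\overline z-z\overline z^2),\quad w^4-\overline w^4=2i(z^3\overline z+z\overline z^3),$$ $$w^5-\overline w^5=2(z^3\overline z-z\overline z^3),\quad w^6-\overline w^6=2i\,z^2\overline z^2,\quad w^7-\overline w^7=2i(z^3\overline z^2+z^2\overline z^3),\quad w^8-\overline w^8=2i(z^4\overline z+z\overline z^4).$$ The Lie algebra of infinitesimal CR-automorphisms $\mathfrak{aut}_{CR}(\mathbb M^3)$ is $11$-dimensional: its elements $Z\,\partial_z+\sum_{l=1}^8W^l\,\partial_{w^l}$ are those with coefficients $$\begin{aligned} Z&=(\mathsf c+i\mathsf d)+\mathsf a z,\\ W^1&=\mathsf c_1+2\mathsf a w^1+2(\mathsf d+i\mathsf c)z,\\ W^2&=\mathsf c_2+4\mathsf c w^1+3\mathsf a w^2+2(\mathsf d+i\mathsf c)z^2,\\ W^3&=\mathsf c_3+4\mathsf d w^1+3\mathsf a w^3+2(\mathsf c-i\mathsf d)z^2,\\ W^4&=\mathsf c_4+3\mathsf c w^2-3\mathsf d w^3+4\mathsf a w^4+2(\mathsf d+i\mathsf c)z^3,\\ W^5&=\mathsf c_5+3\mathsf d w^2+3\mathsf c w^3+4\mathsf a w^5+2(\mathsf c-i\mathsf d)z^3,\\ W^6&=\mathsf c_6+2\mathsf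 c w^2+2\mathsf d w^3+4\mathsf a w^6,\\ W^7&=\mathsf c_7+2\mathsf c w^4+2\mathsf d w^5+6\mathsf c w^6+5\mathsf a w^7,\\ W^8&=\mathsf c_8+4\mathsf c w^4-4\mathsf d w^5+5\mathsf a w^8+2(\mathsf d+i\mathsf c)z^4, \end{aligned}$$ with real parameters $\mathsf c_1,\dots,\mathsf c_8,\mathsf a,\mathsf c,\mathsf d\in\mathbb R$; and it is generated by the eleven $\mathbb R$-linearly independent holomorphic vector fields $\mathsf X_i=\partial_{w^i}$, $i=1,\dots,8$, and $$\mathsf X_9=z\partial_z+2w^1\partial_{w^1}+3w^2\partial_{w^2}+3w^3\partial_{w^3}+4w^4\partial_{w^4}+4w^5\partial_{w^5}+4w^6\partial_{w^6}+5w^7\partial_{w^7}+5w^8\partial_{w^8},$$ $$\mathsf X_{10}=\partial_z+2iz\partial_{w^1}+(4w^1+2iz^2)\partial_{w^2}+2z^2\partial_{w^3}+(3w^2+2iz^3)\partial_{w^4}+(3w^3+2z^3)\partial_{w^5}+2w^2\partial_{w^6}+(2w^4+6w^6)\partial_{w^7}+(4w^4+2iz^4)\partial_{w^8},$$ $$\mathsf X_{11}=i\partial_z+2z\partial_{w^1}+2z^2\partial_{w^2}+(4w^1-2iz^2)\partial_{w^3}+(-3w^3+2z^3)\partial_{w^4}+(3w^2-2iz^3)\partial_{w^5}+2w^3\partial_{w^6}+2w^5\partial_{w^7}+(-4w^5+2z^4)\partial_{w^8}.$$ Furthermore, it is graded of the form $\mathfrak{aut}_{CR}(\mathbb M^3)=\mathfrak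 g_{-5}\oplus\mathfrak g_{-4}\oplus\mathfrak g_{-3}\oplus\mathfrak g_{-2}\oplus\mathfrak g_{-1}\oplus\mathfrak g_0$ with $\mathfrak g_{-5}=\langle\mathsf X_7,\mathsf X_8\rangle$, $\mathfrak g_{-4}=\langle\mathsf X_4,\mathsf X_5,\mathsf X_6\rangle$, $\mathfrak g_{-3}=\langle\mathsf X_2,\mathsf X_3\rangle$, $\mathfrak g_{-2}=\langle\mathsf X_1\rangle$, $\mathfrak g_{-1}=\langle\mathsf X_{10},\mathsf X_{11}\rangle$, $\mathfrak g_0=\langle\mathsf X_9\rangle$, and with the following commutators: $[\mathsf X_i,\mathsf X_j]=0$ for $1\le i,j\le8$; $[\mathsf X_1,\mathsf X_9]=2\mathsf X_1$, $[\mathsf X_1,\mathsf X_{10}]=4\mathsf X_2$, $[\mathsf X_1,\mathsf X_{11}]=4\mathsf X_3$; $[\mathsf X_2,\mathsf X_9]=3\mathsf X_2$, $[\mathsf X_2,\mathsf X_{10}]=3\mathsf X_4+2\mathsf X_6$, $[\mathsf X_2,\mathsf X_{11}]=3\mathsf X_5$; $[\mathsf X_3,\mathsf X_9]=3\mathsf X_3$, $[\mathsf X_3,\mathsf X_{10}]=3\mathsf X_5$, $[\mathsf X_3,\mathsf X_{11}]=-3\mathsf X_4+2\mathsf X_6$; $[\mathsf X_4,\mathsf X_9]=4\mathsf X_4$, $[\mathsf X_4,\mathsf X_{10}]=2\mathsf X_7+4\mathsf X_8$, $[\mathsf X_4,\mathsf X_{11}]=0$; $[\mathsf X_5,\mathsf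 X_9]=4\mathsf X_5$, $[\mathsf X_5,\mathsf X_{10}]=0$, $[\mathsf X_5,\mathsf X_{11}]=2\mathsf X_7-4\mathsf X_8$; $[\mathsf X_6,\mathsf X_9]=4\mathsf X_6$, $[\mathsf X_6,\mathsf X_{10}]=6\mathsf X_7$, $[\mathsf X_6,\mathsf X_{11}]=0$; $[\mathsf X_7,\mathsf X_9]=5\mathsf X_7$, $[\mathsf X_8,\mathsf X_9]=5\mathsf X_8$, $[\mathsf X_7,\mathsf X_{10}]=[\mathsf X_7,\mathsf X_{11}]=[\mathsf X_8,\mathsf X_{10}]=[\mathsf X_8,\mathsf X_{11}]=0$; $[\mathsf X_9,\mathsf X_{10}]=-\mathsf X_{10}$, $[\mathsf X_9,\mathsf X_{11}]=-\mathsf X_{11}$, $[\mathsf X_{10},\mathsf X_{11}]=4\mathsf X_1$.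
   Context: For a real analytic CR-generic submanifold $M\subset\mathbb C^{1+8}$ through the origin, an infinitesimal CR-automorphism of $M$ is a $(1,0)$ vector field $\mathsf X=Z(z,w)\,\partial_z+\sum_{l=1}^8W^l(z,w)\,\partial_{w^l}$ with coefficients holomorphic near the origin such that $\mathsf X+\overline{\mathsf X}$ is tangent to $M$. These form the real Lie algebra $\mathfrak{aut}_{CR}(M)$. "Rigid" means that the right-hand sides of the defining equations do not depend on $w$. Superscripts on $w$ are indices. $\langle\cdot\rangle$ denotes the real span. A Lie algebra $\mathfrak g$ is graded (in the sense of Tanaka) if $\mathfrak g=\mathfrak g_{-k}\oplus\cdots\oplus\mathfrak g_{k'}$ with $[\mathfrak g_i,\mathfrak g_j]\subset\mathfrak g_{i+j}$. *)

theory Defs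
  imports "HOL-Analysis.Analysis"
begin

text \<open>
  Points of the ambient space are pairs of \<open>z\<close> and \<open>w = (w$1, \<dots>, w$8)\<close>.  The index type \<open>8\<close> has
  the elements 1, ..., 7 and \<open>8 = 0\<close>, so \<open>w$8\<close> is the last coordinate, and
  \<open>vector [a1, \<dots>, a8] $ l\<close> is the \<open>l\<close>-th list entry for \<open>l = 1, \<dots>, 8\<close>.
\<close>

type_synonym C9 = "complex \<times> (complex ^ 8)"

definition cscale :: "complex \<Rightarrow> C9 \<Rightarrow> C9" where
  "cscale c v = (c * fst v, c *s snd v)"

definition holomorphic_fun_on :: "(C9 \<Rightarrow> complex) \<Rightarrow> C9 set \<Rightarrow> bool" where
  "holomorphic_fun_on f U \<longleftrightarrow>
     (\<forall>p\<in>U. \<exists>D. (f has_derivative D) (at p) \<and> (\<forall>c v. D (cscale c v) = c * D v))"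

text \<open>
  A (1,0) vector field, with coefficients \<open>Z\<close> along \<open>\<partial>/\<partial>z\<close> and \<open>W l\<close> along \<open>\<partial>/\<partial>w l\<close>, is
  represented by its coefficient map \<open>p \<mapsto> (Z p, W p)\<close>.
\<close>

definition holomorphic_field_on :: "(C9 \<Rightarrow> C9) \<Rightarrow> C9 set \<Rightarrow> bool" where
  "holomorphic_field_on f U \<longleftrightarrow>
     holomorphic_fun_on (\<lambda>p. fst (f p)) U \<and> (\<forall>l. holomorphic_fun_on (\<lambda>p. snd (f p) $ l) U)"

text \<open>
  Vector fields are considered as germs at the origin: two coefficient maps that agree near the
  origin are identified.  The type contains the germs of all maps; holomorphy is imposed in the
  definition of infinitesimal CR-automorphisms.
\<close>

quotient_type vf_germ = "C9 \<Rightarrow> C9" / "\<lambda>f g. \<forall>\<^sub>F p in nhds 0. f p = g p"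
  morphisms rep_vf_germ vf_germ
proof (rule equivpI)
  show "reflp (\<lambda>(f::C9 \<Rightarrow> C9) g. \<forall>\<^sub>F p in nhds 0. f p = g p)"
    by (simp add: reflp_def)
  show "symp (\<lambda>(f::C9 \<Rightarrow> C9) g. \<forall>\<^sub>F p in nhds 0. f p = g p)"
    by (simp add: symp_def eq_commute)
  show "transp (\<lambda>(f::C9 \<Rightarrow> C9) g. \<forall>\<^sub>F p in nhds 0. f p = g p)"
    unfolding transp_def by (auto elim: eventually_elim2)
qed

instantiation vf_germ :: real_vector
begin

lift_definition zero_vf_germ :: vf_germ is "\<lambda>p. 0" .

lift_definition plus_vf_germ :: "vf_germ \<Rightarrow> vf_germ \<Rightarrow> vf_germ" is "\<lambda>f g p. f p + g p"
  by (auto elim: eventually_elim2)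

lift_definition uminus_vf_germ :: "vf_germ \<Rightarrow> vf_germ" is "\<lambda>f p. - f p"
  by (auto elim: eventually_mono)

lift_definition minus_vf_germ :: "vf_germ \<Rightarrow> vf_germ \<Rightarrow> vf_germ" is "\<lambda>f g p. f p - g p"
  by (auto elim: eventually_elim2)

lift_definition scaleR_vf_germ :: "real \<Rightarrow> vf_germ \<Rightarrow> vf_germ" is "\<lambda>r f p. r *\<^sub>R f p"
  by (auto elim: eventually_mono)

instance
  by standard (transfer; simp add: algebra_simps)+

end

text \<open>
  For (1,0) fields with holomorphic coefficients, \<open>[X, Y]\<close> has the coefficients
  \<open>\<Sum>j. X j * \<partial>j (Y k) - Y j * \<partial>j (X k)\<close>; as the derivative of a holomorphic map is complex
  linear, this is \<open>DY(X) - DX(Y)\<close>.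
\<close>

lemma frechet_derivative_cong_ev:
  assumes "\<forall>\<^sub>F q in nhds p. f q = g q"
  shows "frechet_derivative f (at p) = frechet_derivative g (at p)"
proof -
  have *: "(h' has_derivative D) (at p)"
    if "(h has_derivative D) (at p)" and ev: "\<forall>\<^sub>F q in nhds p. h q = h' q" for h h' D
  proof (rule has_derivative_transform_eventually[OF that(1)])
    show "\<forall>\<^sub>F q in at p. h q = h' q"
      using ev by (auto simp: eventually_at_filter elim: eventually_mono)
    show "h p = h' p"
      using ev by (rule eventually_nhds_x_imp_x)
  qed auto
  have "\<forall>\<^sub>F q in nhds p. g q = f q"
    using assms by (auto elim: eventually_mono)
  then have "(f has_derivative D) (at p) \<longleftrightarrow> (g has_derivative D) (at p)" for D
    using *[of f D g] *[of g D f] assms by blast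
  then show ?thesis
    unfolding frechet_derivative_def by simp
qed

lift_definition lie_bracket :: "vf_germ \<Rightarrow> vf_germ \<Rightarrow> vf_germ" is
  "\<lambda>X Y p. frechet_derivative Y (at p) (X p) - frechet_derivative X (at p) (Y p)"
proof -
  fix X X' Y Y' :: "C9 \<Rightarrow> C9"
  assume "\<forall>\<^sub>F p in nhds 0. X p = X' p" "\<forall>\<^sub>F p in nhds 0. Y p = Y' p"
  then have "\<forall>\<^sub>F p in nhds 0. \<forall>\<^sub>F q in nhds p. X q = X' q"
    "\<forall>\<^sub>F p in nhds 0. \<forall>\<^sub>F q in nhds p. Y q = Y' q"
    by (simp_all add: eventually_eventually)
  then show "\<forall>\<^sub>F p in nhds 0.
      frechet_derivative Y (at p) (X p) - frechet_derivative X (at p) (Y p) =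
      frechet_derivative Y' (at p) (X' p) - frechet_derivative X' (at p) (Y' p)"
  proof eventually_elim
    case (elim p)
    then show ?case
      using frechet_derivative_cong_ev[of X X' p] frechet_derivative_cong_ev[of Y Y' p]
        eventually_nhds_x_imp_x[of "\<lambda>q. X q = X' q" p] eventually_nhds_x_imp_x[of "\<lambda>q. Y q = Y' q" p]
      by simp
  qed
qed

definition real_lie_algebra :: "vf_germ set \<Rightarrow> bool" where
  "real_lie_algebra L \<longleftrightarrow>
     subspace L \<and>
     (\<forall>x\<in>L. \<forall>y\<in>L. lie_bracket x y \<in> L) \<and>
     (\<forall>x\<in>L. \<forall>y\<in>L. \<forall>z\<in>L. \<forall>r s.
        lie_bracket (r *\<^sub>R x + s *\<^sub>R y) z = r *\<^sub>R lie_bracket x z + s *\<^sub>R lie_bracket y z \<and>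
        lie_bracket z (r *\<^sub>R x + s *\<^sub>R y) = r *\<^sub>R lie_bracket z x + s *\<^sub>R lie_bracket z y) \<and>
     (\<forall>x\<in>L. lie_bracket x x = 0) \<and>
     (\<forall>x\<in>L. \<forall>y\<in>L. \<forall>z\<in>L.
        lie_bracket x (lie_bracket y z) + lie_bracket y (lie_bracket z x)
          + lie_bracket z (lie_bracket x y) = 0)"

text \<open>
  The internal direct sum \<open>L = g lo \<oplus> \<dots> \<oplus> g hi\<close> with \<open>[g i, g j] \<subseteq> g (i + j)\<close>, where \<open>g k = 0\<close> outside \<open>{lo..hi}\<close>.
\<close>

definition tanaka_graded :: "vf_germ set \<Rightarrow> int \<Rightarrow> int \<Rightarrow> (int \<Rightarrow> vf_germ set) \<Rightarrow> bool" where
  "tanaka_graded L lo hi g \<longleftrightarrow>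
     real_lie_algebra L \<and>
     (\<forall>k. subspace (g k)) \<and>
     (\<forall>k. k \<notin> {lo..hi} \<longrightarrow> g k = {0}) \<and>
     L = {(\<Sum>k=lo..hi. x k) | x. \<forall>k\<in>{lo..hi}. x k \<in> g k} \<and>
     (\<forall>x. (\<forall>k\<in>{lo..hi}. x k \<in> g k) \<and> (\<Sum>k=lo..hi. x k) = 0 \<longrightarrow> (\<forall>k\<in>{lo..hi}. x k = 0)) \<and>
     (\<forall>i j. \<forall>x\<in>g i. \<forall>y\<in>g j. lie_bracket x y \<in> g (i + j))"

text \<open>
  Velocities of curves in \<open>M\<close>; if \<open>M\<close> is a real submanifold, these are exactly the elements of its
  tangent space at \<open>p \<in> M\<close>.
\<close>

definition tangent_vector :: "C9 set \<Rightarrow> C9 \<Rightarrow> C9 \<Rightarrow> bool" where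
  "tangent_vector M p v \<longleftrightarrow>
     (\<exists>\<gamma> :: real \<Rightarrow> C9. \<gamma> 0 = p \<and> (\<forall>\<^sub>F t in nhds 0. \<gamma> t \<in> M) \<and>
        (\<gamma> has_vector_derivative v) (at 0))"

text \<open>
  In real coordinates, the coefficients of \<open>X + cnj X\<close> along \<open>\<partial>/\<partial>x j\<close> and \<open>\<partial>/\<partial>y j\<close> are the real
  and imaginary parts of the \<open>j\<close>-th coefficient of \<open>X\<close>, since
  \<open>\<partial>/\<partial>z = (\<partial>/\<partial>x - i \<partial>/\<partial>y) / 2\<close>.  Hence the real vector of \<open>X + cnj X\<close> at \<open>p\<close> is \<open>f p\<close>, where \<open>f\<close>
  is the coefficient map of \<open>X\<close>.
\<close>

definition aut_CR :: "C9 set \<Rightarrow> vf_germ set" where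
  "aut_CR M = {vf_germ f | f. \<exists>U. open U \<and> 0 \<in> U \<and> holomorphic_field_on f U \<and>
                  (\<forall>p\<in>M \<inter> U. tangent_vector M p (f p))}"

definition M3 :: "C9 set" where
  "M3 = {(z, w).
     w$1 - cnj (w$1) = 2 * \<i> * z * cnj z \<and>
     w$2 - cnj (w$2) = 2 * \<i> * (z^2 * cnj z + z * cnj z^2) \<and>
     w$3 - cnj (w$3) = 2 * (z^2 * cnj z - z * cnj z^2) \<and>
     w$4 - cnj (w$4) = 2 * \<i> * (z^3 * cnj z + z * cnj z^3) \<and>
     w$5 - cnj (w$5) = 2 * (z^3 * cnj z - z * cnj z^3) \<and>
     w$6 - cnj (w$6) = 2 * \<i> * z^2 * cnj z^2 \<and>
     w$7 - cnj (w$7) = 2 * \<i> * (z^3 * cnj z^2 + z^2 * cnj z^3) \<and>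
     w$8 - cnj (w$8) = 2 * \<i> * (z^4 * cnj z + z * cnj z^4)}"

definition general_field :: "real ^ 8 \<Rightarrow> real \<Rightarrow> real \<Rightarrow> real \<Rightarrow> C9 \<Rightarrow> C9" where
  "general_field k a c d = (\<lambda>(z, w).
     ((c + \<i> * d) + a * z,
      vector
       [k$1 + 2 * a * w$1 + 2 * (d + \<i> * c) * z,
        k$2 + 4 * c * w$1 + 3 * a * w$2 + 2 * (d + \<i> * c) * z^2,
        k$3 + 4 * d * w$1 + 3 * a * w$3 + 2 * (c - \<i> * d) * z^2,
        k$4 + 3 * c * w$2 - 3 * d * w$3 + 4 * a * w$4 + 2 * (d + \<i> * c) * z^3,
        k$5 + 3 * d * w$2 + 3 * c * w$3 + 4 * a * w$5 + 2 * (c - \<i> * d) * z^3,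
        k$6 + 2 * c * w$2 + 2 * d * w$3 + 4 * a * w$6,
        k$7 + 2 * c * w$4 + 2 * d * w$5 + 6 * c * w$6 + 5 * a * w$7,
        k$8 + 4 * c * w$4 - 4 * d * w$5 + 5 * a * w$8 + 2 * (d + \<i> * c) * z^4]))"

text \<open>The last case is \<open>\<partial>/\<partial>w i\<close> for \<open>i = 1, \<dots>, 8\<close>; only the indices 1, ..., 11 are used.\<close>

definition X_field :: "nat \<Rightarrow> C9 \<Rightarrow> C9" where
  "X_field i = (\<lambda>(z, w).
     if i = 9 then
       (z, vector [2 * w$1, 3 * w$2, 3 * w$3, 4 * w$4, 4 * w$5, 4 * w$6, 5 * w$7, 5 * w$8])
     else if i = 10 then
       (1, vector [2 * \<i> * z, 4 * w$1 + 2 * \<i> * z^2, 2 * z^2, 3 * w$2 + 2 * \<i> * z^3,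
          3 * w$3 + 2 * z^3, 2 * w$2, 2 * w$4 + 6 * w$6, 4 * w$4 + 2 * \<i> * z^4])
     else if i = 11 then
       (\<i>, vector [2 * z, 2 * z^2, 4 * w$1 - 2 * \<i> * z^2, - 3 * w$3 + 2 * z^3,
          3 * w$2 - 2 * \<i> * z^3, 2 * w$3, 2 * w$5, - 4 * w$5 + 2 * z^4])
     else (0, axis (of_nat i) 1))"

definition XX :: "nat \<Rightarrow> vf_germ" where
  "XX i = vf_germ (X_field i)"

definition gg :: "int \<Rightarrow> vf_germ set" where
  "gg k = (if k = -5 then span {XX 7, XX 8}
     else if k = -4 then span {XX 4, XX 5, XX 6}
     else if k = -3 then span {XX 2, XX 3}
     else if k = -2 then span {XX 1}
     else if k = -1 then span {XX 10, XX 11}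
     else if k = 0 then span {XX 9}
     else {0})"

end

theory Submission
  imports Defs "HOL-Complex_Analysis.Conformal_Mappings"
begin

text \<open>
  Write the equations of \<open>M3\<close> as \<open>w - cnj w = Phi z (cnj z)\<close>, where \<open>Phi\<close> is a polynomial in two
  independent variables.  Grouped by monomials, its coefficients are eight vectors \<open>b11\<close>, \<dots>, \<open>b41\<close>
  that form a basis of the \<open>w\<close>-space.  That the listed fields are symmetries is a computation; the
  content of the theorem is that there are no others.

  For a symmetry with coefficients \<open>Z\<close>, \<open>W\<close>, tangency is the identity
  \<open>W - cnj W = dPhi z (cnj z) Z (cnj Z)\<close> along \<open>M3\<close>.  By the identity theorem in one variable it
  persists when \<open>cnj z\<close> and \<open>cnj w\<close> are replaced by independent variables \<open>\<zeta>\<close> and \<open>x\<close> with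
  \<open>w = x + Phi z \<zeta>\<close> (lemma \<open>complexification\<close>).  Putting \<open>\<zeta> = 0\<close> or \<open>z = 0\<close> expresses \<open>W\<close> through
  \<open>A x = W 0 x\<close> and \<open>Z 0\<close>, so what remains are formulas for the increments \<open>A (x + Phi z \<zeta>) - A x\<close>.

  These increments are read off by limits of first order only.  Dividing by \<open>z\<close> and letting
  \<open>z \<rightarrow> 0\<close> gives derivatives of \<open>A\<close> along those basis vectors whose monomials have degree one in \<open>z\<close>.
  If these derivatives vanish, then the function does not change when its argument moves along these
  vectors; the corresponding terms of \<open>Phi\<close> may be dropped, the rest is divisible by \<open>z^2\<close>, and the
  next coefficients are again a limit of first order (\<open>tendsto_increment\<close>).  The same applies to \<open>\<zeta>\<close>.
  In this way neither second derivatives nor power series in several variables enter.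

  The seventh component, the sixth, and the combination of the fourth and fifth show that \<open>Z 0\<close> is
  constant (\<open>Z0_constant\<close>).  A member of the explicit family can now be subtracted so that \<open>Z\<close> and
  \<open>W\<close> vanish at the origin and the dilation part is zero.  After that only two unknown functions
  occur in all eight increment formulas, and eliminating them leaves linear relations between
  increments.  Comparing their leading terms, the only symmetries left are a dilation, measured by the
  derivative of \<open>A1\<close> along \<open>b11\<close>, and a rotation \<open>\<i> z \<partial>z\<close>, measured by the derivative of \<open>C\<close> along
  \<open>b21\<close>.  The dilation is zero by normalization.  The rotation is excluded by the seventh equation:
  it would send \<open>z^3 \<zeta>^2 + z^2 \<zeta>^3\<close> to a multiple of \<open>z^3 \<zeta>^2 - z^2 \<zeta>^3\<close>, and the derivative of
  \<open>A7\<close> along \<open>b32\<close> would have two opposite values (\<open>C_b21_zero\<close>).  Hence the symmetry is zero.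

  So \<open>aut_CR M3\<close> is the injective linear image of an eleven-dimensional parameter space.  The bracket
  of two members of the family is again a member, with explicit parameters; the Lie algebra axioms,
  the basis, the grading and the commutators are identities between parameters.
\<close>

section \<open>Vectors and derivatives in coordinates\<close>

lemma exhaust_8:
  fixes x :: 8
  shows "x = 1 \<or> x = 2 \<or> x = 3 \<or> x = 4 \<or> x = 5 \<or> x = 6 \<or> x = 7 \<or> x = 8"
proof (induct x)
  case (of_int z)
  then have "z = 0 \<or> z = 1 \<or> z = 2 \<or> z = 3 \<or> z = 4 \<or> z = 5 \<or> z = 6 \<or> z = 7"
    by auto
  moreover have "(8::8) = 0" by simp
  ultimately show ?case by (elim disjE) simp_all
qed

lemma forall_8:
  "(\<forall>i::8. P i) \<longleftrightarrow> P 1 \<and> P 2 \<and> P 3 \<and> P 4 \<and> P 5 \<and> P 6 \<and> P 7 \<and> P 8"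
  by (metis exhaust_8)

lemma all_8I: "P 1 \<Longrightarrow> P 2 \<Longrightarrow> P 3 \<Longrightarrow> P 4 \<Longrightarrow> P 5 \<Longrightarrow> P 6 \<Longrightarrow> P 7 \<Longrightarrow> P 8 \<Longrightarrow> P (i :: 8)"
  using forall_8[of P] by blast

lemma vector_8 [simp]:
  "(vector [a,b,c,d,e,f,g,h] :: ('a::zero)^8) $ 1 = a"
  "(vector [a,b,c,d,e,f,g,h] :: ('a::zero)^8) $ 2 = b"
  "(vector [a,b,c,d,e,f,g,h] :: ('a::zero)^8) $ 3 = c"
  "(vector [a,b,c,d,e,f,g,h] :: ('a::zero)^8) $ 4 = d"
  "(vector [a,b,c,d,e,f,g,h] :: ('a::zero)^8) $ 5 = e"
  "(vector [a,b,c,d,e,f,g,h] :: ('a::zero)^8) $ 6 = f"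
  "(vector [a,b,c,d,e,f,g,h] :: ('a::zero)^8) $ 7 = g"
  "(vector [a,b,c,d,e,f,g,h] :: ('a::zero)^8) $ 8 = h"
  unfolding vector_def by simp_all

lemmas vec8_eq_iff = vec_eq_iff[where 'b = 8, unfolded forall_8]

lemma norm_axis_eq: "norm (axis i x :: 'a::real_normed_vector ^ 'n) = norm x"
proof -
  have "(norm ((axis i x :: 'a ^ 'n) $ j))\<^sup>2 = (if j = i then (norm x)\<^sup>2 else 0)" for j
    by (simp add: axis_def)
  then show ?thesis
    by (simp add: norm_vec_def L2_set_def)
qed

lemma bounded_linear_axis: "bounded_linear (axis i :: 'a::real_normed_vector \<Rightarrow> 'a ^ 'n)"
  by (rule bounded_linear_intro[where K = 1]) (simp_all add: norm_axis_eq, simp_all add: axis_def vec_eq_iff)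

lemma has_derivative_vec_componentwise:
  fixes f :: "'a::real_normed_vector \<Rightarrow> 'b::real_normed_vector ^ 'n"
  assumes "\<And>i. ((\<lambda>x. f x $ i) has_derivative (\<lambda>h. f' h $ i)) F"
  shows "(f has_derivative f') F"
proof -
  have sum_axis: "(\<Sum>i\<in>UNIV. axis i (v $ i)) = v" for v :: "'b ^ 'n"
    by (simp add: vec_eq_iff axis_def if_distrib cong: if_cong)
  have "((\<lambda>x. \<Sum>i\<in>UNIV. axis i (f x $ i)) has_derivative (\<lambda>h. \<Sum>i\<in>UNIV. axis i (f' h $ i))) F"
    by (intro has_derivative_sum bounded_linear.has_derivative[OF bounded_linear_axis] assms)
  then show ?thesis by (simp add: sum_axis)
qed

lemma norm_vector_scale: "norm ((c::complex) *s (v :: complex ^ 'n)) = norm c * norm v"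
  by (simp add: norm_vec_def norm_mult L2_set_right_distrib)

lemma bounded_linear_vector_scale_left:
  "bounded_linear (\<lambda>c::complex. c *s (v :: complex ^ 'n))"
  by (rule bounded_linear_intro[where K = "norm v"])
    (simp_all add: norm_vector_scale, simp_all add: vec_eq_iff algebra_simps)

lemmas has_derivative_scale_left [derivative_intros] =
  bounded_linear.has_derivative[OF bounded_linear_vector_scale_left]

lemma has_derivative_unique_eventually:
  assumes "(f has_derivative f') (at x)" "(g has_derivative g') (at x)"
    and "\<forall>\<^sub>F y in nhds x. f y = g y"
  shows "f' = g'"
  using assms(1,2)[THEN frechet_derivative_at] frechet_derivative_cong_ev[OF assms(3)] by simp

definition cnj_vec :: "complex ^ 8 \<Rightarrow> complex ^ 8" where
  "cnj_vec v = (\<chi> l. cnj (v $ l))"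

lemma cnj_vec_nth [simp]: "cnj_vec v $ l = cnj (v $ l)"
  by (simp add: cnj_vec_def)

lemma cnj_vec_cnj_vec [simp]: "cnj_vec (cnj_vec v) = v"
  by (simp add: vec_eq_iff)

lemma cnj_vec_diff: "cnj_vec (u - v) = cnj_vec u - cnj_vec v"
  by (simp add: vec_eq_iff)

lemma cnj_vec_add: "cnj_vec (u + v) = cnj_vec u + cnj_vec v"
  by (simp add: vec_eq_iff)

lemma cnj_vec_scaleR: "cnj_vec (r *\<^sub>R v) = r *\<^sub>R cnj_vec v"
  by (simp add: vec_eq_iff)

lemma norm_cnj_vec [simp]: "norm (cnj_vec v) = norm v"
  by (simp add: norm_vec_def)

lemma bounded_linear_cnj_vec: "bounded_linear cnj_vec"
  by (rule bounded_linear_intro[where K = 1]) (simp_all add: vec_eq_iff)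

section \<open>The defining functions and the tangent spaces\<close>

text \<open>
  The index \<open>bij\<close> names the monomial \<open>z^i \<zeta>^j\<close> with which the vector occurs in the defining functions.
  The last two vectors each carry a symmetric sum of two monomials, of bidegrees \<open>(3, 2)\<close> and
  \<open>(2, 3)\<close>, respectively \<open>(4, 1)\<close> and \<open>(1, 4)\<close>.
\<close>

definition b11 :: "complex ^ 8" where "b11 = vector [2 * \<i>, 0, 0, 0, 0, 0, 0, 0]"
definition b21 :: "complex ^ 8" where "b21 = vector [0, 2 * \<i>, 2, 0, 0, 0, 0, 0]"
definition b12 :: "complex ^ 8" where "b12 = vector [0, 2 * \<i>, -2, 0, 0, 0, 0, 0]"
definition b31 :: "complex ^ 8" where "b31 = vector [0, 0, 0, 2 * \<i>, 2, 0, 0, 0]"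
definition b13 :: "complex ^ 8" where "b13 = vector [0, 0, 0, 2 * \<i>, -2, 0, 0, 0]"
definition b22 :: "complex ^ 8" where "b22 = vector [0, 0, 0, 0, 0, 2 * \<i>, 0, 0]"
definition b32 :: "complex ^ 8" where "b32 = vector [0, 0, 0, 0, 0, 0, 2 * \<i>, 0]"
definition b41 :: "complex ^ 8" where "b41 = vector [0, 0, 0, 0, 0, 0, 0, 2 * \<i>]"

lemmas b_defs = b11_def b21_def b12_def b31_def b13_def b22_def b32_def b41_def

text \<open>
  The right-hand sides of the defining equations, with \<open>cnj z\<close> replaced by an independent variable.
\<close>

definition Phi :: "complex \<Rightarrow> complex \<Rightarrow> complex ^ 8" where
  "Phi z \<zeta> = (z * \<zeta>) *s b11 + (z^2 * \<zeta>) *s b21 + (z * \<zeta>^2) *s b12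
     + (z^3 * \<zeta>) *s b31 + (z * \<zeta>^3) *s b13 + (z^2 * \<zeta>^2) *s b22
     + (z^3 * \<zeta>^2 + z^2 * \<zeta>^3) *s b32 + (z^4 * \<zeta> + z * \<zeta>^4) *s b41"

text \<open>
  The derivative of \<open>Phi\<close> at \<open>(z, \<zeta>)\<close> in the direction \<open>(Z, Y)\<close>.
\<close>

definition dPhi :: "complex \<Rightarrow> complex \<Rightarrow> complex \<Rightarrow> complex \<Rightarrow> complex ^ 8" where
  "dPhi z \<zeta> Z Y = (Z * \<zeta> + z * Y) *s b11 + (2 * z * Z * \<zeta> + z^2 * Y) *s b21
     + (Z * \<zeta>^2 + z * (2 * \<zeta> * Y)) *s b12
     + (3 * z^2 * Z * \<zeta> + z^3 * Y) *s b31 + (Z * \<zeta>^3 + z * (3 * \<zeta>^2 * Y)) *s b13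
     + (2 * z * Z * \<zeta>^2 + z^2 * (2 * \<zeta> * Y)) *s b22
     + (3 * z^2 * Z * \<zeta>^2 + z^3 * (2 * \<zeta> * Y) + 2 * z * Z * \<zeta>^3 + z^2 * (3 * \<zeta>^2 * Y)) *s b32
     + (4 * z^3 * Z * \<zeta> + z^4 * Y + Z * \<zeta>^4 + z * (4 * \<zeta>^3 * Y)) *s b41"

lemma Phi_has_derivative:
  assumes "(f has_derivative f') (at x)" "(g has_derivative g') (at x)"
  shows "((\<lambda>x. Phi (f x) (g x)) has_derivative (\<lambda>h. dPhi (f x) (g x) (f' h) (g' h))) (at x)"
  unfolding Phi_def
  apply (rule has_derivative_eq_rhs)
   apply (rule derivative_intros assms)+
  apply (rule ext)
  apply (simp add: dPhi_def vec_eq_iff algebra_simps)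
  done

lemma dPhi_scale: "dPhi z \<zeta> (c * Z) (c * Y) = c *s dPhi z \<zeta> Z Y"
  by (simp add: dPhi_def vec_eq_iff algebra_simps)

lemma dPhi_scaleR: "dPhi z \<zeta> (r *\<^sub>R Z) (r *\<^sub>R Y) = r *\<^sub>R dPhi z \<zeta> Z Y"
  using dPhi_scale[of z \<zeta> "complex_of_real r" Z Y] by (simp add: scaleR_conv_of_real[where 'a = complex] vec_eq_iff)

lemma dPhi_diff: "dPhi z \<zeta> (Z - Z') (Y - Y') = dPhi z \<zeta> Z Y - dPhi z \<zeta> Z' Y'"
  by (simp add: dPhi_def vec_eq_iff algebra_simps)

lemma Phi_0 [simp]: "Phi 0 \<zeta> = 0" "Phi z 0 = 0"
  by (simp_all add: Phi_def vec_eq_iff)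

lemma cnj_vec_Phi: "cnj_vec (Phi z \<zeta>) = - Phi (cnj \<zeta>) (cnj z)"
  by (simp add: Phi_def vec8_eq_iff b_defs algebra_simps)

lemma cnj_vec_dPhi: "cnj_vec (dPhi z \<zeta> Z Y) = - dPhi (cnj \<zeta>) (cnj z) (cnj Y) (cnj Z)"
  by (simp add: dPhi_def vec8_eq_iff b_defs algebra_simps)

lemma mem_M3_iff: "p \<in> M3 \<longleftrightarrow> snd p - cnj_vec (snd p) = Phi (fst p) (cnj (fst p))"
  by (cases p) (simp add: M3_def Phi_def vec8_eq_iff b_defs algebra_simps)

text \<open>
  \<open>M3\<close> is a graph over the space of \<open>z\<close> and \<open>Re w\<close>: a vector that satisfies the linearized equations is
  the velocity of the straight line in these coordinates, lifted to \<open>M3\<close>.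
\<close>

lemma tangent_vector_M3_iff:
  assumes "p \<in> M3"
  shows "tangent_vector M3 p v \<longleftrightarrow>
    snd v - cnj_vec (snd v) = dPhi (fst p) (cnj (fst p)) (fst v) (cnj (fst v))"
    (is "_ \<longleftrightarrow> ?linear")
proof
  assume "tangent_vector M3 p v"
  then obtain \<gamma> :: "real \<Rightarrow> C9" where \<gamma>: "\<gamma> 0 = p" "\<forall>\<^sub>F t in nhds 0. \<gamma> t \<in> M3"
      and der: "(\<gamma> has_derivative (\<lambda>t. t *\<^sub>R v)) (at 0)"
    unfolding tangent_vector_def has_vector_derivative_def by auto
  have d1: "((\<lambda>t. snd (\<gamma> t) - cnj_vec (snd (\<gamma> t))) has_derivative
      (\<lambda>t. snd (t *\<^sub>R v) - cnj_vec (snd (t *\<^sub>R v)))) (at 0)"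
    by (intro has_derivative_diff bounded_linear.has_derivative[OF bounded_linear_cnj_vec]
        has_derivative_snd der)
  have d2: "((\<lambda>t. Phi (fst (\<gamma> t)) (cnj (fst (\<gamma> t)))) has_derivative
      (\<lambda>t. dPhi (fst (\<gamma> 0)) (cnj (fst (\<gamma> 0))) (fst (t *\<^sub>R v)) (cnj (fst (t *\<^sub>R v))))) (at 0)"
    by (intro Phi_has_derivative has_derivative_fst has_derivative_cnj der)
  have ev: "\<forall>\<^sub>F t in nhds 0.
      snd (\<gamma> t) - cnj_vec (snd (\<gamma> t)) = Phi (fst (\<gamma> t)) (cnj (fst (\<gamma> t)))"
    using \<gamma>(2) by (simp add: mem_M3_iff)
  have eq: "(\<lambda>t. snd (t *\<^sub>R v) - cnj_vec (snd (t *\<^sub>R v))) =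
      (\<lambda>t. dPhi (fst (\<gamma> 0)) (cnj (fst (\<gamma> 0))) (fst (t *\<^sub>R v)) (cnj (fst (t *\<^sub>R v))))"
    by (rule has_derivative_unique_eventually[OF d1 d2 ev])
  from fun_cong[OF eq, of 1] show ?linear
    by (simp add: \<gamma>(1))
next
  assume lin: ?linear
  define \<gamma> :: "real \<Rightarrow> C9" where
    "\<gamma> = (\<lambda>t. let z = fst p + t *\<^sub>R fst v; w = snd p + t *\<^sub>R snd v in
       (z, (1/2) *\<^sub>R (w + cnj_vec w) + (1/2) *\<^sub>R Phi z (cnj z)))"
  have "\<gamma> t \<in> M3" for t
    by (simp add: mem_M3_iff \<gamma>_def Let_def cnj_vec_add cnj_vec_scaleR cnj_vec_Phi scaleR_2[symmetric]
        flip: scaleR_add_left)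
  moreover have "\<gamma> 0 = p"
    using assms[unfolded mem_M3_iff, symmetric]
    by (simp add: \<gamma>_def Let_def prod_eq_iff vec_eq_iff scaleR_conv_of_real[where 'a = complex] field_simps)
  moreover have "(\<gamma> has_vector_derivative v) (at 0)"
  proof -
    have "(\<gamma> has_derivative (\<lambda>t. (t *\<^sub>R fst v, (1/2) *\<^sub>R (t *\<^sub>R snd v + cnj_vec (t *\<^sub>R snd v)) +
        (1/2) *\<^sub>R dPhi (fst p + 0 *\<^sub>R fst v) (cnj (fst p + 0 *\<^sub>R fst v)) (t *\<^sub>R fst v) (cnj (t *\<^sub>R fst v))))) (at 0)"
      unfolding \<gamma>_def Let_def
      by (intro has_derivative_Pair has_derivative_add has_derivative_scaleR_right Phi_has_derivative
          bounded_linear.has_derivative[OF bounded_linear_cnj_vec] has_derivative_cnj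
          has_derivative_scaleR_left has_derivative_ident has_derivative_add_const
          has_derivative_eq_rhs[OF has_derivative_add[OF has_derivative_const
            has_derivative_scaleR_left[OF has_derivative_ident]]]) simp_all
    moreover have "(t *\<^sub>R fst v, (1/2) *\<^sub>R (t *\<^sub>R snd v + cnj_vec (t *\<^sub>R snd v)) +
        (1/2) *\<^sub>R dPhi (fst p + 0 *\<^sub>R fst v) (cnj (fst p + 0 *\<^sub>R fst v)) (t *\<^sub>R fst v) (cnj (t *\<^sub>R fst v)))
        = t *\<^sub>R v" for t
    proof -
      have "cnj (t *\<^sub>R fst v) = t *\<^sub>R cnj (fst v)" by simp
      then show ?thesis
        by (simp add: dPhi_scaleR lin[symmetric] cnj_vec_scaleR prod_eq_iff vec_eq_iff algebra_simps
            flip: scaleR_add_left)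
    qed
    ultimately show ?thesis
      by (simp add: has_vector_derivative_def)
  qed
  ultimately show "tangent_vector M3 p v"
    unfolding tangent_vector_def by (intro exI[of _ \<gamma>]) simp
qed

section \<open>Holomorphic functions near the origin\<close>

text \<open>
  Holomorphy of a function of the variable \<open>w\<close> alone, expressed by complex linear derivatives.
\<close>

definition hol8 :: "(complex ^ 8 \<Rightarrow> complex) \<Rightarrow> real \<Rightarrow> bool" where
  "hol8 F r \<longleftrightarrow> (\<forall>x\<in>ball 0 r. \<exists>D. (F has_derivative D) (at x) \<and> (\<forall>c v. D (c *s v) = c * D v))"

definition der :: "(complex ^ 8 \<Rightarrow> complex) \<Rightarrow> complex ^ 8 \<Rightarrow> complex ^ 8 \<Rightarrow> complex" where
  "der F x = frechet_derivative F (at x)"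

text \<open>
  By \<open>annihilated_invariant\<close> these are the directions along which \<open>F\<close> is constant; they form a linear
  subspace.
\<close>

definition annihilated :: "(complex ^ 8 \<Rightarrow> complex) \<Rightarrow> real \<Rightarrow> complex ^ 8 \<Rightarrow> bool" where
  "annihilated F r v \<longleftrightarrow> (\<forall>x\<in>ball 0 r. der F x v = 0)"

lemma der_eqI: "(F has_derivative D) (at x) \<Longrightarrow> der F x = D"
  by (simp add: der_def frechet_derivative_at[symmetric])

lemma
  assumes "hol8 F r" "x \<in> ball 0 r"
  shows hol8_has_derivative: "(F has_derivative der F x) (at x)"
    and der_scale: "der F x (c *s v) = c * der F x v"
proof -
  obtain D where D: "(F has_derivative D) (at x)" "\<And>c v. D (c *s v) = c * D v"
    using assms unfolding hol8_def by blast
  show "(F has_derivative der F x) (at x)" "der F x (c *s v) = c * der F x v"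
    using D by (simp_all add: der_eqI[OF D(1)])
qed

lemma der_add:
  assumes "hol8 F r" "x \<in> ball 0 r"
  shows "der F x (u + v) = der F x u + der F x v"
  using hol8_has_derivative[OF assms] by (simp add: linear_add has_derivative_linear)

lemma der_scaleR:
  assumes "hol8 F r" "x \<in> ball 0 r"
  shows "der F x (t *\<^sub>R u) = t *\<^sub>R der F x u"
  using hol8_has_derivative[OF assms] by (simp add: linear_scale has_derivative_linear)

lemma hol8_lincomb:
  assumes F: "hol8 F r" and G: "hol8 G r"
  shows "hol8 (\<lambda>x. F x + c * G x) r"
  unfolding hol8_def
proof
  fix x :: "complex ^ 8" assume x: "x \<in> ball 0 r"
  show "\<exists>D. ((\<lambda>x. F x + c * G x) has_derivative D) (at x) \<and> (\<forall>a v. D (a *s v) = a * D v)"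
    by (intro exI[of _ "\<lambda>v. der F x v + c * der G x v"] conjI allI has_derivative_add
        has_derivative_mult_right hol8_has_derivative[where r = r] F G x)
      (simp add: der_scale[OF F x] der_scale[OF G x] algebra_simps)
qed

lemma annihilated_add:
  "hol8 F r \<Longrightarrow> annihilated F r u \<Longrightarrow> annihilated F r v \<Longrightarrow> annihilated F r (u + v)"
  by (simp add: annihilated_def der_add)

lemma annihilated_scale: "hol8 F r \<Longrightarrow> annihilated F r u \<Longrightarrow> annihilated F r (c *s u)"
  by (simp add: annihilated_def der_scale)

lemma annihilated_0: "hol8 F r \<Longrightarrow> annihilated F r 0"
  using annihilated_scale[of F r _ 0] by (simp add: annihilated_def der_def)
    (metis der_def der_scaleR mem_ball_0 scaleR_zero_left)

lemmas annihilated_intros = annihilated_add annihilated_scale annihilated_0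

text \<open>
  The ball is convex, so the segment from \<open>x\<close> to \<open>x + u\<close> stays inside and the function is constant on it.
\<close>

lemma annihilated_invariant:
  assumes F: "hol8 F r" and u: "annihilated F r u" and x: "x \<in> ball 0 r" "x + u \<in> ball 0 r"
  shows "F (x + u) = F x"
proof -
  have "((\<lambda>t. F (x + t *\<^sub>R u)) has_vector_derivative 0) (at t within {0..1})"
    if t: "t \<in> {0..1}" for t
  proof -
    have "x + t *\<^sub>R u = (1 - t) *\<^sub>R x + t *\<^sub>R (x + u)" by (simp add: algebra_simps)
    then have xt: "x + t *\<^sub>R u \<in> ball 0 r"
      using convexD_alt[OF convex_ball x(1) x(2), of t] t by simp
    have "((\<lambda>t. F (x + t *\<^sub>R u)) has_derivative (\<lambda>h. der F (x + t *\<^sub>R u) (h *\<^sub>R u))) (at t)"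
      by (rule has_derivative_compose[of "\<lambda>t. x + t *\<^sub>R u" "\<lambda>h. h *\<^sub>R u", OF _ hol8_has_derivative[OF F xt]])
        (auto intro!: derivative_eq_intros)
    moreover have "der F (x + t *\<^sub>R u) (h *\<^sub>R u) = h *\<^sub>R 0" for h
      using der_scaleR[OF F xt] u xt by (simp add: annihilated_def)
    ultimately show ?thesis
      by (simp add: has_vector_derivative_def has_derivative_at_withinI)
  qed
  then obtain c where "\<And>t. t \<in> {0..1} \<Longrightarrow> F (x + t *\<^sub>R u) = c"
    using has_vector_derivative_zero_constant[of "{0..1::real}" "\<lambda>t. F (x + t *\<^sub>R u)"] by auto
  from this[of 0] this[of 1] show ?thesis by simp
qed

text \<open>
  Derivatives inherit translation invariance.  This replaces the symmetry of second derivatives.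
\<close>

lemma der_translate:
  assumes F: "hol8 F r" and t: "annihilated F r t" and x: "x \<in> ball 0 r" and xt: "x + t \<in> ball 0 r"
  shows "der F (x + t) v = der F x v"
proof -
  have "((\<lambda>y. F (y + t)) has_derivative der F (x + t)) (at x)"
    by (rule has_derivative_compose[of "\<lambda>y. y + t" "\<lambda>h. h", OF _ hol8_has_derivative[OF F xt]])
      (auto intro!: derivative_eq_intros)
  moreover have "\<forall>\<^sub>F y in nhds x. F (y + t) = F y"
  proof -
    have "\<forall>\<^sub>F y in nhds x. y + t \<in> ball 0 r"
      by (rule topological_tendstoD[of "\<lambda>y. y + t" "x + t"])
        (use xt in \<open>auto simp del: mem_ball_0 intro: tendsto_add[OF filterlim_ident tendsto_const]\<close>)
    moreover have "\<forall>\<^sub>F y in nhds x. y \<in> ball 0 r"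
      using x by (intro eventually_nhds_in_open) auto
    ultimately show ?thesis
      by eventually_elim (simp add: annihilated_invariant[OF F t])
  qed
  ultimately have "der F (x + t) = der F x"
    using has_derivative_unique_eventually[OF _ hol8_has_derivative[OF F x]] by blast
  then show ?thesis by simp
qed

text \<open>
  If \<open>H\<close> is a directional derivative of \<open>F\<close>, up to a factor, then \<open>H\<close> is constant along every direction
  along which \<open>F\<close> is, by \<open>der_translate\<close>.
\<close>

lemma der_annihilated:
  assumes F: "hol8 F r" and H: "hol8 H r" and c: "c \<noteq> 0"
    and der: "\<And>x. x \<in> ball 0 r \<Longrightarrow> der F x v = c * H x"
    and u: "annihilated F r u"
  shows "annihilated H r u"
  unfolding annihilated_def
proof
  fix x :: "complex ^ 8" assume x: "x \<in> ball 0 r"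
  have "((\<lambda>t::real. H (x + t *\<^sub>R u)) has_derivative (\<lambda>h. der H x (h *\<^sub>R u))) (at 0)"
    by (rule has_derivative_compose[of "\<lambda>t. x + t *\<^sub>R u" "\<lambda>h. h *\<^sub>R u" 0 _ H "der H x"])
      (use hol8_has_derivative[OF H x] in \<open>auto intro!: derivative_eq_intros\<close>)
  moreover have "\<forall>\<^sub>F t::real in nhds 0. H (x + t *\<^sub>R u) = H x"
  proof -
    have "\<forall>\<^sub>F t::real in nhds 0. x + t *\<^sub>R u \<in> ball 0 r"
    proof (rule topological_tendstoD[of "\<lambda>t. x + t *\<^sub>R u" "x + 0 *\<^sub>R u"])
      show "((\<lambda>t. x + t *\<^sub>R u) \<longlongrightarrow> x + 0 *\<^sub>R u) (nhds 0)"
        by (intro tendsto_add tendsto_scaleR tendsto_const filterlim_ident)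
    qed (use x in auto)
    then show ?thesis
    proof eventually_elim
      case (elim t)
      have "annihilated F r (t *\<^sub>R u)"
        using u der_scaleR[OF F] by (simp add: annihilated_def)
      from der_translate[OF F this x elim, of v] der[OF elim] der[OF x] c show ?case by simp
    qed
  qed
  ultimately have "(\<lambda>h. der H x (h *\<^sub>R u)) = (\<lambda>h. 0)"
    using has_derivative_unique_eventually[OF _ has_derivative_const] by blast
  from fun_cong[OF this, of 1] show "der H x u = 0"
    by simp
qed

text \<open>
  The key limit.  The part \<open>u z\<close> of the displacement lies in directions along which \<open>F\<close> is constant and
  contributes nothing; what remains is \<open>z ^ k\<close> times a bounded displacement, and differentiability of
  first order suffices.
\<close>

lemma tendsto_increment:
  assumes F: "hol8 F r" and x: "x \<in> ball 0 r" and k: "0 < k"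
    and p: "\<And>z. p z = u z + z ^ k *s \<Psi> z" and u: "\<And>z. annihilated F r (u z)"
    and lim: "(\<Psi> \<longlongrightarrow> \<Psi>0) (at 0)" "(u \<longlongrightarrow> 0) (at 0)"
  shows "((\<lambda>z. (F (x + p z) - F x) / z ^ k) \<longlongrightarrow> der F x \<Psi>0) (at (0::complex))"
proof -
  define h where "h = (\<lambda>z. z ^ k *s \<Psi> z)"
  have "((\<lambda>z. norm (z ^ k) * norm (\<Psi> z)) \<longlongrightarrow> norm (0 ^ k :: complex) * norm \<Psi>0) (at 0)"
    by (intro tendsto_intros lim)
  then have "((\<lambda>z. norm (h z)) \<longlongrightarrow> 0) (at 0)"
    using k by (simp add: h_def norm_vector_scale power_0_left)
  then have h: "(h \<longlongrightarrow> 0) (at 0)"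
    by (simp add: tendsto_norm_zero_iff)
  have bl: "bounded_linear (der F x)"
    using hol8_has_derivative[OF F x] by (rule has_derivative_bounded_linear)
  have rem: "((\<lambda>z. (F (x + h z) - F x - der F x (h z)) / z ^ k) \<longlongrightarrow> 0) (at 0)"
  proof (rule tendstoI)
    fix e :: real assume e: "0 < e"
    define K where "K = norm \<Psi>0 + 1"
    have K: "0 < K" by (simp add: K_def add_nonneg_pos)
    have "0 < e / (2 * K)" using e K by simp
    then obtain d where d: "0 < d" and bnd: "\<And>y. norm (y - x) < d \<Longrightarrow>
        norm (F y - F x - der F x (y - x)) \<le> (e / (2 * K)) * norm (y - x)"
      using hol8_has_derivative[OF F x] unfolding has_derivative_at_alt by blast
    have "\<forall>\<^sub>F z in at 0. norm (h z) < d"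
      using tendstoD[OF h d] by simp
    moreover have "\<forall>\<^sub>F z in at 0. norm (\<Psi> z) < K"
      using tendsto_norm[OF lim(1)] by (rule order_tendstoD) (simp add: K_def)
    moreover have "\<forall>\<^sub>F z in at (0::complex). z \<noteq> 0"
      by (simp add: eventually_at_filter)
    ultimately show "\<forall>\<^sub>F z in at 0. dist ((F (x + h z) - F x - der F x (h z)) / z ^ k) 0 < e"
    proof eventually_elim
      case (elim z)
      have "norm (F (x + h z) - F x - der F x (h z)) \<le> e / (2 * K) * norm (h z)"
        using bnd[of "x + h z"] elim(1) by simp
      also have "\<dots> = e / (2 * K) * norm (\<Psi> z) * norm (z ^ k)"
        by (simp add: h_def norm_vector_scale)
      finally have "norm ((F (x + h z) - F x - der F x (h z)) / z ^ k) \<le> e / (2 * K) * norm (\<Psi> z)"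
        using elim(3) by (simp add: norm_divide field_simps)
      also have "\<dots> \<le> e / (2 * K) * K"
        using e K elim(2) by (intro mult_left_mono) auto
      also have "\<dots> < e"
        using e K by simp
      finally show ?case by simp
    qed
  qed
  have "((\<lambda>z. der F x (\<Psi> z)) \<longlongrightarrow> der F x \<Psi>0) (at 0)"
    by (rule bounded_linear.tendsto[OF bl lim(1)])
  from tendsto_add[OF rem this]
  have "((\<lambda>z. (F (x + h z) - F x - der F x (h z)) / z ^ k + der F x (\<Psi> z)) \<longlongrightarrow> der F x \<Psi>0) (at 0)"
    by simp
  then show ?thesis
  proof (rule Lim_transform_eventually)
    have t: "((\<lambda>z. x + h z) \<longlongrightarrow> x + 0) (at 0)" "((\<lambda>z. x + h z + u z) \<longlongrightarrow> x + 0 + 0) (at 0)"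
      by (intro tendsto_intros h lim)+
    have "\<forall>\<^sub>F z in at 0. x + h z \<in> ball 0 r" "\<forall>\<^sub>F z in at 0. x + h z + u z \<in> ball 0 r"
      using topological_tendstoD[OF t(1) open_ball[of 0 r]] topological_tendstoD[OF t(2) open_ball[of 0 r]] x
      by simp_all
    moreover have "\<forall>\<^sub>F z in at (0::complex). z \<noteq> 0"
      by (simp add: eventually_at_filter)
    ultimately show "\<forall>\<^sub>F z in at 0. (F (x + h z) - F x - der F x (h z)) / z ^ k + der F x (\<Psi> z) =
        (F (x + p z) - F x) / z ^ k"
    proof eventually_elim
      case (elim z)
      have "F (x + p z) = F (x + h z)"
        using annihilated_invariant[OF F u elim(1,2)] by (simp add: p h_def algebra_simps)
      moreover have "der F x (h z) = z ^ k * der F x (\<Psi> z)"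
        by (simp add: h_def der_scale[OF F x])
      ultimately show ?case
        using elim(3) by (simp add: field_simps)
    qed
  qed
qed

lemma b_decomposition:
  obtains c1 c2 c3 c4 c5 c6 c7 c8 where "(v :: complex ^ 8) = c1 *s b11 + c2 *s b21 + c3 *s b12
    + c4 *s b31 + c5 *s b13 + c6 *s b22 + c7 *s b32 + c8 *s b41"
proof
  show "v = (v$1 / (2 * \<i>)) *s b11 + ((v$2 / \<i> + v$3) / 4) *s b21 + ((v$2 / \<i> - v$3) / 4) *s b12
    + ((v$4 / \<i> + v$5) / 4) *s b31 + ((v$4 / \<i> - v$5) / 4) *s b13
    + (v$6 / (2 * \<i>)) *s b22 + (v$7 / (2 * \<i>)) *s b32 + (v$8 / (2 * \<i>)) *s b41"
    by (simp add: vec8_eq_iff b_defs field_simps)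
qed

lemma annihilated_constant:
  assumes F: "hol8 F r" and "annihilated F r b11" "annihilated F r b21" "annihilated F r b12"
    "annihilated F r b31" "annihilated F r b13" "annihilated F r b22" "annihilated F r b32"
    "annihilated F r b41" and x: "x \<in> ball 0 r"
  shows "F x = F 0"
proof -
  obtain c1 c2 c3 c4 c5 c6 c7 c8 where v: "x = c1 *s b11 + c2 *s b21 + c3 *s b12
    + c4 *s b31 + c5 *s b13 + c6 *s b22 + c7 *s b32 + c8 *s b41"
    by (rule b_decomposition)
  have "annihilated F r x"
    unfolding v by (intro annihilated_intros assms)
  moreover have "(0 :: complex ^ 8) \<in> ball 0 r"
    using x by (auto intro: le_less_trans[OF norm_ge_zero])
  ultimately show ?thesis
    using annihilated_invariant[OF F, of x 0] x by simp
qed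

text \<open>
  The leading coefficients of increments along \<open>Phi\<close>, in powers of \<open>z\<close> for fixed \<open>\<zeta>\<close> and in powers of \<open>\<zeta>\<close>
  for fixed \<open>z\<close>.  The limit of order \<open>k\<close> requires that \<open>F\<close> be constant along all vectors that occur with
  a monomial of degree less than \<open>k\<close>.
\<close>

lemma
  assumes F: "hol8 F r" and x: "x \<in> ball 0 r"
  shows tendsto_increment_z1: "((\<lambda>z. (F (x + Phi z \<zeta>) - F x) / z) \<longlongrightarrow>
      \<zeta> * der F x b11 + \<zeta>^2 * der F x b12 + \<zeta>^3 * der F x b13 + \<zeta>^4 * der F x b41) (at 0)"
    and tendsto_increment_z2: "\<lbrakk>annihilated F r b11; annihilated F r b12; annihilated F r b13; annihilated F r b41\<rbrakk>
      \<Longrightarrow> ((\<lambda>z. (F (x + Phi z \<zeta>) - F x) / z^2) \<longlongrightarrow>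
      \<zeta> * der F x b21 + \<zeta>^2 * der F x b22 + \<zeta>^3 * der F x b32) (at 0)"
    and tendsto_increment_z3: "\<lbrakk>annihilated F r b11; annihilated F r b12; annihilated F r b13; annihilated F r b41;
      annihilated F r b21; annihilated F r b22; annihilated F r b32\<rbrakk>
      \<Longrightarrow> ((\<lambda>z. (F (x + Phi z \<zeta>) - F x) / z^3) \<longlongrightarrow> \<zeta> * der F x b31) (at 0)"
    and tendsto_increment_zeta1: "((\<lambda>\<zeta>. (F (x + Phi z \<zeta>) - F x) / \<zeta>) \<longlongrightarrow>
      z * der F x b11 + z^2 * der F x b21 + z^3 * der F x b31 + z^4 * der F x b41) (at 0)"
    and tendsto_increment_zeta2: "\<lbrakk>annihilated F r b11; annihilated F r b21; annihilated F r b31; annihilated F r b41\<rbrakk>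
      \<Longrightarrow> ((\<lambda>\<zeta>. (F (x + Phi z \<zeta>) - F x) / \<zeta>^2) \<longlongrightarrow>
      z * der F x b12 + z^2 * der F x b22 + z^3 * der F x b32) (at 0)"
proof -
  have scale_tendsto: "((\<lambda>z. c z *s v) \<longlongrightarrow> c0 *s v) (at 0)" if "(c \<longlongrightarrow> c0) (at 0)"
    for c :: "complex \<Rightarrow> complex" and c0 and v :: "complex ^ 8"
    by (rule bounded_linear.tendsto[OF bounded_linear_vector_scale_left that])
  note T = tendsto_add scale_tendsto tendsto_mult tendsto_power tendsto_const tendsto_ident_at
  note D = der_add[OF F x] der_scale[OF F x]
  show "((\<lambda>z. (F (x + Phi z \<zeta>) - F x) / z) \<longlongrightarrow> \<zeta> * der F x b11 + \<zeta>^2 * der F x b12 + \<zeta>^3 * der F x b13 + \<zeta>^4 * der F x b41) (at 0)"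
  proof -
    let ?u = "\<lambda>z. 0" and ?\<Psi> = "\<lambda>z. (\<zeta>) *s b11 + (z*\<zeta>) *s b21 + (\<zeta>^2) *s b12 + (z^2*\<zeta>) *s b31 + (\<zeta>^3) *s b13 + (z*\<zeta>^2) *s b22 + (z^2*\<zeta>^2+z*\<zeta>^3) *s b32 + (z^3*\<zeta>+\<zeta>^4) *s b41"
    have "((\<lambda>z. (F (x + Phi z \<zeta>) - F x) / z ^ 1) \<longlongrightarrow> der F x (?\<Psi> 0)) (at 0)"
    proof (rule tendsto_increment[OF F x, where u = ?u and \<Psi> = ?\<Psi>])
      show "Phi z \<zeta> = ?u z + z ^ 1 *s ?\<Psi> z" for z
        by (simp add: Phi_def vec_eq_iff algebra_simps eval_nat_numeral)
      show "annihilated F r (?u z)" for z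
        by (intro annihilated_intros F)
      show "(?\<Psi> \<longlongrightarrow> ?\<Psi> 0) (at 0)"
        by (intro T)
      have "(?u \<longlongrightarrow> ?u 0) (at 0)"
        by (intro T)
      then show "(?u \<longlongrightarrow> 0) (at 0)"
        by simp
    qed simp
    then show ?thesis
      by (simp add: D)
  qed
  show "((\<lambda>z. (F (x + Phi z \<zeta>) - F x) / z^2) \<longlongrightarrow> \<zeta> * der F x b21 + \<zeta>^2 * der F x b22 + \<zeta>^3 * der F x b32) (at 0)"
    if ann: "annihilated F r b11" "annihilated F r b12" "annihilated F r b13" "annihilated F r b41"
  proof -
    let ?u = "\<lambda>z. (z*\<zeta>) *s b11 + (z*\<zeta>^2) *s b12 + (z*\<zeta>^3) *s b13 + (z^4*\<zeta>+z*\<zeta>^4) *s b41" and ?\<Psi> = "\<lambda>z. (\<zeta>) *s b21 + (z*\<zeta>) *s b31 + (\<zeta>^2) *s b22 + (z*\<zeta>^2+\<zeta>^3) *s b32"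
    have "((\<lambda>z. (F (x + Phi z \<zeta>) - F x) / z ^ 2) \<longlongrightarrow> der F x (?\<Psi> 0)) (at 0)"
    proof (rule tendsto_increment[OF F x, where u = ?u and \<Psi> = ?\<Psi>])
      show "Phi z \<zeta> = ?u z + z ^ 2 *s ?\<Psi> z" for z
        by (simp add: Phi_def vec_eq_iff algebra_simps eval_nat_numeral)
      show "annihilated F r (?u z)" for z
        by (intro annihilated_intros F ann)
      show "(?\<Psi> \<longlongrightarrow> ?\<Psi> 0) (at 0)"
        by (intro T)
      have "(?u \<longlongrightarrow> ?u 0) (at 0)"
        by (intro T)
      then show "(?u \<longlongrightarrow> 0) (at 0)"
        by simp
    qed simp
    then show ?thesis
      by (simp add: D)
  qed
  show "((\<lambda>z. (F (x + Phi z \<zeta>) - F x) / z^3) \<longlongrightarrow> \<zeta> * der F x b31) (at 0)"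
    if ann: "annihilated F r b11" "annihilated F r b12" "annihilated F r b13" "annihilated F r b41" "annihilated F r b21" "annihilated F r b22" "annihilated F r b32"
  proof -
    let ?u = "\<lambda>z. (z*\<zeta>) *s b11 + (z*\<zeta>^2) *s b12 + (z*\<zeta>^3) *s b13 + (z^4*\<zeta>+z*\<zeta>^4) *s b41 + (z^2*\<zeta>) *s b21 + (z^2*\<zeta>^2) *s b22 + (z^3*\<zeta>^2+z^2*\<zeta>^3) *s b32" and ?\<Psi> = "\<lambda>z. (\<zeta>) *s b31"
    have "((\<lambda>z. (F (x + Phi z \<zeta>) - F x) / z ^ 3) \<longlongrightarrow> der F x (?\<Psi> 0)) (at 0)"
    proof (rule tendsto_increment[OF F x, where u = ?u and \<Psi> = ?\<Psi>])
      show "Phi z \<zeta> = ?u z + z ^ 3 *s ?\<Psi> z" for z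
        by (simp add: Phi_def vec_eq_iff algebra_simps eval_nat_numeral)
      show "annihilated F r (?u z)" for z
        by (intro annihilated_intros F ann)
      show "(?\<Psi> \<longlongrightarrow> ?\<Psi> 0) (at 0)"
        by (intro T)
      have "(?u \<longlongrightarrow> ?u 0) (at 0)"
        by (intro T)
      then show "(?u \<longlongrightarrow> 0) (at 0)"
        by simp
    qed simp
    then show ?thesis
      by (simp add: D)
  qed
  show "((\<lambda>\<zeta>. (F (x + Phi z \<zeta>) - F x) / \<zeta>) \<longlongrightarrow> z * der F x b11 + z^2 * der F x b21 + z^3 * der F x b31 + z^4 * der F x b41) (at 0)"
  proof -
    let ?u = "\<lambda>\<zeta>. 0" and ?\<Psi> = "\<lambda>\<zeta>. (z) *s b11 + (\<zeta>*z) *s b12 + (z^2) *s b21 + (\<zeta>^2*z) *s b13 + (z^3) *s b31 + (\<zeta>*z^2) *s b22 + (\<zeta>^2*z^2+\<zeta>*z^3) *s b32 + (\<zeta>^3*z+z^4) *s b41"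
    have "((\<lambda>\<zeta>. (F (x + Phi z \<zeta>) - F x) / \<zeta> ^ 1) \<longlongrightarrow> der F x (?\<Psi> 0)) (at 0)"
    proof (rule tendsto_increment[OF F x, where u = ?u and \<Psi> = ?\<Psi>])
      show "Phi z \<zeta> = ?u \<zeta> + \<zeta> ^ 1 *s ?\<Psi> \<zeta>" for \<zeta>
        by (simp add: Phi_def vec_eq_iff algebra_simps eval_nat_numeral)
      show "annihilated F r (?u \<zeta>)" for \<zeta>
        by (intro annihilated_intros F)
      show "(?\<Psi> \<longlongrightarrow> ?\<Psi> 0) (at 0)"
        by (intro T)
      have "(?u \<longlongrightarrow> ?u 0) (at 0)"
        by (intro T)
      then show "(?u \<longlongrightarrow> 0) (at 0)"
        by simp
    qed simp
    then show ?thesis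
      by (simp add: D)
  qed
  show "((\<lambda>\<zeta>. (F (x + Phi z \<zeta>) - F x) / \<zeta>^2) \<longlongrightarrow> z * der F x b12 + z^2 * der F x b22 + z^3 * der F x b32) (at 0)"
    if ann: "annihilated F r b11" "annihilated F r b21" "annihilated F r b31" "annihilated F r b41"
  proof -
    let ?u = "\<lambda>\<zeta>. (\<zeta>*z) *s b11 + (\<zeta>*z^2) *s b21 + (\<zeta>*z^3) *s b31 + (\<zeta>^4*z+\<zeta>*z^4) *s b41" and ?\<Psi> = "\<lambda>\<zeta>. (z) *s b12 + (\<zeta>*z) *s b13 + (z^2) *s b22 + (\<zeta>*z^2+z^3) *s b32"
    have "((\<lambda>\<zeta>. (F (x + Phi z \<zeta>) - F x) / \<zeta> ^ 2) \<longlongrightarrow> der F x (?\<Psi> 0)) (at 0)"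
    proof (rule tendsto_increment[OF F x, where u = ?u and \<Psi> = ?\<Psi>])
      show "Phi z \<zeta> = ?u \<zeta> + \<zeta> ^ 2 *s ?\<Psi> \<zeta>" for \<zeta>
        by (simp add: Phi_def vec_eq_iff algebra_simps eval_nat_numeral)
      show "annihilated F r (?u \<zeta>)" for \<zeta>
        by (intro annihilated_intros F ann)
      show "(?\<Psi> \<longlongrightarrow> ?\<Psi> 0) (at 0)"
        by (intro T)
      have "(?u \<longlongrightarrow> ?u 0) (at 0)"
        by (intro T)
      then show "(?u \<longlongrightarrow> 0) (at 0)"
        by simp
    qed simp
    then show ?thesis
      by (simp add: D)
  qed
qed

section \<open>Symmetries in complexified form\<close>

lemma polynomial_coefficients_zero:
  fixes c1 c2 c3 c4 c5 :: complex
  assumes "0 < \<delta>" and zero: "\<And>s. norm s < \<delta> \<Longrightarrow> s * c1 + s^2 * c2 + s^3 * c3 + s^4 * c4 + s^5 * c5 = 0"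
  shows "c1 = 0 \<and> c2 = 0 \<and> c3 = 0 \<and> c4 = 0 \<and> c5 = 0"
proof -
  let ?p = "[:0, c1, c2, c3, c4, c5:]"
  have "infinite (ball (0::complex) \<delta>)"
    using assms(1) by (metis finite_imp_not_open centre_in_ball empty_iff open_ball)
  moreover have "ball 0 \<delta> \<subseteq> {s. poly ?p s = 0}"
    using zero by (auto simp: algebra_simps eval_nat_numeral)
  ultimately have "infinite {s. poly ?p s = 0}"
    using finite_subset by blast
  then have "?p = 0"
    using poly_roots_finite by blast
  then show ?thesis by simp
qed

lemma dPhi_nth:
  "dPhi z \<zeta> Z Y $ 1 = 2 * \<i> * (Z * \<zeta> + z * Y)"
  "dPhi z \<zeta> Z Y $ 2 = 2 * \<i> * (2 * z * Z * \<zeta> + z^2 * Y + Z * \<zeta>^2 + z * (2 * \<zeta> * Y))"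
  "dPhi z \<zeta> Z Y $ 3 = 2 * (2 * z * Z * \<zeta> + z^2 * Y - Z * \<zeta>^2 - z * (2 * \<zeta> * Y))"
  "dPhi z \<zeta> Z Y $ 4 = 2 * \<i> * (3 * z^2 * Z * \<zeta> + z^3 * Y + Z * \<zeta>^3 + z * (3 * \<zeta>^2 * Y))"
  "dPhi z \<zeta> Z Y $ 5 = 2 * (3 * z^2 * Z * \<zeta> + z^3 * Y - Z * \<zeta>^3 - z * (3 * \<zeta>^2 * Y))"
  "dPhi z \<zeta> Z Y $ 6 = 2 * \<i> * (2 * z * Z * \<zeta>^2 + z^2 * (2 * \<zeta> * Y))"
  "dPhi z \<zeta> Z Y $ 7 =
     2 * \<i> * (3 * z^2 * Z * \<zeta>^2 + z^3 * (2 * \<zeta> * Y) + 2 * z * Z * \<zeta>^3 + z^2 * (3 * \<zeta>^2 * Y))"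
  "dPhi z \<zeta> Z Y $ 8 = 2 * \<i> * (4 * z^3 * Z * \<zeta> + z^4 * Y + Z * \<zeta>^4 + z * (4 * \<zeta>^3 * Y))"
  by (simp_all add: dPhi_def b_defs algebra_simps)

lemma tendsto_Phi:
  assumes "(a \<longlongrightarrow> a0) F" "(b \<longlongrightarrow> b0) F"
  shows "((\<lambda>s. Phi (a s) (b s)) \<longlongrightarrow> Phi a0 b0) F"
  unfolding Phi_def
  by (intro tendsto_intros bounded_linear.tendsto[OF bounded_linear_vector_scale_left] assms)

text \<open>
  Symmetries after complexification.  The values of the conjugated coefficients at independent points
  \<open>(\<zeta>, x)\<close> are \<open>cnj (f (cnj \<zeta>, cnj_vec x))\<close>; the points \<open>(z, w)\<close> and \<open>(\<zeta>, x)\<close> are coupled by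
  \<open>w = x + Phi z \<zeta>\<close>.
\<close>

locale complexified_symmetry =
  fixes f :: "C9 \<Rightarrow> C9" and \<delta> :: real
  assumes pos: "0 < \<delta>"
    and cont: "\<And>z x. norm z < \<delta> \<Longrightarrow> x \<in> ball 0 \<delta> \<Longrightarrow> isCont f (z, x)"
    and hol_Z: "hol8 (\<lambda>x. fst (f (0, x))) \<delta>"
    and hol_W: "\<And>l. hol8 (\<lambda>x. snd (f (0, x)) $ l) \<delta>"
    and tangency: "\<And>z \<zeta> x. \<lbrakk>norm z < \<delta>; norm \<zeta> < \<delta>; x \<in> ball 0 \<delta>; x + Phi z \<zeta> \<in> ball 0 \<delta>\<rbrakk> \<Longrightarrow>
      snd (f (z, x + Phi z \<zeta>)) - cnj_vec (snd (f (cnj \<zeta>, cnj_vec x))) =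
      dPhi z \<zeta> (fst (f (z, x + Phi z \<zeta>))) (cnj (fst (f (cnj \<zeta>, cnj_vec x))))"
begin

definition Z :: "complex \<Rightarrow> complex ^ 8 \<Rightarrow> complex" where
  "Z z x = fst (f (z, x))"

definition Y :: "complex \<Rightarrow> complex ^ 8 \<Rightarrow> complex" where
  "Y \<zeta> x = cnj (fst (f (cnj \<zeta>, cnj_vec x)))"

definition A :: "complex ^ 8 \<Rightarrow> complex ^ 8" where
  "A x = snd (f (0, x))"

lemma hol_A: "hol8 (\<lambda>x. A x $ l) \<delta>"
  using hol_W by (simp add: A_def)

lemma hol_Z0: "hol8 (Z 0) \<delta>"
  using hol_Z by (simp add: Z_def[abs_def])

text \<open>
  The case \<open>z = \<zeta> = 0\<close>: \<open>A\<close> takes real values at real points.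
\<close>

lemma A_real: "x \<in> ball 0 \<delta> \<Longrightarrow> cnj_vec (A (cnj_vec x)) = A x"
  using tangency[of 0 0 x] pos by (simp add: A_def dPhi_def)

text \<open>
  For \<open>\<zeta> = 0\<close> the points \<open>w\<close> and \<open>x\<close> coincide, and \<open>dPhi z 0\<close> does not involve the coefficient \<open>Z\<close>.
\<close>

lemma W_eq:
  assumes "norm z < \<delta>" "x \<in> ball 0 \<delta>"
  shows "snd (f (z, x)) = A x + dPhi z 0 0 (Y 0 x)"
  using tangency[of z 0 x] A_real[of x] assms pos
  by (simp add: A_def Y_def dPhi_def algebra_simps)

text \<open>
  \<open>W_eq\<close> and its conjugate turn the tangency identity into a formula for increments of \<open>A\<close>.  The
  components 6 and 7 of the two correction terms are zero, which makes these components the simplest.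
\<close>

lemma increment:
  assumes "norm z < \<delta>" "norm \<zeta> < \<delta>" "x \<in> ball 0 \<delta>" "x + Phi z \<zeta> \<in> ball 0 \<delta>"
  shows "A (x + Phi z \<zeta>) - A x = dPhi z \<zeta> (Z z (x + Phi z \<zeta>)) (Y \<zeta> x)
    - dPhi z 0 0 (Y 0 (x + Phi z \<zeta>)) - dPhi 0 \<zeta> (Z 0 x) 0"
proof -
  have "snd (f (cnj \<zeta>, cnj_vec x)) = A (cnj_vec x) + dPhi (cnj \<zeta>) 0 0 (cnj (Z 0 x))"
    using W_eq[of "cnj \<zeta>" "cnj_vec x"] assms by (simp add: Y_def Z_def)
  then have "cnj_vec (snd (f (cnj \<zeta>, cnj_vec x))) = A x - dPhi 0 \<zeta> (Z 0 x) 0"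
    using A_real[of x] assms by (simp add: cnj_vec_add cnj_vec_dPhi)
  moreover have "A (x + Phi z \<zeta>) = snd (f (z, x + Phi z \<zeta>)) - dPhi z 0 0 (Y 0 (x + Phi z \<zeta>))"
    using W_eq[of z "x + Phi z \<zeta>"] assms by simp
  moreover have "snd (f (z, x + Phi z \<zeta>)) =
      cnj_vec (snd (f (cnj \<zeta>, cnj_vec x))) + dPhi z \<zeta> (Z z (x + Phi z \<zeta>)) (Y \<zeta> x)"
    using tangency[OF assms] by (simp add: Z_def Y_def diff_eq_eq add.commute)
  ultimately show ?thesis by simp
qed

lemma tendsto_Z:
  assumes "(a \<longlongrightarrow> a0) F" "(b \<longlongrightarrow> b0) F" "norm a0 < \<delta>" "b0 \<in> ball 0 \<delta>"
  shows "((\<lambda>s. Z (a s) (b s)) \<longlongrightarrow> Z a0 b0) F"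
  unfolding Z_def
  by (intro tendsto_fst isCont_tendsto_compose[OF cont] tendsto_Pair assms)

lemma tendsto_Y:
  assumes "(a \<longlongrightarrow> a0) F" "(b \<longlongrightarrow> b0) F" "norm a0 < \<delta>" "b0 \<in> ball 0 \<delta>"
  shows "((\<lambda>s. Y (a s) (b s)) \<longlongrightarrow> Y a0 b0) F"
proof -
  have "((\<lambda>s. Z (cnj (a s)) (cnj_vec (b s))) \<longlongrightarrow> Z (cnj a0) (cnj_vec b0)) F"
    by (intro tendsto_Z tendsto_cnj bounded_linear.tendsto[OF bounded_linear_cnj_vec] assms)
      (use assms in simp_all)
  then show ?thesis
    unfolding Y_def Z_def by (rule tendsto_cnj)
qed

lemma
  assumes x: "x \<in> ball 0 \<delta>"
  shows eventually_z: "\<forall>\<^sub>F z in at 0. norm z < \<delta> \<and> x + Phi z \<zeta> \<in> ball 0 \<delta> \<and> z \<noteq> 0"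
    and eventually_zeta: "\<forall>\<^sub>F \<zeta> in at 0. norm \<zeta> < \<delta> \<and> x + Phi z \<zeta> \<in> ball 0 \<delta> \<and> \<zeta> \<noteq> 0"
proof -
  have small: "\<forall>\<^sub>F s::complex in at 0. norm s < \<delta>"
    using pos by (auto simp: eventually_at intro!: exI[of _ \<delta>])
  have nz: "\<forall>\<^sub>F s::complex in at 0. s \<noteq> 0"
    by (simp add: eventually_at_filter)
  have "((\<lambda>z. x + Phi z \<zeta>) \<longlongrightarrow> x + Phi 0 \<zeta>) (at 0)" "((\<lambda>\<zeta>. x + Phi z \<zeta>) \<longlongrightarrow> x + Phi z 0) (at 0)"
    by (intro tendsto_intros tendsto_Phi)+
  from this[THEN topological_tendstoD[OF _ open_ball[of 0 \<delta>]]]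
  have "\<forall>\<^sub>F z in at 0. x + Phi z \<zeta> \<in> ball 0 \<delta>" "\<forall>\<^sub>F \<zeta> in at 0. x + Phi z \<zeta> \<in> ball 0 \<delta>"
    using x by simp_all
  with small nz show "\<forall>\<^sub>F z in at 0. norm z < \<delta> \<and> x + Phi z \<zeta> \<in> ball 0 \<delta> \<and> z \<noteq> 0"
    "\<forall>\<^sub>F \<zeta> in at 0. norm \<zeta> < \<delta> \<and> x + Phi z \<zeta> \<in> ball 0 \<delta> \<and> \<zeta> \<noteq> 0"
    by (simp_all add: eventually_conj_iff)
qed

lemma limit_z:
  assumes "x \<in> ball 0 \<delta>" "norm \<zeta> < \<delta>" "(g \<longlongrightarrow> L) (at 0)" "(h \<longlongrightarrow> M) (at 0)"
    and "\<And>z. \<lbrakk>norm z < \<delta>; x + Phi z \<zeta> \<in> ball 0 \<delta>; z \<noteq> 0\<rbrakk> \<Longrightarrow> g z = h z"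
  shows "L = (M :: complex)"
proof (rule tendsto_unique[OF _ assms(3)])
  show "(g \<longlongrightarrow> M) (at 0)"
    using eventually_z[OF assms(1), of \<zeta>] by (rule Lim_transform_eventually[OF assms(4) eventually_mono])
      (simp add: assms(5))
qed simp

lemma limit_zeta:
  assumes "x \<in> ball 0 \<delta>" "norm z < \<delta>" "(g \<longlongrightarrow> L) (at 0)" "(h \<longlongrightarrow> M) (at 0)"
    and "\<And>\<zeta>. \<lbrakk>norm \<zeta> < \<delta>; x + Phi z \<zeta> \<in> ball 0 \<delta>; \<zeta> \<noteq> 0\<rbrakk> \<Longrightarrow> g \<zeta> = h \<zeta>"
  shows "L = (M :: complex)"
proof (rule tendsto_unique[OF _ assms(3)])
  show "(g \<longlongrightarrow> M) (at 0)"
    using eventually_zeta[OF assms(1), of z] by (rule Lim_transform_eventually[OF assms(4) eventually_mono])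
      (simp add: assms(5))
qed simp

lemma z1_equation:
  assumes "hol8 F \<delta>" "x \<in> ball 0 \<delta>" "norm \<zeta> < \<delta>" "(h \<longlongrightarrow> L) (at 0)"
    and "\<And>z. \<lbrakk>norm z < \<delta>; x + Phi z \<zeta> \<in> ball 0 \<delta>; z \<noteq> 0\<rbrakk> \<Longrightarrow> F (x + Phi z \<zeta>) - F x = z * h z"
  shows "\<zeta> * der F x b11 + \<zeta>^2 * der F x b12 + \<zeta>^3 * der F x b13 + \<zeta>^4 * der F x b41 = L"
  by (rule limit_z[OF assms(2,3) tendsto_increment_z1[OF assms(1,2)] assms(4)]) (simp add: assms(5))

lemma zeta1_equation:
  assumes "hol8 F \<delta>" "x \<in> ball 0 \<delta>" "norm z < \<delta>" "(h \<longlongrightarrow> L) (at 0)"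
    and "\<And>\<zeta>. \<lbrakk>norm \<zeta> < \<delta>; x + Phi z \<zeta> \<in> ball 0 \<delta>; \<zeta> \<noteq> 0\<rbrakk> \<Longrightarrow> F (x + Phi z \<zeta>) - F x = \<zeta> * h \<zeta>"
  shows "z * der F x b11 + z^2 * der F x b21 + z^3 * der F x b31 + z^4 * der F x b41 = L"
  by (rule limit_zeta[OF assms(2,3) tendsto_increment_zeta1[OF assms(1,2)] assms(4)]) (simp add: assms(5))

lemma z2_equation:
  assumes "hol8 F \<delta>" "x \<in> ball 0 \<delta>" "norm \<zeta> < \<delta>"
    "annihilated F \<delta> b11" "annihilated F \<delta> b12" "annihilated F \<delta> b13" "annihilated F \<delta> b41"
    "(h \<longlongrightarrow> L) (at 0)"
    and "\<And>z. \<lbrakk>norm z < \<delta>; x + Phi z \<zeta> \<in> ball 0 \<delta>; z \<noteq> 0\<rbrakk> \<Longrightarrow> F (x + Phi z \<zeta>) - F x = z^2 * h z"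
  shows "\<zeta> * der F x b21 + \<zeta>^2 * der F x b22 + \<zeta>^3 * der F x b32 = L"
  by (rule limit_z[OF assms(2,3) tendsto_increment_z2[OF assms(1,2,4-7)] assms(8)]) (simp add: assms(9))

lemma zeta2_equation:
  assumes "hol8 F \<delta>" "x \<in> ball 0 \<delta>" "norm z < \<delta>"
    "annihilated F \<delta> b11" "annihilated F \<delta> b21" "annihilated F \<delta> b31" "annihilated F \<delta> b41"
    "(h \<longlongrightarrow> L) (at 0)"
    and "\<And>\<zeta>. \<lbrakk>norm \<zeta> < \<delta>; x + Phi z \<zeta> \<in> ball 0 \<delta>; \<zeta> \<noteq> 0\<rbrakk> \<Longrightarrow> F (x + Phi z \<zeta>) - F x = \<zeta>^2 * h \<zeta>"
  shows "z * der F x b12 + z^2 * der F x b22 + z^3 * der F x b32 = L"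
  by (rule limit_zeta[OF assms(2,3) tendsto_increment_zeta2[OF assms(1,2,4-7)] assms(8)]) (simp add: assms(9))

lemmas tendsto_ZY = tendsto_eq_intros tendsto_Z tendsto_Y tendsto_Phi

text \<open>
  Component 7 of \<open>Phi\<close> has degree at least two in \<open>z\<close> and in \<open>\<zeta>\<close>.  Of its derivative only the term in \<open>Z\<close>
  has degree one in \<open>z\<close>, and only the term in \<open>Y\<close> has degree one in \<open>\<zeta>\<close>.  The limits of first order
  therefore exhibit \<open>Z 0\<close> and \<open>Y 0\<close> as directional derivatives of \<open>A7\<close>.
\<close>

lemma A7_derivatives:
  assumes x: "x \<in> ball 0 \<delta>"
  defines "D \<equiv> der (\<lambda>x. A x $ 7) x"
  shows "D b11 = 0" "D b12 = 0" "D b13 = 4 * \<i> * Z 0 x" "D b41 = 0" "D b21 = 0" "D b31 = 4 * \<i> * Y 0 x"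
proof -
  have "\<zeta> * D b11 + \<zeta>^2 * D b12 + \<zeta>^3 * D b13 + \<zeta>^4 * D b41 = 4 * \<i> * \<zeta>^3 * Z 0 x"
    if \<zeta>: "norm \<zeta> < \<delta>" for \<zeta>
    unfolding D_def
  proof (rule z1_equation[OF hol_A x \<zeta>])
    show "((\<lambda>z. 2 * \<i> * (3 * z * Z z (x + Phi z \<zeta>) * \<zeta>^2 + z^2 * (2 * \<zeta> * Y \<zeta> x)
        + 2 * Z z (x + Phi z \<zeta>) * \<zeta>^3 + z * (3 * \<zeta>^2 * Y \<zeta> x))) \<longlongrightarrow> 4 * \<i> * \<zeta>^3 * Z 0 x) (at 0)"
      using x pos by (auto intro!: tendsto_ZY)
  qed (use arg_cong[OF increment[OF _ \<zeta> x], of _ "\<lambda>v. v $ 7"] in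
      \<open>simp add: dPhi_nth algebra_simps eval_nat_numeral\<close>)
  then have z: "D b11 = 0 \<and> D b12 = 0 \<and> D b13 - 4 * \<i> * Z 0 x = 0 \<and> D b41 = 0 \<and> (0::complex) = 0"
    by (intro polynomial_coefficients_zero[OF pos]) (simp add: algebra_simps)
  have "z * D b11 + z^2 * D b21 + z^3 * D b31 + z^4 * D b41 = 4 * \<i> * z^3 * Y 0 x"
    if z: "norm z < \<delta>" for z
    unfolding D_def
  proof (rule zeta1_equation[OF hol_A x z])
    show "((\<lambda>\<zeta>. 2 * \<i> * (3 * z^2 * Z z (x + Phi z \<zeta>) * \<zeta> + z^3 * (2 * Y \<zeta> x)
        + 2 * z * Z z (x + Phi z \<zeta>) * \<zeta>^2 + z^2 * (3 * \<zeta> * Y \<zeta> x))) \<longlongrightarrow> 4 * \<i> * z^3 * Y 0 x) (at 0)"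
      using x pos z by (auto intro!: tendsto_ZY)
  qed (use arg_cong[OF increment[OF z _ x], of _ "\<lambda>v. v $ 7"] in
      \<open>simp add: dPhi_nth algebra_simps eval_nat_numeral\<close>)
  then have "D b11 = 0 \<and> D b21 = 0 \<and> D b31 - 4 * \<i> * Y 0 x = 0 \<and> D b41 = 0 \<and> (0::complex) = 0"
    by (intro polynomial_coefficients_zero[OF pos]) (simp add: algebra_simps)
  with z show "D b11 = 0" "D b12 = 0" "D b13 = 4 * \<i> * Z 0 x" "D b41 = 0" "D b21 = 0" "D b31 = 4 * \<i> * Y 0 x"
    by simp_all
qed

lemma A6_derivatives:
  assumes x: "x \<in> ball 0 \<delta>"
  defines "D \<equiv> der (\<lambda>x. A x $ 6) x"
  shows "D b11 = 0" "D b12 = 4 * \<i> * Z 0 x" "D b13 = 0" "D b41 = 0" "D b21 = 4 * \<i> * Y 0 x" "D b31 = 0"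
proof -
  have "\<zeta> * D b11 + \<zeta>^2 * D b12 + \<zeta>^3 * D b13 + \<zeta>^4 * D b41 = 4 * \<i> * \<zeta>^2 * Z 0 x"
    if \<zeta>: "norm \<zeta> < \<delta>" for \<zeta>
    unfolding D_def
  proof (rule z1_equation[OF hol_A x \<zeta>])
    show "((\<lambda>z. 4 * \<i> * (Z z (x + Phi z \<zeta>) * \<zeta>^2 + z * \<zeta> * Y \<zeta> x)) \<longlongrightarrow> 4 * \<i> * \<zeta>^2 * Z 0 x) (at 0)"
      using x pos by (auto intro!: tendsto_ZY)
  qed (use arg_cong[OF increment[OF _ \<zeta> x], of _ "\<lambda>v. v $ 6"] in
      \<open>simp add: dPhi_nth algebra_simps eval_nat_numeral\<close>)
  then have z: "D b11 = 0 \<and> D b12 - 4 * \<i> * Z 0 x = 0 \<and> D b13 = 0 \<and> D b41 = 0 \<and> (0::complex) = 0"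
    by (intro polynomial_coefficients_zero[OF pos]) (simp add: algebra_simps)
  have "z * D b11 + z^2 * D b21 + z^3 * D b31 + z^4 * D b41 = 4 * \<i> * z^2 * Y 0 x"
    if z: "norm z < \<delta>" for z
    unfolding D_def
  proof (rule zeta1_equation[OF hol_A x z])
    show "((\<lambda>\<zeta>. 4 * \<i> * (z * Z z (x + Phi z \<zeta>) * \<zeta> + z^2 * Y \<zeta> x)) \<longlongrightarrow> 4 * \<i> * z^2 * Y 0 x) (at 0)"
      using x pos z by (auto intro!: tendsto_ZY)
  qed (use arg_cong[OF increment[OF z _ x], of _ "\<lambda>v. v $ 6"] in
      \<open>simp add: dPhi_nth algebra_simps eval_nat_numeral\<close>)
  then have "D b11 = 0 \<and> D b21 - 4 * \<i> * Y 0 x = 0 \<and> D b31 = 0 \<and> D b41 = 0 \<and> (0::complex) = 0"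
    by (intro polynomial_coefficients_zero[OF pos]) (simp add: algebra_simps)
  with z show "D b11 = 0" "D b12 = 4 * \<i> * Z 0 x" "D b13 = 0" "D b41 = 0" "D b21 = 4 * \<i> * Y 0 x" "D b31 = 0"
    by simp_all
qed

text \<open>
  The combination of components 4 and 5 that carries the monomial \<open>z^3 \<zeta>\<close> without its mirror image.
\<close>

definition Q :: "complex ^ 8 \<Rightarrow> complex" where
  "Q x = A x $ 4 + \<i> * A x $ 5"

lemma hol_Q: "hol8 Q \<delta>"
  unfolding Q_def[abs_def] by (intro hol8_lincomb hol_A)

lemma Q_increment:
  assumes "norm z < \<delta>" "norm \<zeta> < \<delta>" "x \<in> ball 0 \<delta>" "x + Phi z \<zeta> \<in> ball 0 \<delta>"
  shows "Q (x + Phi z \<zeta>) - Q x =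
    z^2 * (4 * \<i> * (3 * \<zeta> * Z z (x + Phi z \<zeta>) + z * Y \<zeta> x - z * Y 0 (x + Phi z \<zeta>)))"
proof -
  have "Q (x + Phi z \<zeta>) - Q x = (A (x + Phi z \<zeta>) - A x) $ 4 + \<i> * (A (x + Phi z \<zeta>) - A x) $ 5"
    by (simp add: Q_def algebra_simps)
  then show ?thesis
    by (simp add: increment[OF assms] dPhi_nth algebra_simps eval_nat_numeral)
qed

lemma Q_annihilated:
  "annihilated Q \<delta> b11" "annihilated Q \<delta> b12" "annihilated Q \<delta> b13" "annihilated Q \<delta> b41"
proof -
  have "\<zeta> * der Q x b11 + \<zeta>^2 * der Q x b12 + \<zeta>^3 * der Q x b13 + \<zeta>^4 * der Q x b41 = 0"
    if \<zeta>: "norm \<zeta> < \<delta>" and x: "x \<in> ball 0 \<delta>" for \<zeta> x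
  proof (rule z1_equation[OF hol_Q x \<zeta>])
    show "((\<lambda>z. z * (4 * \<i> * (3 * \<zeta> * Z z (x + Phi z \<zeta>) + z * Y \<zeta> x - z * Y 0 (x + Phi z \<zeta>))))
        \<longlongrightarrow> 0) (at 0)"
      using x pos by (auto intro!: tendsto_ZY)
  qed (use Q_increment[OF _ \<zeta> x] in \<open>simp add: power2_eq_square\<close>)
  then have "der Q x b11 = 0 \<and> der Q x b12 = 0 \<and> der Q x b13 = 0 \<and> der Q x b41 = 0 \<and> (0::complex) = 0"
    if "x \<in> ball 0 \<delta>" for x
    by (intro polynomial_coefficients_zero[OF pos]) (simp add: that[unfolded mem_ball_0])
  then show "annihilated Q \<delta> b11" "annihilated Q \<delta> b12" "annihilated Q \<delta> b13" "annihilated Q \<delta> b41"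
    unfolding annihilated_def by blast+
qed

lemma Q_derivatives:
  assumes x: "x \<in> ball 0 \<delta>"
  shows "der Q x b21 = 12 * \<i> * Z 0 x" "der Q x b22 = 0" "der Q x b32 = 0"
proof -
  have "\<zeta> * der Q x b21 + \<zeta>^2 * der Q x b22 + \<zeta>^3 * der Q x b32 = 12 * \<i> * \<zeta> * Z 0 x"
    if \<zeta>: "norm \<zeta> < \<delta>" for \<zeta>
  proof (rule z2_equation[OF hol_Q x \<zeta> Q_annihilated])
    show "((\<lambda>z. 4 * \<i> * (3 * \<zeta> * Z z (x + Phi z \<zeta>) + z * Y \<zeta> x - z * Y 0 (x + Phi z \<zeta>)))
        \<longlongrightarrow> 12 * \<i> * \<zeta> * Z 0 x) (at 0)"
      using x pos by (auto intro!: tendsto_ZY)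
  qed (use Q_increment[OF _ \<zeta> x] in simp)
  then have "der Q x b21 - 12 * \<i> * Z 0 x = 0 \<and> der Q x b22 = 0 \<and> der Q x b32 = 0 \<and> (0::complex) = 0 \<and> (0::complex) = 0"
    by (intro polynomial_coefficients_zero[OF pos]) (simp add: algebra_simps)
  then show "der Q x b21 = 12 * \<i> * Z 0 x" "der Q x b22 = 0" "der Q x b32 = 0"
    by simp_all
qed

text \<open>
  \<open>Z 0\<close> is a directional derivative of \<open>A7\<close>, of \<open>A6\<close> and of \<open>Q\<close>.  By \<open>der_annihilated\<close> it is constant
  along every direction along which one of them is, and together these are all eight.
\<close>

lemma Z0_constant:
  assumes "x \<in> ball 0 \<delta>"
  shows "Z 0 x = Z 0 0"
proof (rule annihilated_constant[OF hol_Z0])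
  note A7 = der_annihilated[OF hol_A[of 7] hol_Z0, of "4 * \<i>" b13, OF _ A7_derivatives(3)]
  note A6 = der_annihilated[OF hol_A[of 6] hol_Z0, of "4 * \<i>" b12, OF _ A6_derivatives(2)]
  note Q = der_annihilated[OF hol_Q hol_Z0, of "12 * \<i>" b21, OF _ Q_derivatives(1)]
  show "annihilated (Z 0) \<delta> b11" "annihilated (Z 0) \<delta> b21" "annihilated (Z 0) \<delta> b12" "annihilated (Z 0) \<delta> b41"
    by (rule A7; simp add: annihilated_def A7_derivatives)+
  show "annihilated (Z 0) \<delta> b31" "annihilated (Z 0) \<delta> b13"
    by (rule A6; simp add: annihilated_def A6_derivatives)+
  show "annihilated (Z 0) \<delta> b22" "annihilated (Z 0) \<delta> b32"
    by (rule Q; simp add: annihilated_def Q_derivatives)+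
qed (rule assms)

end

section \<open>Normalized symmetries vanish\<close>

lemma cancel_factor:
  fixes s :: complex
  shows "s \<noteq> 0 \<Longrightarrow> s * (a * (b / s) - c * (d / s)) = a * b - c * d"
  by (simp add: field_simps)

text \<open>
  The normalization kills the fields with \<open>\<partial>z\<close>-coefficient at the origin, the translations in \<open>w\<close>, and the
  dilation, whose coefficient of \<open>\<partial>/\<partial>w 1\<close> is \<open>2 w 1\<close>.
\<close>

locale normalized_symmetry = complexified_symmetry +
  assumes at_0: "f (0, 0) = 0"
    and no_dilation: "Re (der (\<lambda>x. snd (f (0, x)) $ 1) 0 (axis 1 1)) = 0"
begin

lemma Z0 [simp]: "x \<in> ball 0 \<delta> \<Longrightarrow> Z 0 x = 0"
  using Z0_constant[of x] at_0 by (simp add: Z_def)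

lemma Y0 [simp]: "x \<in> ball 0 \<delta> \<Longrightarrow> Y 0 x = 0"
  using Z0[of "cnj_vec x"] by (simp add: Z_def Y_def)

lemma W_eq_A: "norm z < \<delta> \<Longrightarrow> x \<in> ball 0 \<delta> \<Longrightarrow> snd (f (z, x)) = A x"
  by (simp add: W_eq) (simp add: dPhi_def)

lemma A_increment:
  assumes "norm z < \<delta>" "norm \<zeta> < \<delta>" "x \<in> ball 0 \<delta>" "x + Phi z \<zeta> \<in> ball 0 \<delta>"
  shows "A (x + Phi z \<zeta>) $ l - A x $ l = dPhi z \<zeta> (Z z (x + Phi z \<zeta>)) (Y \<zeta> x) $ l"
proof -
  have "dPhi z 0 0 0 = 0" "dPhi 0 \<zeta> 0 0 = 0" by (simp_all add: dPhi_def)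
  then show ?thesis
    using arg_cong[OF increment[OF assms], of "\<lambda>v. v $ l"] assms by simp
qed

text \<open>
  Combinations of components 2 and 3 that carry only \<open>z^2 \<zeta>\<close>, respectively only \<open>z \<zeta>^2\<close>; \<open>Q'\<close> is the
  mirror image of \<open>Q\<close>.
\<close>

definition C where "C x = A x $ 2 + \<i> * A x $ 3"
definition C' where "C' x = A x $ 2 + (-\<i>) * A x $ 3"
definition Q' where "Q' x = A x $ 4 + (-\<i>) * A x $ 5"

lemma hol_CQ: "hol8 C \<delta>" "hol8 C' \<delta>" "hol8 Q' \<delta>"
  unfolding C_def[abs_def] C'_def[abs_def] Q'_def[abs_def] by (intro hol8_lincomb hol_A)+

lemma A1_increment:
  assumes "norm z < \<delta>" "norm \<zeta> < \<delta>" "x \<in> ball 0 \<delta>" "x + Phi z \<zeta> \<in> ball 0 \<delta>"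
  shows "A (x + Phi z \<zeta>) $ 1 - A x $ 1 = 2 * \<i> * (\<zeta> * Z z (x + Phi z \<zeta>) + z * Y \<zeta> x)"
  by (simp add: A_increment[OF assms] dPhi_nth algebra_simps)

lemma C_increment:
  assumes "norm z < \<delta>" "norm \<zeta> < \<delta>" "x \<in> ball 0 \<delta>" "x + Phi z \<zeta> \<in> ball 0 \<delta>"
  shows "C (x + Phi z \<zeta>) - C x = 4 * \<i> * z * (2 * \<zeta> * Z z (x + Phi z \<zeta>) + z * Y \<zeta> x)"
proof -
  have "C (x + Phi z \<zeta>) - C x =
      (A (x + Phi z \<zeta>) $ 2 - A x $ 2) + \<i> * (A (x + Phi z \<zeta>) $ 3 - A x $ 3)"
    by (simp add: C_def algebra_simps)
  also have "\<dots> = 4 * \<i> * z * (2 * \<zeta> * Z z (x + Phi z \<zeta>) + z * Y \<zeta> x)"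
    by (simp add: A_increment[OF assms] dPhi_nth algebra_simps eval_nat_numeral)
  finally show ?thesis .
qed

lemma C'_increment:
  assumes "norm z < \<delta>" "norm \<zeta> < \<delta>" "x \<in> ball 0 \<delta>" "x + Phi z \<zeta> \<in> ball 0 \<delta>"
  shows "C' (x + Phi z \<zeta>) - C' x = 4 * \<i> * \<zeta> * (\<zeta> * Z z (x + Phi z \<zeta>) + 2 * z * Y \<zeta> x)"
proof -
  have "C' (x + Phi z \<zeta>) - C' x =
      (A (x + Phi z \<zeta>) $ 2 - A x $ 2) - \<i> * (A (x + Phi z \<zeta>) $ 3 - A x $ 3)"
    by (simp add: C'_def algebra_simps)
  also have "\<dots> = 4 * \<i> * \<zeta> * (\<zeta> * Z z (x + Phi z \<zeta>) + 2 * z * Y \<zeta> x)"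
    by (simp add: A_increment[OF assms] dPhi_nth algebra_simps eval_nat_numeral)
  finally show ?thesis .
qed

lemma Q'_increment:
  assumes "norm z < \<delta>" "norm \<zeta> < \<delta>" "x \<in> ball 0 \<delta>" "x + Phi z \<zeta> \<in> ball 0 \<delta>"
  shows "Q' (x + Phi z \<zeta>) - Q' x = 4 * \<i> * \<zeta>^2 * (\<zeta> * Z z (x + Phi z \<zeta>) + 3 * z * Y \<zeta> x)"
proof -
  have "Q' (x + Phi z \<zeta>) - Q' x =
      (A (x + Phi z \<zeta>) $ 4 - A x $ 4) - \<i> * (A (x + Phi z \<zeta>) $ 5 - A x $ 5)"
    by (simp add: Q'_def algebra_simps)
  also have "\<dots> = 4 * \<i> * \<zeta>^2 * (\<zeta> * Z z (x + Phi z \<zeta>) + 3 * z * Y \<zeta> x)"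
    by (simp add: A_increment[OF assms] dPhi_nth algebra_simps eval_nat_numeral)
  finally show ?thesis .
qed

text \<open>
  All increments are combinations of the two quantities \<open>Z\<close> at \<open>(z, w)\<close> and \<open>Y\<close> at \<open>(\<zeta>, x)\<close>.  The next
  four lemmas eliminate these.
\<close>

lemma A6_relation:
  assumes "norm z < \<delta>" "norm \<zeta> < \<delta>" "x \<in> ball 0 \<delta>" "x + Phi z \<zeta> \<in> ball 0 \<delta>"
  shows "A (x + Phi z \<zeta>) $ 6 - A x $ 6 = 2 * z * \<zeta> * (A (x + Phi z \<zeta>) $ 1 - A x $ 1)"
  by (simp add: A_increment[OF assms] dPhi_nth algebra_simps eval_nat_numeral)

lemma Q_relation:
  assumes "norm z < \<delta>" "norm \<zeta> < \<delta>" "x \<in> ball 0 \<delta>" "x + Phi z \<zeta> \<in> ball 0 \<delta>"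
  shows "Q (x + Phi z \<zeta>) - Q x =
    2 * z * (C (x + Phi z \<zeta>) - C x) - 2 * z^2 * (A (x + Phi z \<zeta>) $ 1 - A x $ 1)"
  using assms(4)
  by (simp add: Q_increment[OF assms] C_increment[OF assms] A1_increment[OF assms] algebra_simps eval_nat_numeral)

lemma Q'_relation:
  assumes "norm z < \<delta>" "norm \<zeta> < \<delta>" "x \<in> ball 0 \<delta>" "x + Phi z \<zeta> \<in> ball 0 \<delta>"
  shows "Q' (x + Phi z \<zeta>) - Q' x =
    2 * \<zeta> * (C' (x + Phi z \<zeta>) - C' x) - 2 * \<zeta>^2 * (A (x + Phi z \<zeta>) $ 1 - A x $ 1)"
  by (simp add: Q'_increment[OF assms] C'_increment[OF assms] A1_increment[OF assms] algebra_simps eval_nat_numeral)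

lemma C_C'_relation:
  assumes "norm z < \<delta>" "norm \<zeta> < \<delta>" "x \<in> ball 0 \<delta>" "x + Phi z \<zeta> \<in> ball 0 \<delta>"
  shows "\<zeta> * (C (x + Phi z \<zeta>) - C x) + z * (C' (x + Phi z \<zeta>) - C' x) =
    6 * z * \<zeta> * (A (x + Phi z \<zeta>) $ 1 - A x $ 1)"
  by (simp add: C_increment[OF assms] C'_increment[OF assms] A1_increment[OF assms] algebra_simps)

abbreviation "A1 \<equiv> (\<lambda>x. A x $ 1)"
abbreviation "A6 \<equiv> (\<lambda>x. A x $ 6)"
abbreviation "A7 \<equiv> (\<lambda>x. A x $ 7)"

lemma A6_annihilated:
  "annihilated A6 \<delta> b11" "annihilated A6 \<delta> b12" "annihilated A6 \<delta> b13"
  "annihilated A6 \<delta> b41" "annihilated A6 \<delta> b21" "annihilated A6 \<delta> b31"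
  unfolding annihilated_def by (simp_all add: A6_derivatives)

lemma A7_annihilated:
  "annihilated A7 \<delta> b11" "annihilated A7 \<delta> b12" "annihilated A7 \<delta> b13"
  "annihilated A7 \<delta> b41" "annihilated A7 \<delta> b21" "annihilated A7 \<delta> b31"
  unfolding annihilated_def by (simp_all add: A7_derivatives)

lemma Q_annihilated':
  "annihilated Q \<delta> b21" "annihilated Q \<delta> b22" "annihilated Q \<delta> b32"
  unfolding annihilated_def by (simp_all add: Q_derivatives)

lemma z1_annihilated:
  assumes F: "hol8 F \<delta>"
    and lim: "\<And>\<zeta> x. norm \<zeta> < \<delta> \<Longrightarrow> x \<in> ball 0 \<delta> \<Longrightarrow> ((\<lambda>z. h \<zeta> x z) \<longlongrightarrow> 0) (at 0)"
    and incr: "\<And>z \<zeta> x. \<lbrakk>norm z < \<delta>; norm \<zeta> < \<delta>; x \<in> ball 0 \<delta>; x + Phi z \<zeta> \<in> ball 0 \<delta>\<rbrakk> \<Longrightarrow>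
      F (x + Phi z \<zeta>) - F x = z * h \<zeta> x z"
  shows "annihilated F \<delta> b11 \<and> annihilated F \<delta> b12 \<and> annihilated F \<delta> b13 \<and> annihilated F \<delta> b41"
proof -
  have "der F x b11 = 0 \<and> der F x b12 = 0 \<and> der F x b13 = 0 \<and> der F x b41 = 0 \<and> (0::complex) = 0"
    if x: "x \<in> ball 0 \<delta>" for x
  proof (rule polynomial_coefficients_zero[OF pos])
    show "\<zeta> * der F x b11 + \<zeta>^2 * der F x b12 + \<zeta>^3 * der F x b13 + \<zeta>^4 * der F x b41 + \<zeta>^5 * 0 = 0"
      if \<zeta>: "norm \<zeta> < \<delta>" for \<zeta>
      using z1_equation[OF F x \<zeta> lim[OF \<zeta> x] incr[OF _ \<zeta> x]] by simp
  qed
  then show ?thesis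
    unfolding annihilated_def by blast
qed

lemma zeta1_annihilated:
  assumes F: "hol8 F \<delta>"
    and lim: "\<And>z x. norm z < \<delta> \<Longrightarrow> x \<in> ball 0 \<delta> \<Longrightarrow> ((\<lambda>\<zeta>. h z x \<zeta>) \<longlongrightarrow> 0) (at 0)"
    and incr: "\<And>z \<zeta> x. \<lbrakk>norm z < \<delta>; norm \<zeta> < \<delta>; x \<in> ball 0 \<delta>; x + Phi z \<zeta> \<in> ball 0 \<delta>\<rbrakk> \<Longrightarrow>
      F (x + Phi z \<zeta>) - F x = \<zeta> * h z x \<zeta>"
  shows "annihilated F \<delta> b11 \<and> annihilated F \<delta> b21 \<and> annihilated F \<delta> b31 \<and> annihilated F \<delta> b41"
proof -
  have "der F x b11 = 0 \<and> der F x b21 = 0 \<and> der F x b31 = 0 \<and> der F x b41 = 0 \<and> (0::complex) = 0"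
    if x: "x \<in> ball 0 \<delta>" for x
  proof (rule polynomial_coefficients_zero[OF pos])
    show "z * der F x b11 + z^2 * der F x b21 + z^3 * der F x b31 + z^4 * der F x b41 + z^5 * 0 = 0"
      if z: "norm z < \<delta>" for z
      using zeta1_equation[OF F x z lim[OF z x] incr[OF z _ x]] by simp
  qed
  then show ?thesis
    unfolding annihilated_def by blast
qed

lemma C_annihilated:
  "annihilated C \<delta> b11" "annihilated C \<delta> b12" "annihilated C \<delta> b13" "annihilated C \<delta> b41"
proof -
  have "annihilated C \<delta> b11 \<and> annihilated C \<delta> b12 \<and> annihilated C \<delta> b13 \<and> annihilated C \<delta> b41"
  proof (rule z1_annihilated[OF hol_CQ(1)])
    show "((\<lambda>z. 4 * \<i> * (2 * \<zeta> * Z z (x + Phi z \<zeta>) + z * Y \<zeta> x)) \<longlongrightarrow> 0) (at 0)"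
      if "norm \<zeta> < \<delta>" "x \<in> ball 0 \<delta>" for \<zeta> x
      using that pos by (auto intro!: tendsto_ZY)
  qed (simp add: C_increment)
  then show "annihilated C \<delta> b11" "annihilated C \<delta> b12" "annihilated C \<delta> b13" "annihilated C \<delta> b41"
    by simp_all
qed

lemma C'_annihilated:
  "annihilated C' \<delta> b11" "annihilated C' \<delta> b21" "annihilated C' \<delta> b31" "annihilated C' \<delta> b41"
proof -
  have "annihilated C' \<delta> b11 \<and> annihilated C' \<delta> b21 \<and> annihilated C' \<delta> b31 \<and> annihilated C' \<delta> b41"
  proof (rule zeta1_annihilated[OF hol_CQ(2)])
    show "((\<lambda>\<zeta>. 4 * \<i> * (\<zeta> * Z z (x + Phi z \<zeta>) + 2 * z * Y \<zeta> x)) \<longlongrightarrow> 0) (at 0)"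
      if "norm z < \<delta>" "x \<in> ball 0 \<delta>" for z x
      using that pos by (auto intro!: tendsto_ZY)
  qed (simp add: C'_increment)
  then show "annihilated C' \<delta> b11" "annihilated C' \<delta> b21" "annihilated C' \<delta> b31" "annihilated C' \<delta> b41"
    by simp_all
qed

lemma Q'_annihilated:
  "annihilated Q' \<delta> b11" "annihilated Q' \<delta> b21" "annihilated Q' \<delta> b31" "annihilated Q' \<delta> b41"
proof -
  have "annihilated Q' \<delta> b11 \<and> annihilated Q' \<delta> b21 \<and> annihilated Q' \<delta> b31 \<and> annihilated Q' \<delta> b41"
  proof (rule zeta1_annihilated[OF hol_CQ(3)])
    show "((\<lambda>\<zeta>. 4 * \<i> * \<zeta> * (\<zeta> * Z z (x + Phi z \<zeta>) + 3 * z * Y \<zeta> x)) \<longlongrightarrow> 0) (at 0)"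
      if "norm z < \<delta>" "x \<in> ball 0 \<delta>" for z x
      using that pos by (auto intro!: tendsto_ZY)
  qed (simp add: Q'_increment power2_eq_square)
  then show "annihilated Q' \<delta> b11" "annihilated Q' \<delta> b21" "annihilated Q' \<delta> b31" "annihilated Q' \<delta> b41"
    by simp_all
qed

text \<open>
  \<open>A6\<close> is constant along all vectors except \<open>b22\<close> and \<open>b32\<close>, so its increments start in degree two in
  \<open>z\<close> and in \<open>\<zeta>\<close>.  Comparing the coefficients of \<open>A6_relation\<close> in both expansions gives the claims.
\<close>

lemma A6_A1:
  assumes x: "x \<in> ball 0 \<delta>"
  shows "der A6 x b22 = 2 * der A1 x b11" "der A6 x b32 = 2 * der A1 x b12"
    "der A6 x b32 = 2 * der A1 x b21" "der A1 x b13 = 0" "der A1 x b41 = 0" "der A1 x b31 = 0"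
proof -
  have 1: "\<zeta> * der A6 x b21 + \<zeta>^2 * der A6 x b22 + \<zeta>^3 * der A6 x b32 = 2 * \<zeta> *
      (\<zeta> * der A1 x b11 + \<zeta>^2 * der A1 x b12 + \<zeta>^3 * der A1 x b13 + \<zeta>^4 * der A1 x b41)"
    if \<zeta>: "norm \<zeta> < \<delta>" for \<zeta>
  proof (rule z2_equation[OF hol_A x \<zeta> A6_annihilated(1-4)])
    show "((\<lambda>z. 2 * \<zeta> * ((A1 (x + Phi z \<zeta>) - A1 x) / z)) \<longlongrightarrow> 2 * \<zeta> *
      (\<zeta> * der A1 x b11 + \<zeta>^2 * der A1 x b12 + \<zeta>^3 * der A1 x b13 + \<zeta>^4 * der A1 x b41)) (at 0)"
      by (intro tendsto_mult_left tendsto_increment_z1[where r = \<delta>] hol_A x)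
  qed (use A6_relation[OF _ \<zeta> x] in \<open>simp add: power2_eq_square\<close>)
  have "der A6 x b21 = 0 \<and> der A6 x b22 - 2 * der A1 x b11 = 0 \<and> der A6 x b32 - 2 * der A1 x b12 = 0 \<and>
      - 2 * der A1 x b13 = 0 \<and> - 2 * der A1 x b41 = 0"
    by (rule polynomial_coefficients_zero[OF pos]) (use 1 in \<open>simp add: algebra_simps eval_nat_numeral\<close>)
  then show 2: "der A6 x b22 = 2 * der A1 x b11" "der A6 x b32 = 2 * der A1 x b12" "der A1 x b13 = 0" "der A1 x b41 = 0"
    by simp_all
  have 3: "z * der A6 x b12 + z^2 * der A6 x b22 + z^3 * der A6 x b32 = 2 * z *
      (z * der A1 x b11 + z^2 * der A1 x b21 + z^3 * der A1 x b31 + z^4 * der A1 x b41)"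
    if z: "norm z < \<delta>" for z
  proof (rule zeta2_equation[OF hol_A x z A6_annihilated(1,5,6,4)])
    show "((\<lambda>\<zeta>. 2 * z * ((A1 (x + Phi z \<zeta>) - A1 x) / \<zeta>)) \<longlongrightarrow> 2 * z *
      (z * der A1 x b11 + z^2 * der A1 x b21 + z^3 * der A1 x b31 + z^4 * der A1 x b41)) (at 0)"
      by (intro tendsto_mult_left tendsto_increment_zeta1[where r = \<delta>] hol_A x)
  qed (use A6_relation[OF z _ x] in \<open>simp add: power2_eq_square\<close>)
  have "der A6 x b12 = 0 \<and> der A6 x b22 - 2 * der A1 x b11 = 0 \<and> der A6 x b32 - 2 * der A1 x b21 = 0 \<and>
      - 2 * der A1 x b31 = 0 \<and> - 2 * der A1 x b41 = 0"
    by (rule polynomial_coefficients_zero[OF pos]) (use 3 in \<open>simp add: algebra_simps eval_nat_numeral\<close>)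
  then show "der A6 x b32 = 2 * der A1 x b21" "der A1 x b31 = 0"
    by simp_all
qed

text \<open>
  The relation for \<open>Q\<close> to first order in \<open>\<zeta>\<close> and to third order in \<open>z\<close>; the third order is available since
  \<open>Q\<close> is constant along all vectors except \<open>b31\<close>.
\<close>

lemma Q_C:
  assumes x: "x \<in> ball 0 \<delta>"
  shows "der Q x b31 = 2 * der C x b21 - 2 * der A1 x b11" "der C x b31 = der A1 x b21"
    "der C x b22 = der A1 x b12" "der C x b32 = 0"
proof -
  have 1: "z * der Q x b11 + z^2 * der Q x b21 + z^3 * der Q x b31 + z^4 * der Q x b41 =
      2 * z * (z * der C x b11 + z^2 * der C x b21 + z^3 * der C x b31 + z^4 * der C x b41)
      - 2 * z^2 * (z * der A1 x b11 + z^2 * der A1 x b21 + z^3 * der A1 x b31 + z^4 * der A1 x b41)"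
    if z: "norm z < \<delta>" for z
  proof (rule zeta1_equation[OF hol_Q x z])
    show "((\<lambda>\<zeta>. 2 * z * ((C (x + Phi z \<zeta>) - C x) / \<zeta>) - 2 * z^2 * ((A1 (x + Phi z \<zeta>) - A1 x) / \<zeta>))
      \<longlongrightarrow> 2 * z * (z * der C x b11 + z^2 * der C x b21 + z^3 * der C x b31 + z^4 * der C x b41)
      - 2 * z^2 * (z * der A1 x b11 + z^2 * der A1 x b21 + z^3 * der A1 x b31 + z^4 * der A1 x b41)) (at 0)"
      by (intro tendsto_diff tendsto_mult_left tendsto_increment_zeta1[where r = \<delta>] hol_A hol_CQ x)
  qed (simp only: Q_relation[OF z _ x] cancel_factor not_False_eq_True)
  have Qx: "der Q x b11 = 0" "der Q x b21 = 0" "der Q x b41 = 0" "der C x b11 = 0" "der C x b41 = 0"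
    using Q_annihilated Q_annihilated' C_annihilated x by (auto simp: annihilated_def)
  have "0 = (0::complex) \<and> 0 = (0::complex) \<and> der Q x b31 - 2 * der C x b21 + 2 * der A1 x b11 = 0 \<and>
     2 * der A1 x b21 - 2 * der C x b31 = 0 \<and> 0 = (0::complex)"
    by (rule polynomial_coefficients_zero[OF pos])
      (use 1 in \<open>simp add: Qx A6_A1[OF x] algebra_simps eval_nat_numeral\<close>)
  then show "der Q x b31 = 2 * der C x b21 - 2 * der A1 x b11" "der C x b31 = der A1 x b21"
    by (auto simp: algebra_simps)
  have 2: "\<zeta> * der Q x b31 =
      2 * (\<zeta> * der C x b21 + \<zeta>^2 * der C x b22 + \<zeta>^3 * der C x b32)
      - 2 * (\<zeta> * der A1 x b11 + \<zeta>^2 * der A1 x b12 + \<zeta>^3 * der A1 x b13 + \<zeta>^4 * der A1 x b41)"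
    if \<zeta>: "norm \<zeta> < \<delta>" for \<zeta>
  proof (rule limit_z[OF x \<zeta> tendsto_increment_z3[OF hol_Q x Q_annihilated Q_annihilated']])
    show "((\<lambda>z. 2 * ((C (x + Phi z \<zeta>) - C x) / z^2) - 2 * ((A1 (x + Phi z \<zeta>) - A1 x) / z))
      \<longlongrightarrow> 2 * (\<zeta> * der C x b21 + \<zeta>^2 * der C x b22 + \<zeta>^3 * der C x b32)
      - 2 * (\<zeta> * der A1 x b11 + \<zeta>^2 * der A1 x b12 + \<zeta>^3 * der A1 x b13 + \<zeta>^4 * der A1 x b41)) (at 0)"
      by (intro tendsto_diff tendsto_mult_left tendsto_increment_z1[where r = \<delta>] tendsto_increment_z2[where r = \<delta>] hol_A hol_CQ x
          C_annihilated)
  qed (use Q_relation[OF _ \<zeta> x] in \<open>simp add: field_simps eval_nat_numeral\<close>)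
  have "der Q x b31 - 2 * der C x b21 + 2 * der A1 x b11 = 0 \<and> 2 * der A1 x b12 - 2 * der C x b22 = 0 \<and>
      - 2 * der C x b32 = 0 \<and> 0 = (0::complex) \<and> 0 = (0::complex)"
    by (rule polynomial_coefficients_zero[OF pos])
      (use 2 in \<open>simp add: A6_A1[OF x] algebra_simps\<close>)
  then show "der C x b22 = der A1 x b12" "der C x b32 = 0"
    by auto
qed

text \<open>
  Two expressions for the derivatives of \<open>A1\<close> along \<open>b12\<close>: with \<open>Q_C\<close>, the terms on the left of the second
  equation both equal that derivative, so that six times it is twice it.
\<close>

lemma C'_A1:
  assumes x: "x \<in> ball 0 \<delta>"
  shows "der C' x b13 = der A1 x b12" "der C x b22 + der C' x b13 = 6 * der A1 x b12"
proof -
  have "\<zeta> * der Q' x b11 + \<zeta>^2 * der Q' x b12 + \<zeta>^3 * der Q' x b13 + \<zeta>^4 * der Q' x b41 =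
      2 * \<zeta> * (\<zeta> * der C' x b11 + \<zeta>^2 * der C' x b12 + \<zeta>^3 * der C' x b13 + \<zeta>^4 * der C' x b41)
      - 2 * \<zeta>^2 * (\<zeta> * der A1 x b11 + \<zeta>^2 * der A1 x b12 + \<zeta>^3 * der A1 x b13 + \<zeta>^4 * der A1 x b41)"
    if \<zeta>: "norm \<zeta> < \<delta>" for \<zeta>
  proof (rule z1_equation[OF hol_CQ(3) x \<zeta>])
    show "((\<lambda>z. 2 * \<zeta> * ((C' (x + Phi z \<zeta>) - C' x) / z) - 2 * \<zeta>^2 * ((A1 (x + Phi z \<zeta>) - A1 x) / z))
      \<longlongrightarrow> 2 * \<zeta> * (\<zeta> * der C' x b11 + \<zeta>^2 * der C' x b12 + \<zeta>^3 * der C' x b13 + \<zeta>^4 * der C' x b41)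
      - 2 * \<zeta>^2 * (\<zeta> * der A1 x b11 + \<zeta>^2 * der A1 x b12 + \<zeta>^3 * der A1 x b13 + \<zeta>^4 * der A1 x b41)) (at 0)"
      by (intro tendsto_diff tendsto_mult_left tendsto_increment_z1[where r = \<delta>] hol_A hol_CQ x)
  qed (simp only: Q'_relation[OF _ \<zeta> x] cancel_factor not_False_eq_True)
  moreover have "der Q' x b11 = 0" "der Q' x b41 = 0" "der C' x b11 = 0" "der C' x b41 = 0"
    using Q'_annihilated C'_annihilated x by (auto simp: annihilated_def)
  ultimately have "0 = (0::complex) \<and> der Q' x b12 = 0 \<and> der Q' x b13 - 2 * der C' x b12 + 2 * der A1 x b11 = 0 \<and>
     2 * der A1 x b12 - 2 * der C' x b13 = 0 \<and> 0 = (0::complex)"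
    by (intro polynomial_coefficients_zero[OF pos])
      (simp add: A6_A1[OF x] algebra_simps eval_nat_numeral)
  then show "der C' x b13 = der A1 x b12"
    by auto
  have "\<zeta> * (\<zeta> * der C x b21 + \<zeta>^2 * der C x b22 + \<zeta>^3 * der C x b32)
      + (\<zeta> * der C' x b11 + \<zeta>^2 * der C' x b12 + \<zeta>^3 * der C' x b13 + \<zeta>^4 * der C' x b41) =
      6 * \<zeta> * (\<zeta> * der A1 x b11 + \<zeta>^2 * der A1 x b12 + \<zeta>^3 * der A1 x b13 + \<zeta>^4 * der A1 x b41)"
    if \<zeta>: "norm \<zeta> < \<delta>" for \<zeta>
  proof (rule limit_z[OF x \<zeta>])
    show "((\<lambda>z. \<zeta> * ((C (x + Phi z \<zeta>) - C x) / z^2) + (C' (x + Phi z \<zeta>) - C' x) / z) \<longlongrightarrow>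
      \<zeta> * (\<zeta> * der C x b21 + \<zeta>^2 * der C x b22 + \<zeta>^3 * der C x b32)
      + (\<zeta> * der C' x b11 + \<zeta>^2 * der C' x b12 + \<zeta>^3 * der C' x b13 + \<zeta>^4 * der C' x b41)) (at 0)"
      by (intro tendsto_add tendsto_mult_left tendsto_increment_z1[where r = \<delta>] tendsto_increment_z2[where r = \<delta>] hol_A hol_CQ x
          C_annihilated)
    show "((\<lambda>z. 6 * \<zeta> * ((A1 (x + Phi z \<zeta>) - A1 x) / z)) \<longlongrightarrow>
      6 * \<zeta> * (\<zeta> * der A1 x b11 + \<zeta>^2 * der A1 x b12 + \<zeta>^3 * der A1 x b13 + \<zeta>^4 * der A1 x b41)) (at 0)"
      by (intro tendsto_mult_left tendsto_increment_z1[where r = \<delta>] hol_A x)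
  next
    fix z assume z: "norm z < \<delta>" "x + Phi z \<zeta> \<in> ball 0 \<delta>" "z \<noteq> 0"
    have "\<zeta> * ((C (x + Phi z \<zeta>) - C x) / z^2) + (C' (x + Phi z \<zeta>) - C' x) / z =
      (\<zeta> * (C (x + Phi z \<zeta>) - C x) + z * (C' (x + Phi z \<zeta>) - C' x)) / z^2"
      using z(3) by (simp add: field_simps power2_eq_square)
    also have "\<dots> = 6 * \<zeta> * ((A1 (x + Phi z \<zeta>) - A1 x) / z)"
      unfolding C_C'_relation[OF z(1) \<zeta> x z(2)] using z(3) by (simp add: field_simps power2_eq_square)
    finally show "\<zeta> * ((C (x + Phi z \<zeta>) - C x) / z^2) + (C' (x + Phi z \<zeta>) - C' x) / z =
      6 * \<zeta> * ((A1 (x + Phi z \<zeta>) - A1 x) / z)" .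
  qed
  moreover have "der C' x b11 = 0" "der C' x b41 = 0"
    using C'_annihilated x by (auto simp: annihilated_def)
  ultimately have "0 = (0::complex) \<and> der C x b21 + der C' x b12 - 6 * der A1 x b11 = 0 \<and>
     der C x b22 + der C' x b13 - 6 * der A1 x b12 = 0 \<and> 0 = (0::complex) \<and> 0 = (0::complex)"
    by (intro polynomial_coefficients_zero[OF pos])
      (simp add: A6_A1[OF x] Q_C[OF x] algebra_simps eval_nat_numeral)
  then show "der C x b22 + der C' x b13 = 6 * der A1 x b12"
    by simp
qed

lemma degree_three_derivatives_zero:
  assumes "x \<in> ball 0 \<delta>"
  shows "der A1 x b12 = 0" "der A1 x b21 = 0" "der C x b31 = 0" "der C x b22 = 0" "der C x b32 = 0"
    "der A6 x b32 = 0"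
  using A6_A1[OF assms] Q_C[OF assms] C'_A1[OF assms] by auto

lemma A6_annihilated_b32: "annihilated A6 \<delta> b32"
  by (simp add: annihilated_def degree_three_derivatives_zero)

lemma C_annihilated_most:
  "annihilated C \<delta> b31" "annihilated C \<delta> b22" "annihilated C \<delta> b32"
  by (simp_all add: annihilated_def degree_three_derivatives_zero)

text \<open>
  The derivative of \<open>A6\<close> along \<open>b22\<close> does not change along the other vectors because \<open>A6\<close> does not, and it
  does not change along \<open>b22\<close> because it is also a combination of derivatives of \<open>C\<close> and \<open>Q\<close>, which are
  constant along \<open>b22\<close>.
\<close>

lemma A6_b22_constant:
  assumes x: "x \<in> ball 0 \<delta>"
  shows "der A6 x b22 = der A6 0 b22"
proof -
  obtain c1 c2 c3 c4 c5 c6 c7 c8 where decomp: "x = c1 *s b11 + c2 *s b21 + c3 *s b12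
    + c4 *s b31 + c5 *s b13 + c6 *s b22 + c7 *s b32 + c8 *s b41"
    by (rule b_decomposition)
  define y where "y = c6 *s b22"
  define t where "t = c1 *s b11 + c2 *s b21 + c3 *s b12 + c4 *s b31 + c5 *s b13 + c7 *s b32 + c8 *s b41"
  have xyt: "x = y + t"
    by (simp add: decomp y_def t_def algebra_simps)
  have zero: "0 \<in> ball 0 \<delta>" using pos by simp
  \<comment> \<open>The intermediate point \<open>y\<close> must stay in the ball; it is the projection of \<open>x\<close> to one coordinate.\<close>
  have "y = axis 6 (x $ 6)"
    by (simp add: decomp y_def b_defs vec8_eq_iff axis_def)
  then have y: "y \<in> ball 0 \<delta>"
    using Finite_Cartesian_Product.norm_nth_le[of x 6] x by (simp add: norm_axis_eq)
  have in_terms_of_CQ: "der A6 x b22 = 2 * der C x b21 - der Q x b31" if "x \<in> ball 0 \<delta>" for x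
    using A6_A1[OF that] Q_C[OF that] by simp
  have "annihilated A6 \<delta> t"
    unfolding t_def by (intro annihilated_intros hol_A A6_annihilated A6_annihilated_b32)
  then have "der A6 x b22 = der A6 y b22"
    using der_translate[OF hol_A _ y] x xyt by simp
  also have "\<dots> = 2 * der C (0 + y) b21 - der Q (0 + y) b31"
    using in_terms_of_CQ[OF y] by simp
  also have "\<dots> = 2 * der C 0 b21 - der Q 0 b31"
  proof -
    have "annihilated C \<delta> y" "annihilated Q \<delta> y"
      unfolding y_def by (intro annihilated_intros hol_CQ hol_Q C_annihilated_most Q_annihilated')+
    then show ?thesis
      using der_translate[OF hol_CQ(1) _ zero] der_translate[OF hol_Q _ zero] y by simp
  qed
  also have "\<dots> = der A6 0 b22"
    using in_terms_of_CQ[OF zero] by simp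
  finally show ?thesis .
qed

text \<open>
  The derivative of \<open>A1\<close> along the first coordinate is real since \<open>A1\<close> is real at real points, and its
  real part is zero by the normalization of the dilation.
\<close>

lemma A1_b11_at_0: "der A1 0 b11 = 0"
proof -
  let ?e = "axis 1 1 :: complex ^ 8"
  have zero: "0 \<in> ball 0 \<delta>" using pos by simp
  have "((\<lambda>t::real. A1 (0 + t *\<^sub>R ?e)) has_derivative (\<lambda>h. der A1 0 (h *\<^sub>R ?e))) (at 0)"
    by (rule has_derivative_compose[of "\<lambda>t. 0 + t *\<^sub>R ?e" "\<lambda>h. h *\<^sub>R ?e" 0 _ A1 "der A1 0"])
      (use hol8_has_derivative[OF hol_A zero] in \<open>auto intro!: derivative_eq_intros\<close>)
  then have "((\<lambda>t::real. Im (A1 (t *\<^sub>R ?e))) has_derivative (\<lambda>h. Im (der A1 0 (h *\<^sub>R ?e)))) (at 0)"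
    by (simp add: has_derivative_Im)
  moreover have "\<forall>\<^sub>F t::real in nhds 0. Im (A1 (t *\<^sub>R ?e)) = 0"
  proof -
    have "\<forall>\<^sub>F t::real in nhds 0. t \<in> {-\<delta><..<\<delta>}"
      using pos by (intro eventually_nhds_in_open) auto
    then show ?thesis
    proof eventually_elim
      case (elim t)
      have "t *\<^sub>R ?e \<in> ball 0 \<delta>"
        using elim by (auto simp: norm_axis_eq)
      moreover have "cnj_vec (t *\<^sub>R ?e) = t *\<^sub>R ?e"
        by (simp add: vec_eq_iff axis_def)
      ultimately have "cnj (A1 (t *\<^sub>R ?e)) = A1 (t *\<^sub>R ?e)"
        using A_real[of "t *\<^sub>R ?e"] by (metis cnj_vec_nth)
      then show ?case
        by (metis Reals_cnj_iff complex_is_Real_iff)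
    qed
  qed
  ultimately have "(\<lambda>h. Im (der A1 0 (h *\<^sub>R ?e))) = (\<lambda>h. 0)"
    using has_derivative_unique_eventually[OF _ has_derivative_const] by blast
  from fun_cong[OF this, of 1] have "Im (der A1 0 ?e) = 0"
    by simp
  then have "der A1 0 ?e = 0"
    using no_dilation by (simp add: A_def complex_eq_iff)
  moreover have b11: "b11 = (2 * \<i>) *s ?e"
    by (simp add: b11_def vec8_eq_iff axis_def)
  have "der A1 0 b11 = (2 * \<i>) * der A1 0 ?e"
    unfolding b11 by (rule der_scale[OF hol_A zero])
  ultimately show ?thesis by simp
qed

text \<open>
  Only the derivative along \<open>b22\<close> was left; it is constant, and at the origin it is twice the
  derivative of \<open>A1\<close> along \<open>b11\<close>.
\<close>

lemma A6_constant:
  assumes "x \<in> ball 0 \<delta>"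
  shows "A6 x = A6 0"
proof (rule annihilated_constant[OF hol_A])
  have "der A6 x b22 = 0" if "x \<in> ball 0 \<delta>" for x
    using A6_b22_constant[OF that] A6_A1(1)[of 0] A1_b11_at_0 pos by simp
  then show "annihilated A6 \<delta> b22"
    by (simp add: annihilated_def)
qed (use assms A6_annihilated A6_annihilated_b32 in auto)

text \<open>
  Since \<open>A6\<close> is constant, \<open>A6_relation\<close> makes the increment of \<open>A1\<close> vanish.
\<close>

lemma Y_in_terms_of_Z:
  assumes "norm z < \<delta>" "norm \<zeta> < \<delta>" "x \<in> ball 0 \<delta>" "x + Phi z \<zeta> \<in> ball 0 \<delta>" "z \<noteq> 0" "\<zeta> \<noteq> 0"
  shows "z * Y \<zeta> x = - \<zeta> * Z z (x + Phi z \<zeta>)"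
proof -
  have "2 * z * \<zeta> * (2 * \<i> * (\<zeta> * Z z (x + Phi z \<zeta>) + z * Y \<zeta> x)) = 0"
    using A6_relation[OF assms(1-4)] A6_constant[OF assms(3)] A6_constant[OF assms(4)]
      A1_increment[OF assms(1-4)] by simp
  then show ?thesis
    using assms(5,6) by (simp add: add_eq_0_iff)
qed

lemma C_increment':
  assumes "norm z < \<delta>" "norm \<zeta> < \<delta>" "x \<in> ball 0 \<delta>" "x + Phi z \<zeta> \<in> ball 0 \<delta>" "z \<noteq> 0" "\<zeta> \<noteq> 0"
  shows "C (x + Phi z \<zeta>) - C x = 4 * \<i> * z * \<zeta> * Z z (x + Phi z \<zeta>)"
  by (simp add: C_increment[OF assms(1-4)] Y_in_terms_of_Z[OF assms])

lemma A7_relation: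
  assumes "norm z < \<delta>" "norm \<zeta> < \<delta>" "x \<in> ball 0 \<delta>" "x + Phi z \<zeta> \<in> ball 0 \<delta>" "z \<noteq> 0" "\<zeta> \<noteq> 0"
  shows "A7 (x + Phi z \<zeta>) - A7 x = \<zeta> * (z - \<zeta>) / 2 * (C (x + Phi z \<zeta>) - C x)"
proof -
  have e: "A7 (x + Phi z \<zeta>) - A7 x = 2 * \<i> * (3 * z^2 * \<zeta>^2 * Z z (x + Phi z \<zeta>)
      + 2 * z^2 * \<zeta> * (z * Y \<zeta> x) + 2 * z * \<zeta>^3 * Z z (x + Phi z \<zeta>) + 3 * z * \<zeta>^2 * (z * Y \<zeta> x))"
    by (simp add: A_increment[OF assms(1-4)] dPhi_nth algebra_simps eval_nat_numeral)
  show ?thesis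
    unfolding e C_increment'[OF assms] Y_in_terms_of_Z[OF assms]
    by (simp add: algebra_simps eval_nat_numeral)
qed

text \<open>
  Exclusion of the rotation.  In \<open>A7_relation\<close> the factor \<open>z - \<zeta>\<close> changes sign under exchange of \<open>z\<close> and \<open>\<zeta>\<close>,
  while \<open>b32\<close> carries a symmetric sum of monomials.  The order two in \<open>z\<close> and the order two in \<open>\<zeta>\<close>
  therefore give opposite values of the derivative of \<open>A7\<close> along \<open>b32\<close>.
\<close>

lemma C_b21_zero:
  assumes x: "x \<in> ball 0 \<delta>"
  shows "der C x b21 = 0"
proof -
  have C: "der C x b11 = 0" "der C x b12 = 0" "der C x b13 = 0" "der C x b41 = 0"
    using C_annihilated x by (auto simp: annihilated_def)
  have A7: "der A7 x b21 = 0" "der A7 x b12 = 0"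
    using A7_annihilated x by (auto simp: annihilated_def)
  have eq_z: "\<zeta> * der A7 x b21 + \<zeta>^2 * der A7 x b22 + \<zeta>^3 * der A7 x b32 =
      \<zeta> * (0 - \<zeta>) / 2 * (\<zeta> * der C x b21 + \<zeta>^2 * der C x b22 + \<zeta>^3 * der C x b32)"
    if \<zeta>: "norm \<zeta> < \<delta>" "\<zeta> \<noteq> 0" for \<zeta>
  proof (rule z2_equation[OF hol_A x \<zeta>(1) A7_annihilated(1-4)])
    show "((\<lambda>z. \<zeta> * (z - \<zeta>) / 2 * ((C (x + Phi z \<zeta>) - C x) / z^2)) \<longlongrightarrow>
        \<zeta> * (0 - \<zeta>) / 2 * (\<zeta> * der C x b21 + \<zeta>^2 * der C x b22 + \<zeta>^3 * der C x b32)) (at 0)"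
      by (intro tendsto_mult tendsto_divide tendsto_diff tendsto_const tendsto_ident_at
          tendsto_increment_z2[where r = \<delta>] hol_CQ x C_annihilated) simp
  qed (use A7_relation[OF _ \<zeta>(1) x _ _ \<zeta>(2)] in simp)
  have plus: "0 = (0::complex) \<and> der A7 x b22 = 0 \<and> der A7 x b32 + der C x b21 / 2 = 0 \<and>
      0 = (0::complex) \<and> 0 = (0::complex)"
  proof (rule polynomial_coefficients_zero[OF pos])
    fix s :: complex assume s: "norm s < \<delta>"
    show "s * 0 + s^2 * der A7 x b22 + s^3 * (der A7 x b32 + der C x b21 / 2) + s^4 * 0 + s^5 * 0 = 0"
    proof (cases "s = 0")
      case False
      from eq_z[OF s this] show ?thesis
        unfolding A7 degree_three_derivatives_zero[OF x] by (simp add: algebra_simps eval_nat_numeral)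
    qed simp
  qed
  have eq_zeta: "z * der A7 x b12 + z^2 * der A7 x b22 + z^3 * der A7 x b32 =
      (z - 0) / 2 * (z * der C x b11 + z^2 * der C x b21 + z^3 * der C x b31 + z^4 * der C x b41)"
    if z: "norm z < \<delta>" "z \<noteq> 0" for z
  proof (rule zeta2_equation[OF hol_A x z(1) A7_annihilated(1,5,6,4)])
    show "((\<lambda>\<zeta>. (z - \<zeta>) / 2 * ((C (x + Phi z \<zeta>) - C x) / \<zeta>)) \<longlongrightarrow>
        (z - 0) / 2 * (z * der C x b11 + z^2 * der C x b21 + z^3 * der C x b31 + z^4 * der C x b41)) (at 0)"
      by (intro tendsto_mult tendsto_divide tendsto_diff tendsto_const tendsto_ident_at
          tendsto_increment_zeta1[where r = \<delta>] hol_CQ x) simp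
  qed (use A7_relation[OF z(1) _ x _ z(2)] in \<open>simp add: power2_eq_square\<close>)
  have minus: "0 = (0::complex) \<and> der A7 x b22 = 0 \<and> der A7 x b32 - der C x b21 / 2 = 0 \<and>
      0 = (0::complex) \<and> 0 = (0::complex)"
  proof (rule polynomial_coefficients_zero[OF pos])
    fix s :: complex assume s: "norm s < \<delta>"
    show "s * 0 + s^2 * der A7 x b22 + s^3 * (der A7 x b32 - der C x b21 / 2) + s^4 * 0 + s^5 * 0 = 0"
    proof (cases "s = 0")
      case False
      from eq_zeta[OF s this] show ?thesis
        unfolding A7 C degree_three_derivatives_zero[OF x] by (simp add: algebra_simps eval_nat_numeral)
    qed simp
  qed
  from plus minus have "(der A7 x b32 + der C x b21 / 2) - (der A7 x b32 - der C x b21 / 2) = 0"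
    by simp
  then show ?thesis by simp
qed

lemma C_constant:
  assumes "x \<in> ball 0 \<delta>"
  shows "C x = C 0"
  by (rule annihilated_constant[OF hol_CQ(1)])
    (use assms C_annihilated C_annihilated_most C_b21_zero in \<open>auto simp: annihilated_def\<close>)

text \<open>
  For \<open>w\<close> and \<open>z \<noteq> 0\<close>, any small \<open>\<zeta>\<close> other than zero gives a point \<open>x\<close> with \<open>w = x + Phi z \<zeta>\<close>, and there
  the increment of the constant function \<open>C\<close> is a nonzero multiple of \<open>Z z w\<close>.
\<close>

lemma Z_zero:
  assumes z: "norm z < \<delta>" and w: "w \<in> ball 0 \<delta>"
  shows "Z z w = 0"
proof (cases "z = 0")
  case True
  then show ?thesis using Z0[OF w] by simp
next
  case False
  have "((\<lambda>\<zeta>. w - Phi z \<zeta>) \<longlongrightarrow> w - Phi z 0) (at 0)"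
    by (intro tendsto_intros tendsto_Phi)
  from topological_tendstoD[OF this open_ball[of 0 \<delta>]]
  have "\<forall>\<^sub>F \<zeta> in at 0. w - Phi z \<zeta> \<in> ball 0 \<delta>"
    using w by simp
  with eventually_zeta[OF w, of 0] have "\<forall>\<^sub>F \<zeta> in at 0. norm \<zeta> < \<delta> \<and> \<zeta> \<noteq> 0 \<and> w - Phi z \<zeta> \<in> ball 0 \<delta>"
    by eventually_elim simp
  then obtain \<zeta> where \<zeta>: "norm \<zeta> < \<delta>" "\<zeta> \<noteq> 0" "w - Phi z \<zeta> \<in> ball 0 \<delta>"
    using eventually_happens'[OF trivial_limit_at] by blast
  have "4 * \<i> * z * \<zeta> * Z z w = 0"
    using C_increment'[OF z \<zeta>(1,3)] C_constant[OF w] C_constant[OF \<zeta>(3)] w False \<zeta>(2) by simp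
  then show ?thesis
    using False \<zeta>(2) by simp
qed

text \<open>
  With \<open>Z = 0\<close> all increments of \<open>A\<close> along \<open>Phi\<close> vanish, and the expansions give all eight derivatives.
\<close>

lemma A_zero:
  assumes "x \<in> ball 0 \<delta>"
  shows "A x = 0"
proof -
  have Y_zero: "Y \<zeta> x = 0" if "norm \<zeta> < \<delta>" "x \<in> ball 0 \<delta>" for \<zeta> x
    using Z_zero[of "cnj \<zeta>" "cnj_vec x"] that by (simp add: Y_def Z_def)
  have incr: "A (x + Phi z \<zeta>) $ l - A x $ l = 0"
    if "norm z < \<delta>" "norm \<zeta> < \<delta>" "x \<in> ball 0 \<delta>" "x + Phi z \<zeta> \<in> ball 0 \<delta>" for x z \<zeta> l
    unfolding A_increment[OF that] Z_zero[OF that(1,4)] Y_zero[OF that(2,3)] by (simp add: dPhi_def)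
  have "A x $ l = A 0 $ l" for l
  proof (rule annihilated_constant[OF hol_A])
    have z: "annihilated (\<lambda>x. A x $ l) \<delta> b11 \<and> annihilated (\<lambda>x. A x $ l) \<delta> b12 \<and>
      annihilated (\<lambda>x. A x $ l) \<delta> b13 \<and> annihilated (\<lambda>x. A x $ l) \<delta> b41"
      by (rule z1_annihilated[where h = "\<lambda>_ _ _. 0", OF hol_A]) (simp_all add: incr)
    have zeta: "annihilated (\<lambda>x. A x $ l) \<delta> b11 \<and> annihilated (\<lambda>x. A x $ l) \<delta> b21 \<and>
      annihilated (\<lambda>x. A x $ l) \<delta> b31 \<and> annihilated (\<lambda>x. A x $ l) \<delta> b41"
      by (rule zeta1_annihilated[where h = "\<lambda>_ _ _. 0", OF hol_A]) (simp_all add: incr)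
    from z zeta show "annihilated (\<lambda>x. A x $ l) \<delta> b11" "annihilated (\<lambda>x. A x $ l) \<delta> b21"
      "annihilated (\<lambda>x. A x $ l) \<delta> b12" "annihilated (\<lambda>x. A x $ l) \<delta> b31"
      "annihilated (\<lambda>x. A x $ l) \<delta> b13" "annihilated (\<lambda>x. A x $ l) \<delta> b41" by simp_all
    have "der (\<lambda>x. A x $ l) x b21 = 0 \<and> der (\<lambda>x. A x $ l) x b22 = 0 \<and> der (\<lambda>x. A x $ l) x b32 = 0
        \<and> 0 = (0::complex) \<and> 0 = (0::complex)" if x: "x \<in> ball 0 \<delta>" for x
    proof (rule polynomial_coefficients_zero[OF pos])
      fix s :: complex assume s: "norm s < \<delta>"
      have "s * der (\<lambda>x. A x $ l) x b21 + s^2 * der (\<lambda>x. A x $ l) x b22 + s^3 * der (\<lambda>x. A x $ l) x b32 = 0"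
        by (rule z2_equation[OF hol_A x s, where h = "\<lambda>_. 0"]) (use z incr[OF _ s x] in simp_all)
      then show "s * der (\<lambda>x. A x $ l) x b21 + s^2 * der (\<lambda>x. A x $ l) x b22 + s^3 * der (\<lambda>x. A x $ l) x b32
          + s^4 * 0 + s^5 * 0 = 0"
        by simp
    qed
    then show "annihilated (\<lambda>x. A x $ l) \<delta> b22" "annihilated (\<lambda>x. A x $ l) \<delta> b32"
      by (simp_all add: annihilated_def)
  qed (rule assms)
  then show ?thesis
    using at_0 by (simp add: vec_eq_iff A_def)
qed

theorem symmetry_zero:
  assumes "norm z < \<delta>" "x \<in> ball 0 \<delta>"
  shows "f (z, x) = 0"
  using Z_zero[OF assms] W_eq_A[OF assms] A_zero[OF assms(2)] by (simp add: Z_def prod_eq_iff)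

end

section \<open>Complexification of the tangency condition\<close>

lemma fst_cscale [simp]: "fst (cscale c v) = c * fst v"
  and snd_cscale [simp]: "snd (cscale c v) = c *s snd v"
  by (simp_all add: cscale_def)

lemma holomorphic_field_onD:
  assumes "holomorphic_field_on f U" "p \<in> U"
  obtains D where "(f has_derivative D) (at p)" "\<And>c v. D (cscale c v) = cscale c (D v)"
proof -
  obtain D1 where D1: "((\<lambda>p. fst (f p)) has_derivative D1) (at p)" "\<And>c v. D1 (cscale c v) = c * D1 v"
    using assms unfolding holomorphic_field_on_def holomorphic_fun_on_def by blast
  have "\<forall>l. \<exists>D. ((\<lambda>p. snd (f p) $ l) has_derivative D) (at p) \<and> (\<forall>c v. D (cscale c v) = c * D v)"
    using assms unfolding holomorphic_field_on_def holomorphic_fun_on_def by blast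
  then obtain D2 where D2: "\<And>l. ((\<lambda>p. snd (f p) $ l) has_derivative D2 l) (at p)"
    "\<And>l c v. D2 l (cscale c v) = c * D2 l v"
    by metis
  show thesis
  proof (rule that)
    have "((\<lambda>p. (fst (f p), snd (f p))) has_derivative (\<lambda>v. (D1 v, \<chi> l. D2 l v))) (at p)"
      by (intro has_derivative_Pair D1 has_derivative_vec_componentwise) (simp add: D2)
    then show "(f has_derivative (\<lambda>v. (D1 v, \<chi> l. D2 l v))) (at p)" by simp
  qed (simp add: D1 D2 prod_eq_iff vec_eq_iff)
qed

lemma holomorphic_field_onI:
  assumes "\<And>p. p \<in> U \<Longrightarrow> (f has_derivative D p) (at p)"
    and "\<And>p c v. p \<in> U \<Longrightarrow> D p (cscale c v) = cscale c (D p v)"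
  shows "holomorphic_field_on f U"
  unfolding holomorphic_field_on_def holomorphic_fun_on_def
proof (intro conjI ballI allI)
  fix p assume p: "p \<in> U"
  show "\<exists>D. ((\<lambda>p. fst (f p)) has_derivative D) (at p) \<and> (\<forall>c v. D (cscale c v) = c * D v)"
    by (intro exI[of _ "\<lambda>v. fst (D p v)"] conjI has_derivative_fst assms p)
      (simp add: assms(2)[OF p])
  show "\<exists>D. ((\<lambda>p. snd (f p) $ l) has_derivative D) (at p) \<and> (\<forall>c v. D (cscale c v) = c * D v)" for l
    by (intro exI[of _ "\<lambda>v. snd (D p v) $ l"] conjI bounded_linear.has_derivative[OF bounded_linear_vec_nth]
        has_derivative_snd assms p) (simp add: assms(2)[OF p])
qed

lemma holomorphic_along_curve:
  assumes f: "holomorphic_field_on f U" and S: "open S" "\<And>s. s \<in> S \<Longrightarrow> \<gamma> s \<in> U"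
    and \<gamma>: "\<And>s. s \<in> S \<Longrightarrow> (\<gamma> has_derivative (\<lambda>h. cscale h (v s))) (at s)"
  shows "(\<lambda>s. fst (f (\<gamma> s))) holomorphic_on S" "(\<lambda>s. snd (f (\<gamma> s)) $ l) holomorphic_on S"
proof -
  have *: "\<exists>d. ((\<lambda>s. f (\<gamma> s)) has_derivative (\<lambda>h. cscale h d)) (at s)" if s: "s \<in> S" for s
  proof -
    obtain D where D: "(f has_derivative D) (at (\<gamma> s))" "\<And>c v. D (cscale c v) = cscale c (D v)"
      using holomorphic_field_onD[OF f S(2)[OF s]] by blast
    show ?thesis
      using has_derivative_compose[OF \<gamma>[OF s] D(1)] unfolding D(2) by blast
  qed
  show "(\<lambda>s. fst (f (\<gamma> s))) holomorphic_on S"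
    unfolding holomorphic_on_open[OF S(1)]
  proof
    fix s assume "s \<in> S"
    then obtain d where "((\<lambda>s. f (\<gamma> s)) has_derivative (\<lambda>h. cscale h d)) (at s)" using * by blast
    then have "((\<lambda>s. fst (f (\<gamma> s))) has_derivative (\<lambda>h. fst (cscale h d))) (at s)"
      by (rule has_derivative_fst)
    moreover have "(\<lambda>h. fst (cscale h d)) = (*) (fst d)"
      by (simp add: cscale_def fun_eq_iff)
    ultimately show "\<exists>d. ((\<lambda>s. fst (f (\<gamma> s))) has_field_derivative d) (at s)"
      unfolding has_field_derivative_def by metis
  qed
  show "(\<lambda>s. snd (f (\<gamma> s)) $ l) holomorphic_on S"
    unfolding holomorphic_on_open[OF S(1)]
  proof
    fix s assume "s \<in> S"
    then obtain d where "((\<lambda>s. f (\<gamma> s)) has_derivative (\<lambda>h. cscale h d)) (at s)" using * by blast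
    then have "((\<lambda>s. snd (f (\<gamma> s)) $ l) has_derivative (\<lambda>h. snd (cscale h d) $ l)) (at s)"
      by (intro bounded_linear.has_derivative[OF bounded_linear_vec_nth] has_derivative_snd)
    moreover have "(\<lambda>h. snd (cscale h d) $ l) = (*) (snd d $ l)"
      by (simp add: cscale_def fun_eq_iff)
    ultimately show "\<exists>d. ((\<lambda>s. snd (f (\<gamma> s)) $ l) has_field_derivative d) (at s)"
      unfolding has_field_derivative_def by metis
  qed
qed

text \<open>
  The identity theorem: real points accumulate at the origin.
\<close>

lemma zero_on_real_axis_imp_zero:
  assumes "G holomorphic_on ball 0 r" and "\<And>t. \<bar>t\<bar> < r \<Longrightarrow> G (complex_of_real t) = 0"
    and "s \<in> ball 0 r"
  shows "G s = 0"
proof (rule analytic_continuation[OF assms(1) open_ball connected_ball, where U = "of_real ` {-r<..<r}"])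
  have r: "0 < r" using assms(3) by (auto intro: le_less_trans[OF norm_ge_zero])
  show "complex_of_real ` {-r<..<r} \<subseteq> ball 0 r" by auto
  show "(0::complex) \<in> ball 0 r" using r by simp
  show "0 islimpt complex_of_real ` {-r<..<r}"
    unfolding islimpt_approachable
  proof (intro allI impI)
    fix e :: real assume e: "0 < e"
    show "\<exists>x'\<in>complex_of_real ` {-r<..<r}. x' \<noteq> 0 \<and> dist x' 0 < e"
      using r e by (intro bexI[of _ "of_real (min r e / 2)"] imageI) (auto simp: min_def)
  qed
qed (use assms in auto)

text \<open>
  Independent values of \<open>z\<close> and \<open>\<zeta>\<close> are reached along a complex line: \<open>zc s = \<alpha> + s \<beta>\<close> and
  \<open>\<zeta>c s = cnj \<alpha> + s cnj \<beta>\<close> are conjugate for real \<open>s\<close> and take prescribed values at \<open>s = \<i>\<close>.  With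
  the real vectors \<open>a\<close> and \<open>b\<close> treated alike, the curve \<open>\<gamma>\<close> lies on \<open>M3\<close> for real \<open>s\<close>, and the conjugated
  coefficients along it are values at \<open>cnj s\<close>, conjugated, hence holomorphic in \<open>s\<close>.  The tangency
  identity is thus a holomorphic function of \<open>s\<close> that vanishes on the real axis; its value at
  \<open>s = \<i>\<close> is the claim.
\<close>

lemma complexification:
  assumes U: "open U" "0 \<in> U" and f: "holomorphic_field_on f U"
    and tangent: "\<And>p. p \<in> M3 \<Longrightarrow> p \<in> U \<Longrightarrow> tangent_vector M3 p (f p)"
  shows "\<exists>\<delta>. complexified_symmetry f \<delta>"
proof -
  obtain e where e: "0 < e" and in_U: "\<And>z \<zeta> u. norm z < e \<Longrightarrow> norm \<zeta> < e \<Longrightarrow> norm u < e \<Longrightarrow>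
      (z, u + (1/2) *\<^sub>R Phi z \<zeta>) \<in> U"
  proof -
    define g :: "complex \<times> complex \<times> (complex ^ 8) \<Rightarrow> C9" where
      "g = (\<lambda>y. (fst y, snd (snd y) + (1/2) *\<^sub>R Phi (fst y) (fst (snd y))))"
    have "(g \<longlongrightarrow> g 0) (nhds 0)"
      unfolding g_def
      by (intro tendsto_Pair tendsto_add tendsto_scaleR tendsto_const tendsto_Phi tendsto_fst tendsto_snd
          filterlim_ident)
    moreover have "g 0 \<in> U" using U(2) by (simp add: g_def zero_prod_def)
    ultimately have "\<forall>\<^sub>F y in nhds 0. g y \<in> U"
      using U(1) by (blast dest: topological_tendstoD)
    then obtain d where d: "0 < d" "\<And>y. dist y 0 < d \<Longrightarrow> g y \<in> U"
      by (auto simp: eventually_nhds_metric)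
    show thesis
    proof (rule that[of "d / 3"])
      fix z \<zeta> :: complex and u :: "complex ^ 8" assume small: "norm z < d / 3" "norm \<zeta> < d / 3" "norm u < d / 3"
      have "norm (z, \<zeta>, u) \<le> norm z + (norm \<zeta> + norm u)"
        using norm_Pair_le[of z "(\<zeta>, u)"] norm_Pair_le[of \<zeta> u] by linarith
      then have "g (z, \<zeta>, u) \<in> U"
        using small by (intro d(2)) simp
      then show "(z, u + (1/2) *\<^sub>R Phi z \<zeta>) \<in> U"
        by (simp add: g_def)
    qed (use d(1) in simp)
  qed
  \<comment> \<open>For \<open>norm s < 2\<close> the points \<open>\<alpha> + s \<beta>\<close> and \<open>a + s b\<close> have norm below three times the bound for their coefficients.\<close>
  define \<delta> where "\<delta> = e / 3"
  have \<delta>: "0 < \<delta>" "\<delta> < e" using e by (simp_all add: \<delta>_def)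
  have ball_U: "(z, x) \<in> U" if "norm z < \<delta>" "norm x < \<delta>" for z x
    using in_U[of z 0 x] that \<delta> by simp
  have "complexified_symmetry f \<delta>"
    proof
      show "0 < \<delta>" by (rule \<delta>(1))
      show "isCont f (z, x)" if "norm z < \<delta>" "x \<in> ball 0 \<delta>" for z x
      proof -
        have "norm z < \<delta>" "norm x < \<delta>" using that by simp_all
        then obtain D where "(f has_derivative D) (at (z, x))"
          using holomorphic_field_onD[OF f ball_U] by blast
        then show ?thesis by (rule has_derivative_continuous)
      qed
      have *: "((\<lambda>x. f (0, x)) has_derivative (\<lambda>v. D (0, v))) (at x)"
        if "(f has_derivative D) (at (0, x))" for D x
        by (rule has_derivative_compose[of "\<lambda>x. (0, x)" "\<lambda>v. (0, v)", OF _ that])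
          (auto intro!: derivative_eq_intros)
      have scale: "(0, c *s v) = cscale c (0, v)" for c v
        by (simp add: cscale_def)
      show "hol8 (\<lambda>x. fst (f (0, x))) \<delta>"
        unfolding hol8_def
      proof
        fix x :: "complex ^ 8" assume "x \<in> ball 0 \<delta>"
        then obtain D where D: "(f has_derivative D) (at (0, x))" "\<And>c v. D (cscale c v) = cscale c (D v)"
          using holomorphic_field_onD[OF f ball_U[of 0 x]] \<delta> by auto
        show "\<exists>D. ((\<lambda>x. fst (f (0, x))) has_derivative D) (at x) \<and> (\<forall>c v. D (c *s v) = c * D v)"
          by (intro exI[of _ "\<lambda>v. fst (D (0, v))"] conjI has_derivative_fst * D(1))
            (simp add: scale D(2))
      qed
      show "hol8 (\<lambda>x. snd (f (0, x)) $ l) \<delta>" for l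
        unfolding hol8_def
      proof
        fix x :: "complex ^ 8" assume "x \<in> ball 0 \<delta>"
        then obtain D where D: "(f has_derivative D) (at (0, x))" "\<And>c v. D (cscale c v) = cscale c (D v)"
          using holomorphic_field_onD[OF f ball_U[of 0 x]] \<delta> by auto
        show "\<exists>D. ((\<lambda>x. snd (f (0, x)) $ l) has_derivative D) (at x) \<and> (\<forall>c v. D (c *s v) = c * D v)"
          by (intro exI[of _ "\<lambda>v. snd (D (0, v)) $ l"] conjI
              bounded_linear.has_derivative[OF bounded_linear_vec_nth] has_derivative_snd * D(1))
            (simp add: scale D(2))
      qed
    next
      fix z \<zeta> :: complex and x :: "complex ^ 8"
      assume z: "norm z < \<delta>" and \<zeta>: "norm \<zeta> < \<delta>" and x: "x \<in> ball 0 \<delta>" and w: "x + Phi z \<zeta> \<in> ball 0 \<delta>"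
      define \<alpha> \<beta> where "\<alpha> = (z + cnj \<zeta>) / 2" and "\<beta> = (z - cnj \<zeta>) / (2 * \<i>)"
      define u where "u = x + (1/2) *\<^sub>R Phi z \<zeta>"
      define a b where "a = (1/2) *\<^sub>R (u + cnj_vec u)" and "b = (-\<i>/2) *s (u - cnj_vec u)"
      define zc \<zeta>c where "zc = (\<lambda>s. \<alpha> + s * \<beta>)" and "\<zeta>c = (\<lambda>s. cnj \<alpha> + s * cnj \<beta>)"
      define \<gamma> where "\<gamma> = (\<lambda>s. (zc s, a + s *s b + (1/2) *\<^sub>R Phi (zc s) (\<zeta>c s)))"
      have norm_u: "norm u < \<delta>"
      proof -
        have "u = (1/2) *\<^sub>R x + (1/2) *\<^sub>R (x + Phi z \<zeta>)"
          by (simp add: u_def vec_eq_iff scaleR_conv_of_real[where 'a = complex] field_simps)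
        then have "norm u \<le> (1/2) * norm x + (1/2) * norm (x + Phi z \<zeta>)"
          using norm_triangle_ineq[of "(1/2) *\<^sub>R x" "(1/2) *\<^sub>R (x + Phi z \<zeta>)"] by simp
        then show ?thesis using x w by simp
      qed
      have norm_b: "norm b = (1/2) * norm (u - cnj_vec u)"
        unfolding b_def norm_vector_scale by (simp add: norm_divide)
      have norms: "norm \<alpha> < \<delta>" "norm \<beta> < \<delta>" "norm a < \<delta>" "norm b < \<delta>"
        using norm_triangle_ineq[of z "cnj \<zeta>"] norm_triangle_ineq4[of z "cnj \<zeta>"] z \<zeta>
          norm_triangle_ineq[of u "cnj_vec u"] norm_triangle_ineq4[of u "cnj_vec u"] norm_u
        by (simp_all add: \<alpha>_def \<beta>_def a_def norm_b norm_divide norm_mult)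
      have \<gamma>_U: "\<gamma> s \<in> U" if s: "s \<in> ball 0 2" for s
      proof -
        have s: "norm s < 2" using s by simp
        have bound: "p + norm s * q < e" if "p < \<delta>" "q < \<delta>" "0 \<le> q" for p q
        proof -
          have "norm s * q \<le> 2 * q" using s that by (intro mult_right_mono) auto
          then show ?thesis using that by (simp add: \<delta>_def)
        qed
        show ?thesis
          unfolding \<gamma>_def
        proof (rule in_U)
          show "norm (zc s) < e"
            unfolding zc_def using norm_triangle_ineq[of \<alpha> "s * \<beta>"] bound[OF norms(1,2)]
            by (simp add: norm_mult)
          show "norm (\<zeta>c s) < e"
            unfolding \<zeta>c_def using norm_triangle_ineq[of "cnj \<alpha>" "s * cnj \<beta>"] bound[OF norms(1,2)]
            by (simp add: norm_mult)
          show "norm (a + s *s b) < e"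
            using norm_triangle_ineq[of a "s *s b"] bound[OF norms(3,4)] by (simp add: norm_vector_scale)
        qed
      qed
      have \<gamma>_der: "(\<gamma> has_derivative (\<lambda>h. cscale h (\<beta>, b + (1/2) *\<^sub>R dPhi (zc s) (\<zeta>c s) \<beta> (cnj \<beta>)))) (at s)" for s
      proof -
        have "(zc has_derivative (\<lambda>h. h * \<beta>)) (at s)" "(\<zeta>c has_derivative (\<lambda>h. h * cnj \<beta>)) (at s)"
          unfolding zc_def \<zeta>c_def by (auto intro!: derivative_eq_intros)
        moreover from this have "((\<lambda>s. (1/2) *\<^sub>R Phi (zc s) (\<zeta>c s)) has_derivative
            (\<lambda>h. (1/2) *\<^sub>R dPhi (zc s) (\<zeta>c s) (h * \<beta>) (h * cnj \<beta>))) (at s)"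
          by (intro has_derivative_scaleR_right Phi_has_derivative)
        moreover have "((\<lambda>s. a + s *s b) has_derivative (\<lambda>h. h *s b)) (at s)"
          by (auto intro!: derivative_eq_intros)
        ultimately have "(\<gamma> has_derivative (\<lambda>h. (h * \<beta>, h *s b +
            (1/2) *\<^sub>R dPhi (zc s) (\<zeta>c s) (h * \<beta>) (h * cnj \<beta>)))) (at s)"
          unfolding \<gamma>_def by (intro has_derivative_Pair has_derivative_add)
        moreover have "(h * \<beta>, h *s b + (1/2) *\<^sub>R dPhi (zc s) (\<zeta>c s) (h * \<beta>) (h * cnj \<beta>)) =
            cscale h (\<beta>, b + (1/2) *\<^sub>R dPhi (zc s) (\<zeta>c s) \<beta> (cnj \<beta>))" for h
          unfolding dPhi_scale by (simp add: cscale_def vec_eq_iff algebra_simps)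
        ultimately show ?thesis by simp
      qed
      define hZ where "hZ = (\<lambda>s. fst (f (\<gamma> s)))"
      define hW where "hW = (\<lambda>l s. snd (f (\<gamma> s)) $ l)"
      define G where "G = (\<lambda>l s. hW l s - cnj (hW l (cnj s)) -
        dPhi (zc s) (\<zeta>c s) (hZ s) (cnj (hZ (cnj s))) $ l)"
      have hol: "hZ holomorphic_on ball 0 2" "hW l holomorphic_on ball 0 2" for l
        unfolding hZ_def hW_def
        by (rule holomorphic_along_curve[OF f open_ball _ \<gamma>_der], erule \<gamma>_U)+
      have ball_cnj: "cnj ` ball 0 2 = ball 0 2"
        by (auto simp: image_iff intro!: bexI[of _ "cnj _"])
      have reflect: "(\<lambda>s. cnj (h (cnj s))) holomorphic_on ball 0 2" if "h holomorphic_on ball 0 2" for h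
        using holomorphic_on_compose_cnj_cnj[of h "ball 0 2"] that ball_cnj by (simp add: o_def)
      have "G l holomorphic_on ball 0 2" for l
        unfolding G_def dPhi_def vector_add_component vector_smult_component zc_def \<zeta>c_def
        by (intro holomorphic_intros hol reflect)
      moreover have "G l (of_real t) = 0" if t: "\<bar>t\<bar> < 2" for t l
      proof -
        let ?t = "complex_of_real t"
        have conj: "\<zeta>c ?t = cnj (zc ?t)" by (simp add: zc_def \<zeta>c_def)
        have "cnj_vec (a + ?t *s b) = a + ?t *s b"
          by (simp add: a_def b_def vec_eq_iff algebra_simps)
        then have "\<gamma> ?t \<in> M3"
          by (simp add: mem_M3_iff \<gamma>_def conj cnj_vec_add cnj_vec_scaleR cnj_vec_Phi
              flip: scaleR_add_left)
        moreover have "\<gamma> ?t \<in> U"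
          by (rule \<gamma>_U) (use t in simp)
        ultimately have "snd (f (\<gamma> ?t)) - cnj_vec (snd (f (\<gamma> ?t))) =
            dPhi (zc ?t) (cnj (zc ?t)) (hZ ?t) (cnj (hZ ?t))"
          using tangent tangent_vector_M3_iff by (simp add: \<gamma>_def hZ_def)
        from arg_cong[OF this, of "\<lambda>v. v $ l"] show ?thesis
          by (simp add: G_def hW_def conj)
      qed
      ultimately have "G l \<i> = 0" for l
        by (rule zero_on_real_axis_imp_zero) auto
      moreover have "\<gamma> \<i> = (z, x + Phi z \<zeta>)" "\<gamma> (cnj \<i>) = (cnj \<zeta>, cnj_vec x)" "zc \<i> = z" "\<zeta>c \<i> = \<zeta>"
      proof -
        have plus: "zc \<i> = z" "\<zeta>c \<i> = \<zeta>" and minus: "zc (cnj \<i>) = cnj \<zeta>" "\<zeta>c (cnj \<i>) = cnj z"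
          by (simp_all add: zc_def \<zeta>c_def \<alpha>_def \<beta>_def field_simps)
        have ab: "a + \<i> *s b = u" "a + cnj \<i> *s b = cnj_vec u"
          by (simp_all add: a_def b_def vec_eq_iff scaleR_conv_of_real[where 'a = complex] field_simps)
        show "zc \<i> = z" "\<zeta>c \<i> = \<zeta>" by (fact plus)+
        show "\<gamma> \<i> = (z, x + Phi z \<zeta>)"
          unfolding \<gamma>_def plus ab by (simp add: u_def add.assoc flip: scaleR_add_left)
        show "\<gamma> (cnj \<i>) = (cnj \<zeta>, cnj_vec x)"
          unfolding \<gamma>_def minus ab by (simp add: u_def cnj_vec_add cnj_vec_scaleR cnj_vec_Phi)
      qed
      ultimately show "snd (f (z, x + Phi z \<zeta>)) - cnj_vec (snd (f (cnj \<zeta>, cnj_vec x))) =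
          dPhi z \<zeta> (fst (f (z, x + Phi z \<zeta>))) (cnj (fst (f (cnj \<zeta>, cnj_vec x))))"
        by (simp add: G_def hZ_def hW_def vec_eq_iff)
    qed
  then show ?thesis ..
qed

section \<open>The explicit symmetries\<close>

type_synonym params = "(real ^ 8) \<times> real \<times> real \<times> real"

definition symmetry_field :: "params \<Rightarrow> C9 \<Rightarrow> C9" where
  "symmetry_field = (\<lambda>(k, a, c, d). general_field k a c d)"

definition symmetry :: "params \<Rightarrow> vf_germ" where
  "symmetry p = vf_germ (symmetry_field p)"

text \<open>
  The derivative of a member of the family at \<open>(z, w)\<close> in the direction \<open>(v, u)\<close>.
\<close>

definition dsymmetry_field :: "params \<Rightarrow> C9 \<Rightarrow> C9 \<Rightarrow> C9" where
  "dsymmetry_field = (\<lambda>(k, a, c, d) (z, w) (v, u). (a * v,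
      vector
       [2 * a * u$1 + 2 * (d + \<i> * c) * v,
        4 * c * u$1 + 3 * a * u$2 + 4 * (d + \<i> * c) * z * v,
        4 * d * u$1 + 3 * a * u$3 + 4 * (c - \<i> * d) * z * v,
        3 * c * u$2 - 3 * d * u$3 + 4 * a * u$4 + 6 * (d + \<i> * c) * z^2 * v,
        3 * d * u$2 + 3 * c * u$3 + 4 * a * u$5 + 6 * (c - \<i> * d) * z^2 * v,
        2 * c * u$2 + 2 * d * u$3 + 4 * a * u$6,
        2 * c * u$4 + 2 * d * u$5 + 6 * c * u$6 + 5 * a * u$7,
        4 * c * u$4 - 4 * d * u$5 + 5 * a * u$8 + 8 * (d + \<i> * c) * z^3 * v]))"

lemmas has_derivative_vec_nth = bounded_linear.has_derivative[OF bounded_linear_vec_nth]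

lemma symmetry_field_has_derivative: "(symmetry_field p has_derivative dsymmetry_field p x) (at x)"
proof -
  obtain k a c d where p: "p = (k, a, c, d)" by (cases p) auto
  obtain z w where x: "x = (z, w)" by (cases x) auto
  have "((\<lambda>x. fst (symmetry_field p x)) has_derivative (\<lambda>h. fst (dsymmetry_field p x h))) (at x)"
    unfolding p x symmetry_field_def general_field_def dsymmetry_field_def case_prod_conv fst_conv split_beta
    by (rule has_derivative_eq_rhs, (rule derivative_intros)+) (simp add: fun_eq_iff)
  moreover have "((\<lambda>x. snd (symmetry_field p x)) has_derivative (\<lambda>h. snd (dsymmetry_field p x h))) (at x)"
  proof (rule has_derivative_vec_componentwise)
    show "((\<lambda>x. snd (symmetry_field p x) $ i) has_derivative (\<lambda>h. snd (dsymmetry_field p x h) $ i)) (at x)" for i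
      unfolding p x symmetry_field_def general_field_def dsymmetry_field_def case_prod_conv snd_conv split_beta
      by (rule all_8I[of _ i];
          unfold vector_8; rule has_derivative_eq_rhs, (rule derivative_intros has_derivative_vec_nth)+,
          simp add: fun_eq_iff algebra_simps eval_nat_numeral)
  qed
  ultimately show ?thesis
    using has_derivative_Pair by fastforce
qed

lemma dsymmetry_field_cscale: "dsymmetry_field p x (cscale c v) = cscale c (dsymmetry_field p x v)"
  by (cases p, cases x, cases v) (simp add: dsymmetry_field_def cscale_def vec8_eq_iff algebra_simps)

lemma holomorphic_symmetry_field: "holomorphic_field_on (symmetry_field p) U"
  by (rule holomorphic_field_onI[where D = "dsymmetry_field p"]) (auto simp: symmetry_field_has_derivative dsymmetry_field_cscale)

lemma tangent_symmetry_field: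
  assumes "x \<in> M3"
  shows "tangent_vector M3 x (symmetry_field p x)"
proof -
  obtain k a c d where p: "p = (k, a, c, d)" by (cases p) auto
  obtain z w where x: "x = (z, w)" by (cases x) auto
  have "cnj_vec w = w - Phi z (cnj z)"
    using assms by (simp add: mem_M3_iff x algebra_simps)
  then have conj: "cnj (w $ l) = w $ l - Phi z (cnj z) $ l" for l
    by (metis cnj_vec_nth vector_minus_component)
  show ?thesis
    unfolding tangent_vector_M3_iff[OF assms]
    by (simp add: p x conj symmetry_field_def general_field_def vec8_eq_iff dPhi_def Phi_def b_defs algebra_simps
        eval_nat_numeral)
qed

lemma symmetry_field_add: "symmetry_field (p + q) x = symmetry_field p x + symmetry_field q x"
  by (cases p, cases q, cases x) (simp add: symmetry_field_def general_field_def vec8_eq_iff algebra_simps)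

lemma symmetry_field_scaleR: "symmetry_field (r *\<^sub>R p) x = r *\<^sub>R symmetry_field p x"
  by (cases p, cases x) (simp add: symmetry_field_def general_field_def vec8_eq_iff
      scaleR_conv_of_real[where 'a = complex] algebra_simps)

lemma linear_symmetry: "linear symmetry"
proof
  show "symmetry (p + q) = symmetry p + symmetry q" for p q
    unfolding symmetry_def plus_vf_germ.abs_eq by (simp flip: symmetry_field_add)
  show "symmetry (r *\<^sub>R p) = r *\<^sub>R symmetry p" for r p
    unfolding symmetry_def scaleR_vf_germ.abs_eq by (simp flip: symmetry_field_scaleR)
qed

text \<open>
  The value at the origin determines all parameters except the dilation, which is seen on the \<open>z\<close>-axis.
\<close>

lemma inj_symmetry: "inj symmetry"
proof (rule linear_injective_0[OF linear_symmetry, THEN iffD2], intro allI impI)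
  fix p assume "symmetry p = 0"
  obtain k a c d where p: "p = (k, a, c, d)" by (cases p) auto
  from \<open>symmetry p = 0\<close> have "\<forall>\<^sub>F x in nhds 0. symmetry_field p x = 0"
    by (simp add: symmetry_def zero_vf_germ_def vf_germ.abs_eq_iff)
  then obtain e where e: "0 < e" "\<And>x. dist x 0 < e \<Longrightarrow> symmetry_field p x = 0"
    by (auto simp: eventually_nhds_metric)
  have "symmetry_field p (0, 0) = 0"
    using e by (simp flip: zero_prod_def)
  then have "c = 0" "d = 0" "k = 0"
    by (auto simp: p symmetry_field_def general_field_def zero_prod_def vec8_eq_iff complex_eq_iff)
  moreover have "symmetry_field p (of_real (e / 2), 0) = 0"
    using e by simp
  ultimately have "a = 0"
    using e(1) by (simp add: p symmetry_field_def general_field_def zero_prod_def)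
  then show "p = 0"
    by (simp add: p \<open>c = 0\<close> \<open>d = 0\<close> \<open>k = 0\<close> zero_prod_def)
qed

text \<open>
  The Lie bracket in terms of parameters \<open>(k, a, c, d)\<close>.
\<close>

definition bracket :: "params \<Rightarrow> params \<Rightarrow> params" where
  "bracket = (\<lambda>(k, a, c, d) (k', a', c', d').
    (vector
      [2 * (k$1 * a' - a * k'$1) + 4 * (c * d' - d * c'),
       3 * (k$2 * a' - a * k'$2) + 4 * (k$1 * c' - c * k'$1),
       3 * (k$3 * a' - a * k'$3) + 4 * (k$1 * d' - d * k'$1),
       4 * (k$4 * a' - a * k'$4) + 3 * (k$2 * c' - c * k'$2) - 3 * (k$3 * d' - d * k'$3),
       4 * (k$5 * a' - a * k'$5) + 3 * (k$2 * d' - d * k'$2) + 3 * (k$3 * c' - c * k'$3),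
       4 * (k$6 * a' - a * k'$6) + 2 * (k$2 * c' - c * k'$2) + 2 * (k$3 * d' - d * k'$3),
       5 * (k$7 * a' - a * k'$7) + 2 * (k$4 * c' - c * k'$4) + 2 * (k$5 * d' - d * k'$5) + 6 * (k$6 * c' - c * k'$6),
       5 * (k$8 * a' - a * k'$8) + 4 * (k$4 * c' - c * k'$4) - 4 * (k$5 * d' - d * k'$5)],
     0, c * a' - a * c', d * a' - a * d'))"

lemma lie_bracket_symmetry: "lie_bracket (symmetry p) (symmetry q) = symmetry (bracket p q)"
proof -
  have "dsymmetry_field q x (symmetry_field p x) - dsymmetry_field p x (symmetry_field q x) = symmetry_field (bracket p q) x" for x
    by (cases p, cases q, cases x)
      (simp add: dsymmetry_field_def symmetry_field_def general_field_def bracket_def vec8_eq_iff algebra_simps eval_nat_numeral)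
  then show ?thesis
    by (simp add: symmetry_def lie_bracket.abs_eq flip: frechet_derivative_at[OF symmetry_field_has_derivative])
qed

lemma bracket_add_left: "bracket (p + q) s = bracket p s + bracket q s"
  and bracket_scale_left: "bracket (r *\<^sub>R p) s = r *\<^sub>R bracket p s"
  and bracket_anticomm: "bracket p q = - bracket q p"
  and bracket_jacobi: "bracket p (bracket q s) + bracket q (bracket s p) + bracket s (bracket p q) = 0"
  by (cases p, cases q, cases s, simp add: bracket_def vec8_eq_iff zero_prod_def algebra_simps)+

lemma holomorphic_field_on_diff:
  assumes "holomorphic_field_on f U" "holomorphic_field_on g U"
  shows "holomorphic_field_on (\<lambda>x. f x - g x) U"
proof (rule holomorphic_field_onI)
  fix x assume x: "x \<in> U"
  obtain D where D: "(f has_derivative D) (at x)" "\<And>c v. D (cscale c v) = cscale c (D v)"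
    using holomorphic_field_onD[OF assms(1) x] by blast
  obtain E where E: "(g has_derivative E) (at x)" "\<And>c v. E (cscale c v) = cscale c (E v)"
    using holomorphic_field_onD[OF assms(2) x] by blast
  have *: "((\<lambda>x. f x - g x) has_derivative (\<lambda>v. D v - E v)) (at x)"
    by (intro has_derivative_diff D E)
  then show "((\<lambda>x. f x - g x) has_derivative frechet_derivative (\<lambda>x. f x - g x) (at x)) (at x)"
    by (simp add: frechet_derivative_at[symmetric])
  show "frechet_derivative (\<lambda>x. f x - g x) (at x) (cscale c v) =
      cscale c (frechet_derivative (\<lambda>x. f x - g x) (at x) v)" for c v
    by (simp add: frechet_derivative_at[OF *, symmetric] D(2) E(2) prod_eq_iff vec_eq_iff algebra_simps)
qed

text \<open>
  A given symmetry is compared with the member of the family that has the same normalized data at the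
  origin; the difference is a normalized symmetry, hence zero near the origin.
\<close>

lemma aut_CR_M3: "aut_CR M3 = range symmetry"
proof
  show "range symmetry \<subseteq> aut_CR M3"
    unfolding aut_CR_def symmetry_def
    using holomorphic_symmetry_field tangent_symmetry_field by (blast intro: open_UNIV)
  show "aut_CR M3 \<subseteq> range symmetry"
  proof
    fix X assume "X \<in> aut_CR M3"
    then obtain f U where X: "X = vf_germ f" and U: "open U" "0 \<in> U" and f: "holomorphic_field_on f U"
      and tangent: "\<And>p. p \<in> M3 \<Longrightarrow> p \<in> U \<Longrightarrow> tangent_vector M3 p (f p)"
      unfolding aut_CR_def by blast
    \<comment> \<open>The first-order coefficient of \<open>w 1\<close> is twice the dilation parameter.\<close>
    define p :: params where "p = ((\<chi> l. Re (snd (f 0) $ l)),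
      Re (der (\<lambda>x. snd (f (0, x)) $ 1) 0 (axis 1 1)) / 2, Re (fst (f 0)), Im (fst (f 0)))"
    define g where "g = (\<lambda>x. f x - symmetry_field p x)"
    have g: "holomorphic_field_on g U"
      unfolding g_def by (intro holomorphic_field_on_diff f holomorphic_symmetry_field)
    have tangent_g: "tangent_vector M3 q (g q)" if q: "q \<in> M3" "q \<in> U" for q
      using tangent[OF q] tangent_symmetry_field[OF q(1), of p]
      by (simp add: tangent_vector_M3_iff[OF q(1)] g_def cnj_vec_diff dPhi_diff) (simp add: algebra_simps)
    obtain \<delta> where sym: "complexified_symmetry g \<delta>"
      using complexification[OF U g] tangent_g by blast
    interpret complexified_symmetry g \<delta> by (rule sym)
    have "(0::C9) \<in> M3"
      by (simp add: mem_M3_iff vec_eq_iff)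
    then have "snd (f 0) - cnj_vec (snd (f 0)) = 0"
      using tangent[of 0] U(2) by (simp add: tangent_vector_M3_iff dPhi_def)
    from arg_cong[OF this, of "\<lambda>v. v $ l" for l] have "Im (snd (f 0) $ l) = 0" for l
      by (simp add: complex_eq_iff)
    then have "f 0 = symmetry_field p 0"
      by (simp add: p_def symmetry_field_def general_field_def zero_prod_def prod_eq_iff vec8_eq_iff complex_eq_iff)
    then have at_0: "g (0, 0) = 0"
      by (simp add: g_def zero_prod_def)
    obtain D where D: "(f has_derivative D) (at (0, 0))"
    proof -
      have "(0, 0) \<in> U" using U(2) by (simp add: zero_prod_def)
      then show thesis using holomorphic_field_onD[OF f] that by blast
    qed
    have slice: "((\<lambda>x. snd (h (0, x)) $ 1) has_derivative (\<lambda>v. snd (E (0, v)) $ 1)) (at 0)"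
      if "(h has_derivative E) (at (0, 0))" for h :: "C9 \<Rightarrow> C9" and E
    proof -
      have "((\<lambda>x. h (0, x)) has_derivative (\<lambda>v. E (0, v))) (at 0)"
        by (rule has_derivative_compose[of "\<lambda>x. (0, x)" "\<lambda>v. (0, v)", OF _ that])
          (auto intro!: derivative_eq_intros)
      then show ?thesis
        by (intro has_derivative_vec_nth has_derivative_snd)
    qed
    have "(g has_derivative (\<lambda>v. D v - dsymmetry_field p (0, 0) v)) (at (0, 0))"
      unfolding g_def by (intro has_derivative_diff D symmetry_field_has_derivative)
    from der_eqI[OF slice[OF this]]
    have "der (\<lambda>x. snd (g (0, x)) $ 1) 0 (axis 1 1) =
        snd (D (0, axis 1 1)) $ 1 - snd (dsymmetry_field p (0, 0) (0, axis 1 1)) $ 1"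
      by simp
    also have "snd (D (0, axis 1 1)) $ 1 = der (\<lambda>x. snd (f (0, x)) $ 1) 0 (axis 1 1)"
      by (simp add: der_eqI[OF slice[OF D]])
    finally have "Re (der (\<lambda>x. snd (g (0, x)) $ 1) 0 (axis 1 1)) = 0"
      by (simp add: p_def dsymmetry_field_def)
    with at_0 interpret normalized_symmetry g \<delta>
      by unfold_locales
    have "\<forall>\<^sub>F x in nhds (0::C9). x \<in> ball 0 \<delta> \<times> ball 0 \<delta>"
      using pos by (intro eventually_nhds_in_open open_Times open_ball) (simp add: zero_prod_def)
    then have "\<forall>\<^sub>F x in nhds 0. f x = symmetry_field p x"
    proof eventually_elim
      case (elim x)
      then have "g (fst x, snd x) = 0"
        by (intro symmetry_zero) (auto simp: mem_Times_iff)
      then show ?case by (simp add: g_def)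
    qed
    then have "X = symmetry p"
      by (simp add: X symmetry_def vf_germ.abs_eq_iff)
    then show "X \<in> range symmetry" by simp
  qed
qed

section \<open>Basis, Lie algebra and grading\<close>

definition basis_param :: "nat \<Rightarrow> params" where
  "basis_param i = (if i = 9 then (0, 1, 0, 0) else if i = 10 then (0, 0, 1, 0)
     else if i = 11 then (0, 0, 0, 1) else (axis (of_nat i) 1, 0, 0, 0))"

lemma upto_11: "{1..11::nat} = {1, 2, 3, 4, 5, 6, 7, 8, 9, 10, 11}"
  by (rule set_eqI) (simp, presburger)

lemma XX_eq_symmetry:
  assumes "i \<in> {1..11}"
  shows "XX i = symmetry (basis_param i)"
proof -
  have "X_field i x = symmetry_field (basis_param i) x" for x
    using assms unfolding upto_11
    by (cases x) (elim insertE; simp add: X_field_def symmetry_field_def basis_param_def general_field_def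
        vec8_eq_iff axis_def)
  then show ?thesis
    by (simp add: XX_def symmetry_def) (metis ext)
qed

lemma inj_on_basis_param: "inj_on basis_param {1..11}"
  unfolding upto_11 by (simp add: basis_param_def axis_eq_axis)

lemma basis_param_image: "basis_param ` {1..11} = Basis"
proof (rule card_subset_eq)
  show "basis_param ` {1..11} \<subseteq> Basis"
    by (auto simp: basis_param_def Basis_prod_def zero_prod_def image_iff axis_in_Basis_iff)
  show "card (basis_param ` {1..11}) = card (Basis :: params set)"
    by (subst card_image[OF inj_on_basis_param]) simp
qed simp

lemma independent_XX: "inj_on XX {1..11}" "independent (XX ` {1..11})" "span (XX ` {1..11}) = aut_CR M3"
proof -
  have image: "XX ` {1..11} = symmetry ` Basis"
    unfolding basis_param_image[symmetric] image_image by (rule image_cong) (simp_all add: XX_eq_symmetry)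
  show "inj_on XX {1..11}"
    by (rule inj_onI) (metis XX_eq_symmetry injD[OF inj_symmetry] inj_onD[OF inj_on_basis_param])
  show "independent (XX ` {1..11})"
    unfolding image by (intro linear_independent_injective_image linear_symmetry independent_Basis)
      (rule inj_on_subset[OF inj_symmetry subset_UNIV])
  show "span (XX ` {1..11}) = aut_CR M3"
    unfolding image aut_CR_M3 linear_span_image[OF linear_symmetry] by simp
qed

lemma dim_aut_CR_M3: "dim (aut_CR M3) = 11"
proof -
  have "dim (aut_CR M3) = card (XX ` {1..11})"
    using independent_XX by (metis dim_span dim_eq_card_independent)
  then show ?thesis
    unfolding card_image[OF independent_XX(1)] by simp
qed

lemma real_lie_algebra_aut_CR_M3: "real_lie_algebra (aut_CR M3)"
proof -
  have bracket_add_right: "bracket s (p + q) = bracket s p + bracket s q" for p q s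
    using bracket_add_left[of p q s] bracket_anticomm[of s] by simp
  have bracket_scale_right: "bracket s (r *\<^sub>R p) = r *\<^sub>R bracket s p" for p r s
    using bracket_scale_left[of r p s] bracket_anticomm[of s] by simp
  have bracket_self: "bracket p p = 0" for p
    by (cases p) (simp add: bracket_def zero_prod_def vec8_eq_iff)
  have lincomb: "r *\<^sub>R symmetry p + s *\<^sub>R symmetry q = symmetry (r *\<^sub>R p + s *\<^sub>R q)" for r s p q
    by (simp add: linear_add[OF linear_symmetry] linear_scale[OF linear_symmetry])
  show ?thesis
    unfolding real_lie_algebra_def aut_CR_M3
  proof (intro conjI ballI allI)
    show "subspace (range symmetry)"
      by (intro linear_subspace_image linear_symmetry subspace_UNIV)
    fix X1 X2 X3 and r s :: real assume "X1 \<in> range symmetry" "X2 \<in> range symmetry" "X3 \<in> range symmetry"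
    then obtain p1 p2 p3 where X: "X1 = symmetry p1" "X2 = symmetry p2" "X3 = symmetry p3" by blast
    show "lie_bracket X1 X2 \<in> range symmetry"
      by (simp add: X lie_bracket_symmetry)
    show "lie_bracket X1 X1 = 0"
      by (simp add: X lie_bracket_symmetry bracket_self linear_0[OF linear_symmetry])
    show "lie_bracket (r *\<^sub>R X1 + s *\<^sub>R X2) X3 = r *\<^sub>R lie_bracket X1 X3 + s *\<^sub>R lie_bracket X2 X3"
      "lie_bracket X3 (r *\<^sub>R X1 + s *\<^sub>R X2) = r *\<^sub>R lie_bracket X3 X1 + s *\<^sub>R lie_bracket X3 X2"
      by (simp_all add: X lincomb lie_bracket_symmetry bracket_add_left bracket_add_right bracket_scale_left bracket_scale_right)
    show "lie_bracket X1 (lie_bracket X2 X3) + lie_bracket X2 (lie_bracket X3 X1) +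
        lie_bracket X3 (lie_bracket X1 X2) = 0"
      by (simp add: X lie_bracket_symmetry bracket_jacobi linear_0[OF linear_symmetry] flip: linear_add[OF linear_symmetry])
  qed
qed

text \<open>
  The parameters of a given weight: the translations along \<open>w l\<close> have minus the weight of \<open>w l\<close>, the
  parameters \<open>c\<close> and \<open>d\<close> have weight \<open>-1\<close>, and the dilation has weight \<open>0\<close>.
\<close>

definition weight_space :: "int \<Rightarrow> params set" where
  "weight_space j = {(k, a, c, d). (j \<noteq> -5 \<longrightarrow> k$7 = 0 \<and> k$8 = 0) \<and> (j \<noteq> -4 \<longrightarrow> k$4 = 0 \<and> k$5 = 0 \<and> k$6 = 0) \<and>
     (j \<noteq> -3 \<longrightarrow> k$2 = 0 \<and> k$3 = 0) \<and> (j \<noteq> -2 \<longrightarrow> k$1 = 0) \<and> (j \<noteq> -1 \<longrightarrow> c = 0 \<and> d = 0) \<and>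
     (j \<noteq> 0 \<longrightarrow> a = 0)}"

lemma subspace_weight_space: "subspace (weight_space j)"
  by (rule subspaceI) (simp_all add: weight_space_def zero_prod_def split_beta)

lemma gg_eq: "gg j = symmetry ` weight_space j"
proof -
  have span_image: "span (XX ` I) = symmetry ` weight_space j" if I: "I \<subseteq> {1..11}" "basis_param ` I \<subseteq> weight_space j"
      and in_span: "\<And>k a c d. (k, a, c, d) \<in> weight_space j \<Longrightarrow> (k, a, c, d) \<in> span (basis_param ` I)" for I j
  proof -
    have "XX ` I = symmetry ` basis_param ` I"
      using I(1) unfolding image_image by (intro image_cong) (auto simp: XX_eq_symmetry)
    moreover have "span (basis_param ` I) = weight_space j"
      using I(2) in_span by (intro equalityI span_minimal subspace_weight_space) auto
    ultimately show ?thesis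
      by (simp add: linear_span_image[OF linear_symmetry])
  qed
  consider "j = -5" | "j = -4" | "j = -3" | "j = -2" | "j = -1" | "j = 0"
    | "j \<noteq> -5" "j \<noteq> -4" "j \<noteq> -3" "j \<noteq> -2" "j \<noteq> -1" "j \<noteq> 0"
    by blast
  then show ?thesis
  proof cases
    case 1
    have "(k, a, c, d) \<in> span (basis_param ` {7, 8})" if "(k, a, c, d) \<in> weight_space j" for k a c d
    proof -
      have eq: "(k, a, c, d) = k$7 *\<^sub>R basis_param 7 + k$8 *\<^sub>R basis_param 8"
        using that 1 by (simp add: weight_space_def basis_param_def vec8_eq_iff axis_def)
      show ?thesis unfolding eq by (simp add: span_add span_scale span_base)
    qed
    then show ?thesis
      using span_image[of "{7, 8}" j] 1 by (simp add: gg_def weight_space_def basis_param_def axis_def)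
  next
    case 2
    have "(k, a, c, d) \<in> span (basis_param ` {4, 5, 6})" if "(k, a, c, d) \<in> weight_space j" for k a c d
    proof -
      have eq: "(k, a, c, d) = k$4 *\<^sub>R basis_param 4 + k$5 *\<^sub>R basis_param 5 + k$6 *\<^sub>R basis_param 6"
        using that 2 by (simp add: weight_space_def basis_param_def vec8_eq_iff axis_def)
      show ?thesis unfolding eq by (simp add: span_add span_scale span_base)
    qed
    then show ?thesis
      using span_image[of "{4, 5, 6}" j] 2 by (simp add: gg_def weight_space_def basis_param_def axis_def)
  next
    case 3
    have "(k, a, c, d) \<in> span (basis_param ` {2, 3})" if "(k, a, c, d) \<in> weight_space j" for k a c d
    proof -
      have eq: "(k, a, c, d) = k$2 *\<^sub>R basis_param 2 + k$3 *\<^sub>R basis_param 3"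
        using that 3 by (simp add: weight_space_def basis_param_def vec8_eq_iff axis_def)
      show ?thesis unfolding eq by (simp add: span_add span_scale span_base)
    qed
    then show ?thesis
      using span_image[of "{2, 3}" j] 3 by (simp add: gg_def weight_space_def basis_param_def axis_def)
  next
    case 4
    have "(k, a, c, d) \<in> span (basis_param ` {1})" if "(k, a, c, d) \<in> weight_space j" for k a c d
    proof -
      have eq: "(k, a, c, d) = k$1 *\<^sub>R basis_param 1"
        using that 4 by (simp add: weight_space_def basis_param_def vec8_eq_iff axis_def)
      show ?thesis unfolding eq by (simp add: span_add span_scale span_base)
    qed
    then show ?thesis
      using span_image[of "{1}" j] 4 by (simp add: gg_def weight_space_def basis_param_def axis_def)
  next
    case 5
    have "(k, a, c, d) \<in> span (basis_param ` {10, 11})" if "(k, a, c, d) \<in> weight_space j" for k a c d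
    proof -
      have eq: "(k, a, c, d) = c *\<^sub>R basis_param 10 + d *\<^sub>R basis_param 11"
        using that 5 by (simp add: weight_space_def basis_param_def vec8_eq_iff axis_def)
      show ?thesis unfolding eq by (simp add: span_add span_scale span_base)
    qed
    then show ?thesis
      using span_image[of "{10, 11}" j] 5 by (simp add: gg_def weight_space_def basis_param_def axis_def)
  next
    case 6
    have "(k, a, c, d) \<in> span (basis_param ` {9})" if "(k, a, c, d) \<in> weight_space j" for k a c d
    proof -
      have eq: "(k, a, c, d) = a *\<^sub>R basis_param 9"
        using that 6 by (simp add: weight_space_def basis_param_def vec8_eq_iff axis_def)
      show ?thesis unfolding eq by (simp add: span_add span_scale span_base)
    qed
    then show ?thesis
      using span_image[of "{9}" j] 6 by (simp add: gg_def weight_space_def basis_param_def axis_def)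
  next
    case 7
    then have "weight_space j = {0}"
      by (auto simp: weight_space_def zero_prod_def vec8_eq_iff)
    then show ?thesis
      using 7 by (simp add: gg_def linear_0[OF linear_symmetry])
  qed
qed

definition weight_part :: "int \<Rightarrow> params \<Rightarrow> params" where
  "weight_part j = (\<lambda>(k, a, c, d). (vector
     [if j = -2 then k$1 else 0, if j = -3 then k$2 else 0, if j = -3 then k$3 else 0,
      if j = -4 then k$4 else 0, if j = -4 then k$5 else 0, if j = -4 then k$6 else 0,
      if j = -5 then k$7 else 0, if j = -5 then k$8 else 0],
     if j = 0 then a else 0, if j = -1 then c else 0, if j = -1 then d else 0))"

lemma weight_part_in_weight_space: "weight_part j p \<in> weight_space j"
  by (cases p) (simp add: weight_part_def weight_space_def)

lemma weights: "{-5..0::int} = {-5, -4, -3, -2, -1, 0}"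
  by (rule set_eqI) (simp, presburger)

lemma sum_weight_part: "(\<Sum>j=-5..0. weight_part j p) = p"
  unfolding weights by (cases p) (simp add: weight_part_def vec8_eq_iff)

text \<open>
  Outside the six weights the spaces are zero; the remaining cases are checked one by one.
\<close>

lemma bracket_weight_space:
  assumes "p \<in> weight_space i" "q \<in> weight_space j"
  shows "bracket p q \<in> weight_space (i + j)"
proof -
  have trivial: "weight_space i = {0}" if "i \<notin> {-5..0}" for i
    using that unfolding weights by (auto simp: weight_space_def zero_prod_def vec8_eq_iff)
  have zero: "bracket 0 q = 0" "bracket p 0 = 0" for p q
    by (cases p, cases q, simp add: bracket_def zero_prod_def vec8_eq_iff)+
  show ?thesis
  proof (cases "i \<in> {-5..0} \<and> j \<in> {-5..0}")
    case False
    then have "p = 0 \<or> q = 0" using trivial[of i] trivial[of j] assms by blast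
    then show ?thesis
      using subspace_0[OF subspace_weight_space, of "i + j"] zero(1)[of q] zero(2)[of p] by presburger
  next
    case True
    obtain k a c d k' a' c' d' where pq: "p = (k, a, c, d)" "q = (k', a', c', d')"
      by (cases p, cases q) auto
    from True[unfolded weights] assms show ?thesis
      unfolding pq by (elim conjE insertE emptyE; simp add: weight_space_def bracket_def)
  qed
qed

lemma tanaka_graded_aut_CR_M3: "tanaka_graded (aut_CR M3) (-5) 0 gg"
  unfolding tanaka_graded_def
proof (intro conjI allI impI ballI)
  show "real_lie_algebra (aut_CR M3)" by (rule real_lie_algebra_aut_CR_M3)
  show "subspace (gg j)" for j
    unfolding gg_eq by (intro linear_subspace_image linear_symmetry subspace_weight_space)
  show "gg j = {0}" if "j \<notin> {-5..0}" for j
    using that by (auto simp: gg_def)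
  show "aut_CR M3 = {\<Sum>j = - 5..0. x j |x. \<forall>j\<in>{- 5..0}. x j \<in> gg j}"
  proof (intro equalityI subsetI)
    fix X assume "X \<in> aut_CR M3"
    then obtain p where "X = symmetry p" unfolding aut_CR_M3 by blast
    then have "X = (\<Sum>j=-5..0. symmetry (weight_part j p))"
      by (simp add: sum_weight_part flip: linear_sum[OF linear_symmetry])
    moreover have "\<forall>j\<in>{-5..0}. symmetry (weight_part j p) \<in> gg j"
      using weight_part_in_weight_space gg_eq by blast
    ultimately show "X \<in> {\<Sum>j = - 5..0. x j |x. \<forall>j\<in>{- 5..0}. x j \<in> gg j}"
      by blast
  next
    fix X assume "X \<in> {\<Sum>j = - 5..0. x j |x. \<forall>j\<in>{- 5..0}. x j \<in> gg j}"
    then obtain x where X: "X = (\<Sum>j=-5..0. x j)" and x: "\<forall>j\<in>{-5..0}. x j \<in> gg j" by blast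
    have "subspace (aut_CR M3)"
      unfolding aut_CR_M3 by (intro linear_subspace_image linear_symmetry subspace_UNIV)
    then show "X \<in> aut_CR M3"
      unfolding X by (rule subspace_sum) (use x gg_eq aut_CR_M3 in blast)
  qed
  show "x j = 0" if x: "(\<forall>j\<in>{-5..0}. x j \<in> gg j) \<and> (\<Sum>j=-5..0. x j) = 0" and j: "j \<in> {-5..0}" for x j
  proof -
    have "\<forall>j. \<exists>y. j \<in> {-5..0} \<longrightarrow> y \<in> weight_space j \<and> x j = symmetry y"
      using x unfolding gg_eq by blast
    then obtain y where y: "\<And>j. j \<in> {-5..0} \<Longrightarrow> y j \<in> weight_space j \<and> x j = symmetry (y j)"
      by metis
    have "(\<Sum>j=-5..0. x j) = (\<Sum>j=-5..0. symmetry (y j))"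
      using y by (intro sum.cong) auto
    then have "symmetry (\<Sum>j=-5..0. y j) = symmetry 0"
      using x by (simp add: linear_sum[OF linear_symmetry] linear_0[OF linear_symmetry])
    then have sum0: "(\<Sum>j=-5..0. y j) = 0"
      using inj_symmetry by (auto dest: injD)
    have y_weights: "y (-5) \<in> weight_space (-5)" "y (-4) \<in> weight_space (-4)" "y (-3) \<in> weight_space (-3)" "y (-2) \<in> weight_space (-2)" "y (-1) \<in> weight_space (-1)" "y 0 \<in> weight_space 0"
      using y by auto
    have "y j = 0"
      using j sum0 y_weights unfolding weights
      by (auto simp: weight_space_def zero_prod_def vec8_eq_iff prod_eq_iff split_beta)
    then show ?thesis
      using y[OF j] by (simp add: linear_0[OF linear_symmetry])
  qed
  show "lie_bracket x y \<in> gg (i + j)" if "x \<in> gg i" "y \<in> gg j" for i j x y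
    using that unfolding gg_eq by (auto simp: lie_bracket_symmetry intro: bracket_weight_space)
qed

section \<open>Commutators and conclusion\<close>

lemma commuting_translations:
  assumes "i \<in> {1..8}" "j \<in> {1..8}"
  shows "lie_bracket (XX i) (XX j) = 0"
proof -
  have "bracket (basis_param i) (basis_param j) = 0"
    using assms by (simp add: basis_param_def bracket_def vec8_eq_iff zero_prod_def)
  then show ?thesis
    using assms by (simp add: XX_eq_symmetry lie_bracket_symmetry linear_0[OF linear_symmetry])
qed

lemma symmetry_eq_0_iff: "symmetry p = 0 \<longleftrightarrow> p = 0"
  using inj_eq[OF inj_symmetry, of p 0] by (simp add: linear_0[OF linear_symmetry])

lemmas pull_back_to_parameters = XX_eq_symmetry lie_bracket_symmetry inj_eq[OF inj_symmetry] symmetry_eq_0_iff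
  linear_add[OF linear_symmetry, symmetric] linear_diff[OF linear_symmetry, symmetric]
  linear_scale[OF linear_symmetry, symmetric] linear_neg[OF linear_symmetry, symmetric]

lemmas compute_in_parameters = basis_param_def bracket_def zero_prod_def vec8_eq_iff axis_def

lemma commutators:
  "lie_bracket (XX 1) (XX 9) = 2 *\<^sub>R XX 1"
  "lie_bracket (XX 1) (XX 10) = 4 *\<^sub>R XX 2"
  "lie_bracket (XX 1) (XX 11) = 4 *\<^sub>R XX 3"
  "lie_bracket (XX 2) (XX 9) = 3 *\<^sub>R XX 2"
  "lie_bracket (XX 2) (XX 10) = 3 *\<^sub>R XX 4 + 2 *\<^sub>R XX 6"
  "lie_bracket (XX 2) (XX 11) = 3 *\<^sub>R XX 5"
  "lie_bracket (XX 3) (XX 9) = 3 *\<^sub>R XX 3"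
  "lie_bracket (XX 3) (XX 10) = 3 *\<^sub>R XX 5"
  "lie_bracket (XX 3) (XX 11) = - 3 *\<^sub>R XX 4 + 2 *\<^sub>R XX 6"
  "lie_bracket (XX 4) (XX 9) = 4 *\<^sub>R XX 4"
  "lie_bracket (XX 4) (XX 10) = 2 *\<^sub>R XX 7 + 4 *\<^sub>R XX 8"
  "lie_bracket (XX 4) (XX 11) = 0"
  "lie_bracket (XX 5) (XX 9) = 4 *\<^sub>R XX 5"
  "lie_bracket (XX 5) (XX 10) = 0"
  "lie_bracket (XX 5) (XX 11) = 2 *\<^sub>R XX 7 - 4 *\<^sub>R XX 8"
  "lie_bracket (XX 6) (XX 9) = 4 *\<^sub>R XX 6"
  "lie_bracket (XX 6) (XX 10) = 6 *\<^sub>R XX 7"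
  "lie_bracket (XX 6) (XX 11) = 0"
  "lie_bracket (XX 7) (XX 9) = 5 *\<^sub>R XX 7"
  "lie_bracket (XX 8) (XX 9) = 5 *\<^sub>R XX 8"
  "lie_bracket (XX 7) (XX 10) = 0"
  "lie_bracket (XX 7) (XX 11) = 0"
  "lie_bracket (XX 8) (XX 10) = 0"
  "lie_bracket (XX 8) (XX 11) = 0"
  "lie_bracket (XX 9) (XX 10) = - XX 10"
  "lie_bracket (XX 9) (XX 11) = - XX 11"
  "lie_bracket (XX 10) (XX 11) = 4 *\<^sub>R XX 1"
  by (simp add: pull_back_to_parameters, simp add: compute_in_parameters)+

lemma aut_CR_M3_general_field:
  "aut_CR M3 = {vf_germ (general_field k a c d) | k a c d. True}"
  by (auto simp: aut_CR_M3 symmetry_def symmetry_field_def image_iff, blast)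

theorem theorem5p3:
  shows "real_lie_algebra (aut_CR M3) \<and>
    dim (aut_CR M3) = 11 \<and>
    aut_CR M3 = {vf_germ (general_field k a c d) | (k :: real ^ 8) (a :: real) (c :: real) (d :: real). True} \<and>
    inj_on XX {1..11} \<and> independent (XX ` {1..11}) \<and> span (XX ` {1..11}) = aut_CR M3 \<and>
    tanaka_graded (aut_CR M3) (-5) 0 gg \<and>
    (\<forall>i\<in>{1..8}. \<forall>j\<in>{1..8}. lie_bracket (XX i) (XX j) = 0) \<and>
    lie_bracket (XX 1) (XX 9) = 2 *\<^sub>R XX 1 \<and>
    lie_bracket (XX 1) (XX 10) = 4 *\<^sub>R XX 2 \<and>
    lie_bracket (XX 1) (XX 11) = 4 *\<^sub>R XX 3 \<and>
    lie_bracket (XX 2) (XX 9) = 3 *\<^sub>R XX 2 \<and>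
    lie_bracket (XX 2) (XX 10) = 3 *\<^sub>R XX 4 + 2 *\<^sub>R XX 6 \<and>
    lie_bracket (XX 2) (XX 11) = 3 *\<^sub>R XX 5 \<and>
    lie_bracket (XX 3) (XX 9) = 3 *\<^sub>R XX 3 \<and>
    lie_bracket (XX 3) (XX 10) = 3 *\<^sub>R XX 5 \<and>
    lie_bracket (XX 3) (XX 11) = - 3 *\<^sub>R XX 4 + 2 *\<^sub>R XX 6 \<and>
    lie_bracket (XX 4) (XX 9) = 4 *\<^sub>R XX 4 \<and>
    lie_bracket (XX 4) (XX 10) = 2 *\<^sub>R XX 7 + 4 *\<^sub>R XX 8 \<and>
    lie_bracket (XX 4) (XX 11) = 0 \<and>
    lie_bracket (XX 5) (XX 9) = 4 *\<^sub>R XX 5 \<and>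
    lie_bracket (XX 5) (XX 10) = 0 \<and>
    lie_bracket (XX 5) (XX 11) = 2 *\<^sub>R XX 7 - 4 *\<^sub>R XX 8 \<and>
    lie_bracket (XX 6) (XX 9) = 4 *\<^sub>R XX 6 \<and>
    lie_bracket (XX 6) (XX 10) = 6 *\<^sub>R XX 7 \<and>
    lie_bracket (XX 6) (XX 11) = 0 \<and>
    lie_bracket (XX 7) (XX 9) = 5 *\<^sub>R XX 7 \<and>
    lie_bracket (XX 8) (XX 9) = 5 *\<^sub>R XX 8 \<and>
    lie_bracket (XX 7) (XX 10) = 0 \<and>
    lie_bracket (XX 7) (XX 11) = 0 \<and>
    lie_bracket (XX 8) (XX 10) = 0 \<and>
    lie_bracket (XX 8) (XX 11) = 0 \<and>
    lie_bracket (XX 9) (XX 10) = - XX 10 \<and>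
    lie_bracket (XX 9) (XX 11) = - XX 11 \<and>
    lie_bracket (XX 10) (XX 11) = 4 *\<^sub>R XX 1"
  by (intro conjI real_lie_algebra_aut_CR_M3 dim_aut_CR_M3 aut_CR_M3_general_field independent_XX
      tanaka_graded_aut_CR_M3 commutators ballI commuting_translations) assumption+

end
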